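(* (1) $\mathcal B=\{b\in\mathcal A_\infty:\mathcal E_\infty[b]<+\infty\}$ is an algebra and is complete for the norm $\left(\|b\|^2_{L^2(\tau)}+\mathcal E_\infty[b]\right)^{1/2}$. (2) $\mathcal E_\infty$ is a symmetric Dirichlet form on $L^2(\mathcal A_\infty,\tau)$. (3) The associated Dirichlet algebra and Dirichlet space coincide and are equal to $\mathcal B$.
   Context: Indices $j\in\{1,2,3\}$ are taken mod $3$. $M_3(\mathbb C)$ has matrix units $e_{ij}$, and $\mathbb C^3$ is identified with its diagonal subalgebra. $\mathrm{UHF}(3^\infty)$ is the $C^*$-inductive limit of $M_3(\mathbb C)^{\otimes n}$ under $x\mapsto x\otimes I_3$; each $M_3(\mathbb C)^{\otimes n}$ is regarded as a unital subalgebra of it. For $n\ge0$ put $\alpha^n_j=e_{jj}\otimes e_{22}^{\otimes n}\in M_3(\mathbb C)^{\otimes(n+1)}$, and for $k\ge1$ put $\beta^k_j=(e_{jj}\otimes e_{11}+e_{j+2,j+2}\otimes e_{33})\otimes e_{22}^{\otimes(k-1)}\in M_3(\mathbb C)^{\otimes(k+1)}$. The finite-dimensional $*$-algebra $\mathcal A_n\subset M_3(\mathbb C)^{\otimes n}\otimes\mathbb C^3\subset M_3(\mathbb C)^{\otimes(n+1)}$ is the linear span of the $\alpha^n_j$ and of the $x\otimes\beta^k_j$ with $j=1,2,3$, $k=1,\dots,n$, $x\in M_3(\mathbb C)^{\otimes(n-k)}$. $\mathcal A_\infty$ is the $C^*$-subalgebra of $\mathrm{UHF}(3^\infty)$ of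 all norm limits $\lim_n a_n$ with $a_n\in\mathcal A_n$. The slice map $\rho_m:\mathrm{UHF}(3^\infty)\to M_3(\mathbb C)^{\otimes(m+1)}$, identity on the first $m+1$ tensor factors and applying the state $x\mapsto x_{22}$ to each of the others, restricts to a $*$-homomorphism $\rho_m:\mathcal A_\infty\to\mathcal A_m$. An element $b\in M_3(\mathbb C)^{\otimes n}\otimes\mathbb C^3$ is written $b=\sum_i b(v_i)\otimes e_{ii}$ with $b(v_i)\in M_3(\mathbb C)^{\otimes n}$. For $b\in\mathcal A_n$, $\mathcal E_n[b]=\sum_{i\ne j}\mathrm{Tr}\big(|b(v_i)-b(v_j)|^2\big)$, where $\mathrm{Tr}$ is the unnormalized trace on $M_3(\mathbb C)^{\otimes n}$. For $b\in\mathcal A_\infty$, $\mathcal E_\infty[b]=\lim_m(5/3)^m\mathcal E_m[\rho_m(b)]\in[0,+\infty]$ (the sequence is nondecreasing). $\tau$ is the restriction to $\mathcal A_\infty$ of the normalized trace of $\mathrm{UHF}(3^\infty)$ (it is faithful), $L^2(\mathcal A_\infty,\tau)$ is its GNS Hilbert space, in which $\mathcal A_\infty$ is regarded as a dense subspace, with $\|b\|_{L^2(\tau)}^2=\tau(b^*b)$. $\mathcal E_\infty$ is regarded as a form on $L^2(\mathcal A_\infty,\tau)$ with domain $\mathcal B$ (value $+\infty$ off $\mathcal B$). A symmetric Dirichlet form on $L^2(\mathcal A_\infty,\tau)$ is a densely defined, closed (lower semicontinuous), nonnegative quadratic form $\mathcal E$ that is real ($\mathcal E[a^*]=\mathcal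 E[a]$, with $*$ extended to $L^2$) and Markovian ($\mathcal E[a\wedge1]\le\mathcal E[a]$ for $a=a^*$ in $L^2$, where $a\wedge1$ is the Hilbert-space projection of $a$ onto the closed convex set of self-adjoint $h\in L^2$ with $h\le1$). Its Dirichlet space is its domain in $L^2(\mathcal A_\infty,\tau)$, and its Dirichlet algebra is the intersection of its domain with $\mathcal A_\infty$. *)

theory Defs
  imports
    "HOL-Analysis.Elementary_Topology"
    "HOL-Analysis.Inner_Product"
    "HOL-Library.Extended_Real"
    "Jordan_Normal_Form.Schur_Decomposition"
begin

section \<open>Unital C*-algebras and complex Hilbert spaces\<close>

class complex_vec = real_vector +
  fixes scaleC :: "complex \<Rightarrow> 'a \<Rightarrow> 'a"  (infixr \<open>*\<^sub>C\<close> 75)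
  assumes scaleC_add_right: "c *\<^sub>C (x + y) = c *\<^sub>C x + c *\<^sub>C y"
    and scaleC_add_left: "(c + d) *\<^sub>C x = c *\<^sub>C x + d *\<^sub>C x"
    and scaleC_scaleC: "c *\<^sub>C (d *\<^sub>C x) = (c * d) *\<^sub>C x"
    and scaleC_of_real: "complex_of_real r *\<^sub>C x = r *\<^sub>R x"

class cstar_algebra_1 = complex_vec + banach + real_normed_algebra_1 +
  fixes adj :: "'a \<Rightarrow> 'a"
  assumes mult_scaleC_left: "(c *\<^sub>C x) * y = c *\<^sub>C (x * y)"
    and mult_scaleC_right: "x * (c *\<^sub>C y) = c *\<^sub>C (x * y)"
    and norm_scaleC: "norm (c *\<^sub>C x) = cmod c * norm x"
    and adj_adj: "adj (adj x) = x"
    and adj_add: "adj (x + y) = adj x + adj y"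
    and adj_scaleC: "adj (c *\<^sub>C x) = cnj c *\<^sub>C adj x"
    and adj_mult: "adj (x * y) = adj y * adj x"
    and cstar_identity: "norm (adj x * x) = (norm x)\<^sup>2"

text \<open>The complex inner product is conjugate linear in its first argument.\<close>

class complex_hilbert = complex_vec + real_inner + complete_space +
  fixes cinner :: "'a \<Rightarrow> 'a \<Rightarrow> complex"
  assumes cinner_add_right: "cinner x (y + z) = cinner x y + cinner x z"
    and cinner_scaleC_right: "cinner x (c *\<^sub>C y) = c * cinner x y"
    and cinner_commute: "cinner y x = cnj (cinner x y)"
    and inner_eq_Re_cinner: "inner x y = Re (cinner x y)"

section \<open>Matrices\<close>

text \<open>The algebra of n-fold tensors over 3-by-3 matrices is realised as
  \<open>carrier_mat (3^n) (3^n)\<close> through the Kronecker product \<open>tensor\<close>; the last tensor factor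
  corresponds to the least significant base-3 digit of a row or column number.\<close>

definition tensor :: "complex mat \<Rightarrow> complex mat \<Rightarrow> complex mat"  (infixl \<open>\<otimes>\<^sub>m\<close> 70) where
  "A \<otimes>\<^sub>m B = mat (dim_row A * dim_row B) (dim_col A * dim_col B)
     (\<lambda>(i, j). A $$ (i div dim_row B, j div dim_col B) * B $$ (i mod dim_row B, j mod dim_col B))"

primrec tensor_pow :: "complex mat \<Rightarrow> nat \<Rightarrow> complex mat" where
  "tensor_pow A 0 = 1\<^sub>m 1"
| "tensor_pow A (Suc n) = tensor_pow A n \<otimes>\<^sub>m A"

text \<open>The row (counted from 0) belonging to an index in \<open>{1, 2, 3}\<close> taken modulo 3.\<close>

definition row_of :: "nat \<Rightarrow> nat" where
  "row_of j = (j + 2) mod 3"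

definition munit :: "nat \<Rightarrow> nat \<Rightarrow> complex mat" where
  "munit i j = mat 3 3 (\<lambda>(k, l). if k = row_of i \<and> l = row_of j then 1 else 0)"

definition mtrace :: "complex mat \<Rightarrow> complex" where
  "mtrace A = (\<Sum>i<dim_row A. A $$ (i, i))"

definition mat_norm :: "complex mat \<Rightarrow> real" where
  "mat_norm A = (SUP v \<in> {v \<in> carrier_vec (dim_col A). Re (v \<bullet>c v) \<le> 1}.
     sqrt (Re ((A *\<^sub>v v) \<bullet>c (A *\<^sub>v v))))"

text \<open>The coefficient of \<open>munit i i\<close> in the last tensor factor, i.e. \<open>b(v_i)\<close>. For \<open>i = 2\<close> this
  is the slice map applying the state \<open>x \<mapsto> x_22\<close> to the last tensor factor.\<close>

definition comp_at :: "complex mat \<Rightarrow> nat \<Rightarrow> complex mat" where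
  "comp_at b i = mat (dim_row b div 3) (dim_col b div 3)
     (\<lambda>(s, t). b $$ (3 * s + row_of i, 3 * t + row_of i))"

section \<open>The algebra UHF(3^infinity), its trace and its slice maps\<close>

text \<open>\<open>\<iota>\<close> exhibits the C*-algebra \<open>'u\<close> as the C*-inductive limit of the matrix algebras
  under \<open>x \<mapsto> x \<otimes> 1\<close>.\<close>

definition is_uhf3 :: "(nat \<Rightarrow> complex mat \<Rightarrow> 'u::cstar_algebra_1) \<Rightarrow> bool" where
  "is_uhf3 \<iota> \<longleftrightarrow>
     (\<forall>n. \<iota> n (1\<^sub>m (3 ^ n)) = 1) \<and>
     (\<forall>n. \<forall>x \<in> carrier_mat (3 ^ n) (3 ^ n).
        \<iota> n (mat_adjoint x) = adj (\<iota> n x) \<and>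
        norm (\<iota> n x) = mat_norm x \<and>
        \<iota> (Suc n) (x \<otimes>\<^sub>m 1\<^sub>m 3) = \<iota> n x \<and>
        (\<forall>c. \<iota> n (c \<cdot>\<^sub>m x) = c *\<^sub>C \<iota> n x) \<and>
        (\<forall>y \<in> carrier_mat (3 ^ n) (3 ^ n).
           \<iota> n (x + y) = \<iota> n x + \<iota> n y \<and> \<iota> n (x * y) = \<iota> n x * \<iota> n y)) \<and>
     closure (\<Union>n. \<iota> n ` carrier_mat (3 ^ n) (3 ^ n)) = UNIV"

text \<open>Continuous extension to the limit algebra of a functional given by \<open>F n\<close> on the
  \<open>n\<close>-fold tensors (for all large \<open>n\<close>).\<close>

definition extend_functional ::
  "(nat \<Rightarrow> complex mat \<Rightarrow> 'u::cstar_algebra_1) \<Rightarrow> (nat \<Rightarrow> complex mat \<Rightarrow> complex) \<Rightarrow> 'u \<Rightarrow> complex"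
where
  "extend_functional \<iota> F a = (THE t. \<forall>x. (\<forall>n. x n \<in> carrier_mat (3 ^ n) (3 ^ n)) \<longrightarrow>
     (\<lambda>n. \<iota> n (x n)) \<longlonglongrightarrow> a \<longrightarrow> (\<lambda>n. F n (x n)) \<longlonglongrightarrow> t)"

definition uhf_trace :: "(nat \<Rightarrow> complex mat \<Rightarrow> 'u::cstar_algebra_1) \<Rightarrow> 'u \<Rightarrow> complex" where
  "uhf_trace \<iota> = extend_functional \<iota> (\<lambda>n x. mtrace x / 3 ^ n)"

text \<open>\<open>slice \<iota> m\<close> is \<open>\<rho>_m\<close>, given entrywise. An element of the \<open>n\<close>-fold tensors, \<open>n \<ge> m + 1\<close>, is
  sliced \<open>n - (m + 1)\<close> times.\<close>

definition slice :: "(nat \<Rightarrow> complex mat \<Rightarrow> 'u::cstar_algebra_1) \<Rightarrow> nat \<Rightarrow> 'u \<Rightarrow> complex mat" where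
  "slice \<iota> m a = mat (3 ^ Suc m) (3 ^ Suc m) (\<lambda>(i, j).
     extend_functional \<iota> (\<lambda>n x. ((\<lambda>b. comp_at b 2) ^^ (n - Suc m)) x $$ (i, j)) a)"

section \<open>The algebras \<open>A_n\<close> and \<open>A_infinity\<close> and the energy\<close>

definition alpha :: "nat \<Rightarrow> nat \<Rightarrow> complex mat" where
  "alpha n j = munit j j \<otimes>\<^sub>m tensor_pow (munit 2 2) n"

definition beta :: "nat \<Rightarrow> nat \<Rightarrow> complex mat" where
  "beta k j = (munit j j \<otimes>\<^sub>m munit 1 1 + munit (j + 2) (j + 2) \<otimes>\<^sub>m munit 3 3)
     \<otimes>\<^sub>m tensor_pow (munit 2 2) (k - 1)"

inductive_set A_fin :: "nat \<Rightarrow> complex mat set" for n :: nat where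
  zero: "0\<^sub>m (3 ^ Suc n) (3 ^ Suc n) \<in> A_fin n"
| alpha: "j \<in> {1, 2, 3} \<Longrightarrow> alpha n j \<in> A_fin n"
| beta: "\<lbrakk>j \<in> {1, 2, 3}; k \<in> {1..n}; x \<in> carrier_mat (3 ^ (n - k)) (3 ^ (n - k))\<rbrakk>
    \<Longrightarrow> x \<otimes>\<^sub>m beta k j \<in> A_fin n"
| add: "\<lbrakk>a \<in> A_fin n; b \<in> A_fin n\<rbrakk> \<Longrightarrow> a + b \<in> A_fin n"
| smult: "a \<in> A_fin n \<Longrightarrow> c \<cdot>\<^sub>m a \<in> A_fin n"

definition A_inf :: "(nat \<Rightarrow> complex mat \<Rightarrow> 'u::cstar_algebra_1) \<Rightarrow> 'u set" where
  "A_inf \<iota> = {a. \<exists>x. (\<forall>n. x n \<in> A_fin n) \<and> (\<lambda>n. \<iota> (Suc n) (x n)) \<longlonglongrightarrow> a}"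

definition energy :: "complex mat \<Rightarrow> real" where
  "energy b = (\<Sum>(i, j) \<in> {(i, j). i \<in> {1, 2, 3} \<and> j \<in> {1, 2, 3} \<and> i \<noteq> j}.
     Re (mtrace (mat_adjoint (comp_at b i - comp_at b j) * (comp_at b i - comp_at b j))))"

definition energy_inf :: "(nat \<Rightarrow> complex mat \<Rightarrow> 'u::cstar_algebra_1) \<Rightarrow> 'u \<Rightarrow> ereal" where
  "energy_inf \<iota> b = lim (\<lambda>m. ereal ((5 / 3) ^ m * energy (slice \<iota> m b)))"

definition B_space :: "(nat \<Rightarrow> complex mat \<Rightarrow> 'u::cstar_algebra_1) \<Rightarrow> 'u set" where
  "B_space \<iota> = {b \<in> A_inf \<iota>. energy_inf \<iota> b < \<infinity>}"

definition B_norm :: "(nat \<Rightarrow> complex mat \<Rightarrow> 'u::cstar_algebra_1) \<Rightarrow> 'u \<Rightarrow> real" where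
  "B_norm \<iota> b = sqrt (Re (uhf_trace \<iota> (adj b * b)) + real_of_ereal (energy_inf \<iota> b))"

definition is_subalgebra :: "'u::cstar_algebra_1 set \<Rightarrow> bool" where
  "is_subalgebra S \<longleftrightarrow> 0 \<in> S \<and> (\<forall>x\<in>S. \<forall>y\<in>S. x + y \<in> S \<and> x * y \<in> S) \<and> (\<forall>c. \<forall>x\<in>S. c *\<^sub>C x \<in> S)"

definition is_norm_on :: "'u::cstar_algebra_1 set \<Rightarrow> ('u \<Rightarrow> real) \<Rightarrow> bool" where
  "is_norm_on S N \<longleftrightarrow>
     (\<forall>x\<in>S. 0 \<le> N x \<and> (N x = 0 \<longleftrightarrow> x = 0)) \<and>
     (\<forall>c. \<forall>x\<in>S. N (c *\<^sub>C x) = cmod c * N x) \<and>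
     (\<forall>x\<in>S. \<forall>y\<in>S. N (x + y) \<le> N x + N y)"

definition complete_for :: "'u::cstar_algebra_1 set \<Rightarrow> ('u \<Rightarrow> real) \<Rightarrow> bool" where
  "complete_for S N \<longleftrightarrow>
     (\<forall>X. (\<forall>n. X n \<in> S) \<longrightarrow> (\<forall>e>0. \<exists>K. \<forall>m\<ge>K. \<forall>n\<ge>K. N (X m - X n) < e) \<longrightarrow>
        (\<exists>x\<in>S. (\<lambda>n. N (X n - x)) \<longlonglongrightarrow> 0))"

section \<open>GNS spaces and symmetric Dirichlet forms\<close>

text \<open>\<open>\<Lambda>\<close> exhibits the Hilbert space \<open>'h\<close> as the GNS space \<open>L^2(A, \<tau>)\<close> of the C*-subalgebra \<open>A\<close>;
  only the values of \<open>\<Lambda>\<close> on \<open>A\<close> matter.\<close>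

definition is_gns ::
  "'u::cstar_algebra_1 set \<Rightarrow> ('u \<Rightarrow> complex) \<Rightarrow> ('u \<Rightarrow> 'h::complex_hilbert) \<Rightarrow> bool" where
  "is_gns A \<tau> \<Lambda> \<longleftrightarrow>
     (\<forall>a\<in>A. \<forall>b\<in>A. \<Lambda> (a + b) = \<Lambda> a + \<Lambda> b) \<and>
     (\<forall>c. \<forall>a\<in>A. \<Lambda> (c *\<^sub>C a) = c *\<^sub>C \<Lambda> a) \<and>
     (\<forall>a\<in>A. \<forall>b\<in>A. cinner (\<Lambda> a) (\<Lambda> b) = \<tau> (adj a * b)) \<and>
     closure (\<Lambda> ` A) = UNIV"

definition L2_adj :: "'u::cstar_algebra_1 set \<Rightarrow> ('u \<Rightarrow> 'h::complex_hilbert) \<Rightarrow> 'h \<Rightarrow> 'h" where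
  "L2_adj A \<Lambda> \<xi> = (THE \<eta>. \<forall>x. (\<forall>n. x n \<in> A) \<longrightarrow> (\<lambda>n. \<Lambda> (x n)) \<longlonglongrightarrow> \<xi> \<longrightarrow>
     (\<lambda>n. \<Lambda> (adj (x n))) \<longlonglongrightarrow> \<eta>)"

definition L2_pos :: "'u::cstar_algebra_1 set \<Rightarrow> ('u \<Rightarrow> 'h::complex_hilbert) \<Rightarrow> 'h set" where
  "L2_pos A \<Lambda> = closure ((\<lambda>a. \<Lambda> (adj a * a)) ` A)"

definition L2_le_one :: "'u::cstar_algebra_1 set \<Rightarrow> ('u \<Rightarrow> 'h::complex_hilbert) \<Rightarrow> 'h set" where
  "L2_le_one A \<Lambda> = {h. L2_adj A \<Lambda> h = h \<and> \<Lambda> 1 - h \<in> L2_pos A \<Lambda>}"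

text \<open>The metric projection onto \<open>K\<close> (the library's \<open>closest_point\<close> requires \<open>heine_borel\<close>).\<close>

definition hilbert_proj :: "'h::complex_hilbert set \<Rightarrow> 'h \<Rightarrow> 'h" where
  "hilbert_proj K \<xi> = (THE h. h \<in> K \<and> (\<forall>k\<in>K. dist \<xi> h \<le> dist \<xi> k))"

definition wedge_one :: "'u::cstar_algebra_1 set \<Rightarrow> ('u \<Rightarrow> 'h::complex_hilbert) \<Rightarrow> 'h \<Rightarrow> 'h" where
  "wedge_one A \<Lambda> = hilbert_proj (L2_le_one A \<Lambda>)"

definition form_domain :: "('h \<Rightarrow> ereal) \<Rightarrow> 'h set" where
  "form_domain F = {\<xi>. F \<xi> < \<infinity>}"

definition is_quadratic_form :: "('h::complex_hilbert \<Rightarrow> ereal) \<Rightarrow> bool" where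
  "is_quadratic_form F \<longleftrightarrow> (let D = form_domain F in
     0 \<in> D \<and> (\<forall>\<xi>\<in>D. \<forall>\<eta>\<in>D. \<xi> + \<eta> \<in> D) \<and> (\<forall>c. \<forall>\<xi>\<in>D. c *\<^sub>C \<xi> \<in> D) \<and>
     (\<exists>S :: 'h \<Rightarrow> 'h \<Rightarrow> complex.
        (\<forall>\<xi>\<in>D. \<forall>\<eta>\<in>D. \<forall>\<zeta>\<in>D. S \<xi> (\<eta> + \<zeta>) = S \<xi> \<eta> + S \<xi> \<zeta>) \<and>
        (\<forall>c. \<forall>\<xi>\<in>D. \<forall>\<eta>\<in>D. S \<xi> (c *\<^sub>C \<eta>) = c * S \<xi> \<eta>) \<and>
        (\<forall>\<xi>\<in>D. \<forall>\<eta>\<in>D. S \<eta> \<xi> = cnj (S \<xi> \<eta>)) \<and>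
        (\<forall>\<xi>\<in>D. F \<xi> = ereal (Re (S \<xi> \<xi>)))))"

definition is_symmetric_dirichlet_form ::
  "'u::cstar_algebra_1 set \<Rightarrow> ('u \<Rightarrow> 'h::complex_hilbert) \<Rightarrow> ('h \<Rightarrow> ereal) \<Rightarrow> bool" where
  "is_symmetric_dirichlet_form A \<Lambda> F \<longleftrightarrow>
     closure (form_domain F) = UNIV \<and>
     is_quadratic_form F \<and>
     (\<forall>\<xi>. 0 \<le> F \<xi>) \<and>
     (\<forall>X \<xi>. X \<longlonglongrightarrow> \<xi> \<longrightarrow> F \<xi> \<le> liminf (\<lambda>n. F (X n))) \<and>
     (\<forall>\<xi>. F (L2_adj A \<Lambda> \<xi>) = F \<xi>) \<and>
     (\<forall>\<xi>. L2_adj A \<Lambda> \<xi> = \<xi> \<longrightarrow> F (wedge_one A \<Lambda> \<xi>) \<le> F \<xi>)"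

definition dirichlet_space :: "('h \<Rightarrow> ereal) \<Rightarrow> 'h set" where
  "dirichlet_space F = form_domain F"

text \<open>The intersection of the domain with \<open>A\<close>, as a subset of \<open>A\<close>.\<close>

definition dirichlet_algebra :: "'u set \<Rightarrow> ('u \<Rightarrow> 'h) \<Rightarrow> ('h \<Rightarrow> ereal) \<Rightarrow> 'u set" where
  "dirichlet_algebra A \<Lambda> F = {a \<in> A. \<Lambda> a \<in> form_domain F}"

definition energy_L2 ::
  "(nat \<Rightarrow> complex mat \<Rightarrow> 'u::cstar_algebra_1) \<Rightarrow> ('u \<Rightarrow> 'h) \<Rightarrow> 'h \<Rightarrow> ereal" where
  "energy_L2 \<iota> \<Lambda> \<xi> = (if \<xi> \<in> \<Lambda> ` B_space \<iota>
     then energy_inf \<iota> (THE b. b \<in> A_inf \<iota> \<and> \<Lambda> b = \<xi>) else \<infinity>)"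

end

theory Submission
  imports Defs "HOL-Analysis.L2_Norm" "HOL-Analysis.Elementary_Metric_Spaces"
    "HOL-Computational_Algebra.Formal_Power_Series"
begin

text \<open>An element \<open>b\<close> of \<open>A_(n+1)\<close> consists of \<open>b(v_2)\<close>, an element of \<open>A_n\<close> with components \<open>a_j\<close>, and
  of matrices \<open>x_j\<close> at three new vertices. Its energy is \<open>2 \<Sum>_j |x_j - a_j|\<^sup>2 + |x_(j+1) - a_j|\<^sup>2 + |x_j - x_(j+1)|\<^sup>2\<close>
  in the Hilbert-Schmidt norm, which is the energy of the Sierpinski gasket with matrix values; its
  minimum over \<open>x\<close> is \<open>3/5\<close> of the energy of \<open>a\<close>, attained at the harmonic extension.

  Since the operator norm is bounded by the Hilbert-Schmidt norm, the increments
  \<open>\<rho>_(m+1)(b) - \<rho>_m(b)\<close> have norm at most \<open>(3/5)^(m/2)\<close> times the root of the energy. Elements of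
  bounded energy are thus uniformly approximated by their slices, and on slices the operator norm is
  controlled by the \<open>L\<^sup>2\<close> norm; hence an \<open>L\<^sup>2\<close> Cauchy sequence of bounded energy is norm Cauchy. This
  gives completeness, lower semicontinuity and the inclusion of the form domain in \<open>A_\<infinity>\<close>. Harmonic
  extensions of slices give density.

  For the Markov property write \<open>1 - b = p - q\<close> with \<open>p = s\<^sup>2\<close>, \<open>q = t\<^sup>2\<close> and \<open>p q = 0\<close>. Then \<open>b \<and> 1 = 1 - p\<close>,
  and replacing \<open>p - q\<close> by \<open>p\<close> decreases the energy because
  \<open>Tr ((p(v_i) - p(v_j)) (q(v_i) - q(v_j))) \<le> 0\<close>.\<close>

text \<open>The obstacle is the growing dimension: on \<open>M n\<close> the Hilbert-Schmidt and
  operator norms may differ by a factor \<open>sqrt (d3 n)\<close>. Increments between consecutive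
  slices are estimated in the good direction, operator norm by energy, with a rate depending on the
  energy alone; the bad direction is used only at one level m, fixed first to make the tail small.
  For density, the normalised trace divides by the very dimension that appears when an energy is
  bounded by an increment, so the L^2 error of a harmonic extension is at most a constant times the
  norm of one increment of slices, which tends to 0 for every element of \<open>A_inf\<close>.
  Positivity is handled by squares: a positive element enters as \<open>s * s\<close> with
  \<open>s\<close> self-adjoint in \<open>A_inf\<close>, because slices and components are
  multiplicative there and carry the factorisation to each vertex, where cyclicity of the trace
  turns cross terms into Hilbert-Schmidt norms. The existence of s and t rests on the binomial
  series of the square root, summable on the whole closed unit ball, and on bounds
  \<open>norm (1 - x) \<le> 1\<close> in place of spectra.\<close>

lemma row_of_simps [simp]: "row_of 1 = 0" "row_of (Suc 0) = 0" "row_of 2 = 1" "row_of 3 = 2"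
  "row_of 4 = 0" "row_of 5 = 1"
  by (simp_all add: row_of_def)

lemma row_of_less [simp]: "row_of j < 3"
  by (simp add: row_of_def)

lemma sum_lessThan_times3:
  fixes f :: "nat \<Rightarrow> 'a::comm_monoid_add"
  shows "(\<Sum>i<3 * n. f i) = (\<Sum>s<n. f (3 * s) + f (3 * s + 1) + f (3 * s + 2))"
proof (induction n)
  case (Suc n)
  have "{..<3 * Suc n} = insert (3 * n + 2) (insert (3 * n + 1) (insert (3 * n) {..<3 * n}))"
    by auto
  then have "(\<Sum>i<3 * Suc n. f i) = f (3 * n + 2) + (f (3 * n + 1) + (f (3 * n) + (\<Sum>i<3 * n. f i)))"
    by simp
  then show ?case
    using Suc by (simp add: ac_simps)
qed simp

lemma less_times3_cases:
  assumes "i < 3 * (n :: nat)"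
  obtains s p where "s < n" "p < 3" "i = 3 * s + p"
  using assms by (metis div_less_iff_less_mult mult.commute mult_div_mod_eq mod_less_divisor zero_less_numeral)

lemma less3_disj: "(p::nat) < 3 \<Longrightarrow> p = 0 \<or> p = 1 \<or> p = 2"
  by linarith

section \<open>Hilbert-Schmidt and operator norms of matrices\<close>

definition hs :: "complex mat \<Rightarrow> complex mat \<Rightarrow> complex" where
  "hs A B = (\<Sum>i<dim_row A. \<Sum>j<dim_col A. cnj (A $$ (i, j)) * B $$ (i, j))"

text \<open>The square of the Hilbert-Schmidt norm, kept without the root because it is additive
  over entries, columns and diagonal blocks; \<open>sqnorm\<close> plays the same role for
  vectors.\<close>

definition fro :: "complex mat \<Rightarrow> real" where
  "fro A = (\<Sum>i<dim_row A. \<Sum>j<dim_col A. (cmod (A $$ (i, j)))\<^sup>2)"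

definition sqnorm :: "complex vec \<Rightarrow> real" where
  "sqnorm v = (\<Sum>i<dim_vec v. (cmod (v $ i))\<^sup>2)"

lemma dim_mat_adjoint [simp]: "dim_row (mat_adjoint A) = dim_col A" "dim_col (mat_adjoint A) = dim_row A"
  by (simp_all add: mat_adjoint_def)

lemma index_mat_adjoint [simp]:
  "i < dim_col A \<Longrightarrow> j < dim_row A \<Longrightarrow> mat_adjoint A $$ (i, j) = cnj (A $$ (j, i))"
  by (simp add: mat_adjoint_def mat_of_rows_index)

lemma mat_adjoint_carrier [simp]: "A \<in> carrier_mat n m \<Longrightarrow> mat_adjoint A \<in> carrier_mat m n"
  by auto

lemma index_mult_mat_sum:
  assumes "A \<in> carrier_mat n m" "B \<in> carrier_mat m k" "i < n" "j < k"
  shows "(A * B) $$ (i, j) = (\<Sum>l<m. A $$ (i, l) * B $$ (l, j))"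
  using assms by (auto simp: scalar_prod_def atLeast0LessThan intro!: sum.cong)

lemma mat_adjoint_mult:
  assumes "A \<in> carrier_mat n m" "B \<in> carrier_mat m k"
  shows "mat_adjoint (A * B) = mat_adjoint B * mat_adjoint (A :: complex mat)"
proof (rule eq_matI)
  fix i j assume "i < dim_row (mat_adjoint B * mat_adjoint A)" "j < dim_col (mat_adjoint B * mat_adjoint A)"
  then have ij: "i < k" "j < n"
    using assms by auto
  have "mat_adjoint (A * B) $$ (i, j) = cnj ((A * B) $$ (j, i))"
    using assms ij by simp
  also have "\<dots> = (\<Sum>l<m. cnj (A $$ (j, l)) * cnj (B $$ (l, i)))"
    using index_mult_mat_sum[OF assms ij(2,1)] by simp
  also have "\<dots> = (\<Sum>l<m. mat_adjoint B $$ (i, l) * mat_adjoint A $$ (l, j))"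
    using assms ij by (intro sum.cong) auto
  also have "\<dots> = (mat_adjoint B * mat_adjoint A) $$ (i, j)"
    using index_mult_mat_sum[of "mat_adjoint B" k m "mat_adjoint A" n i j] assms ij by simp
  finally show "mat_adjoint (A * B) $$ (i, j) = (mat_adjoint B * mat_adjoint A) $$ (i, j)" .
qed (use assms in auto)

lemma mtrace_adjoint_mult:
  assumes "A \<in> carrier_mat n m" "B \<in> carrier_mat n m"
  shows "mtrace (mat_adjoint A * B) = hs A B"
proof -
  have "mtrace (mat_adjoint A * B) = (\<Sum>j<m. \<Sum>i<n. cnj (A $$ (i, j)) * B $$ (i, j))"
    unfolding mtrace_def
    using assms index_mult_mat_sum[of "mat_adjoint A" m n B m] by (auto intro!: sum.cong)
  also have "\<dots> = (\<Sum>i<n. \<Sum>j<m. cnj (A $$ (i, j)) * B $$ (i, j))"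
    by (rule sum.swap)
  finally show ?thesis
    using assms by (simp add: hs_def)
qed

lemma mtrace_commute:
  assumes "A \<in> carrier_mat n m" "B \<in> carrier_mat m n"
  shows "mtrace (A * B) = mtrace (B * A)"
proof -
  have "mtrace (A * B) = (\<Sum>i<n. \<Sum>l<m. A $$ (i, l) * B $$ (l, i))"
    unfolding mtrace_def using assms index_mult_mat_sum[OF assms] by auto
  also have "\<dots> = (\<Sum>l<m. \<Sum>i<n. B $$ (l, i) * A $$ (i, l))"
    by (subst sum.swap) (simp add: mult.commute)
  also have "\<dots> = mtrace (B * A)"
    unfolding mtrace_def using assms index_mult_mat_sum[OF assms(2,1)] by auto
  finally show ?thesis .
qed

lemma fro_nonneg [simp]: "0 \<le> fro A"
  by (auto simp: fro_def intro!: sum_nonneg)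

lemma sqnorm_nonneg [simp]: "0 \<le> sqnorm v"
  by (auto simp: sqnorm_def intro!: sum_nonneg)

lemma cnj_mult_self: "cnj z * z = complex_of_real ((cmod z)\<^sup>2)"
  by (metis complex_norm_square mult.commute)

lemma cmod_diff_square: "(cmod (z - w))\<^sup>2 = (cmod z)\<^sup>2 - 2 * Re (cnj z * w) + (cmod w)\<^sup>2"
  unfolding cmod_power2 by (simp add: power2_eq_square algebra_simps)

lemma hs_self: "hs A A = complex_of_real (fro A)"
  unfolding hs_def fro_def cnj_mult_self by simp

lemma Re_scalar_prod_self: "Re (v \<bullet>c v) = sqnorm v"
proof -
  have "v \<bullet>c v = complex_of_real (sqnorm v)"
    unfolding sqnorm_def scalar_prod_def of_real_sum complex_norm_square
    by (auto simp: atLeast0LessThan intro!: sum.cong)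
  then show ?thesis by simp
qed

lemma sqnorm_smult: "sqnorm (c \<cdot>\<^sub>v v) = (cmod c)\<^sup>2 * sqnorm v"
  by (simp add: sqnorm_def norm_mult power_mult_distrib sum_distrib_left)

lemma fro_adjoint: "fro (mat_adjoint A) = fro A"
  unfolding fro_def by (subst sum.swap) (auto intro!: sum.cong)

lemma norm_sum_mult_le:
  fixes f g :: "nat \<Rightarrow> complex"
  shows "(cmod (\<Sum>i\<in>S. f i * g i))\<^sup>2 \<le> (\<Sum>i\<in>S. (cmod (f i))\<^sup>2) * (\<Sum>i\<in>S. (cmod (g i))\<^sup>2)"
proof -
  have "cmod (\<Sum>i\<in>S. f i * g i) \<le> (\<Sum>i\<in>S. \<bar>cmod (f i)\<bar> * \<bar>cmod (g i)\<bar>)"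
    by (rule order_trans[OF norm_sum]) (simp add: norm_mult)
  also have "\<dots> \<le> L2_set (\<lambda>i. cmod (f i)) S * L2_set (\<lambda>i. cmod (g i)) S"
    by (rule L2_set_mult_ineq)
  finally have "(cmod (\<Sum>i\<in>S. f i * g i))\<^sup>2
      \<le> (L2_set (\<lambda>i. cmod (f i)) S * L2_set (\<lambda>i. cmod (g i)) S)\<^sup>2"
    by (rule power_mono) simp
  then show ?thesis
    by (simp add: L2_set_def power_mult_distrib sum_nonneg)
qed

text \<open>Cauchy-Schwarz row by row. The finite bound is also what makes the supremum in
  \<open>mat_norm\<close> meaningful.\<close>

lemma sqnorm_mult_mat_vec_le_fro:
  assumes "v \<in> carrier_vec (dim_col A)"
  shows "sqnorm (A *\<^sub>v v) \<le> fro A * sqnorm v"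
proof -
  have "sqnorm (A *\<^sub>v v) = (\<Sum>i<dim_row A. (cmod (\<Sum>j<dim_col A. A $$ (i, j) * v $ j))\<^sup>2)"
    using assms by (auto simp: sqnorm_def scalar_prod_def atLeast0LessThan intro!: sum.cong)
  also have "\<dots> \<le> (\<Sum>i<dim_row A. (\<Sum>j<dim_col A. (cmod (A $$ (i, j)))\<^sup>2) * (\<Sum>j<dim_col A. (cmod (v $ j))\<^sup>2))"
    by (intro sum_mono norm_sum_mult_le)
  also have "\<dots> = fro A * sqnorm v"
    using assms by (simp add: fro_def sqnorm_def sum_distrib_right)
  finally show ?thesis .
qed

section \<open>The operator norm\<close>

abbreviation contr_image :: "complex mat \<Rightarrow> real set" where
  "contr_image A \<equiv> (\<lambda>v. sqrt (Re ((A *\<^sub>v v) \<bullet>c (A *\<^sub>v v)))) ` {v \<in> carrier_vec (dim_col A). Re (v \<bullet>c v) \<le> 1}"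

lemma bdd_contr_image: "bdd_above (contr_image A)"
proof (rule bdd_aboveI2)
  fix v assume "v \<in> {v \<in> carrier_vec (dim_col A). Re (v \<bullet>c v) \<le> 1}"
  then have v: "v \<in> carrier_vec (dim_col A)" "sqnorm v \<le> 1"
    by (auto simp: Re_scalar_prod_self)
  have "sqnorm (A *\<^sub>v v) \<le> fro A * sqnorm v"
    by (rule sqnorm_mult_mat_vec_le_fro) fact
  also have "\<dots> \<le> fro A"
    using v by (simp add: mult_left_le)
  finally show "sqrt (Re ((A *\<^sub>v v) \<bullet>c (A *\<^sub>v v))) \<le> sqrt (fro A)"
    by (simp add: Re_scalar_prod_self)
qed

lemma zero_in_ball: "0\<^sub>v n \<in> {v \<in> carrier_vec n. Re (v \<bullet>c v) \<le> 1}"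
  by simp

lemma mat_norm_nonneg [simp]: "0 \<le> mat_norm A"
proof -
  have "sqrt (Re ((A *\<^sub>v 0\<^sub>v (dim_col A)) \<bullet>c (A *\<^sub>v 0\<^sub>v (dim_col A)))) \<le> mat_norm A"
    unfolding mat_norm_def by (rule cSUP_upper[OF zero_in_ball bdd_contr_image])
  moreover have "0 \<le> sqrt (Re ((A *\<^sub>v 0\<^sub>v (dim_col A)) \<bullet>c (A *\<^sub>v 0\<^sub>v (dim_col A))))"
    unfolding Re_scalar_prod_self by simp
  ultimately show ?thesis by linarith
qed

text \<open>Homogeneity extends the bound from the unit ball to all vectors. Null vectors, which
  cannot be normalised, are covered by the Hilbert-Schmidt bound.\<close>

lemma mat_norm_bound:
  assumes v: "v \<in> carrier_vec (dim_col A)"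
  shows "sqnorm (A *\<^sub>v v) \<le> (mat_norm A)\<^sup>2 * sqnorm v"
proof (cases "sqnorm v = 0")
  case True
  then show ?thesis
    using sqnorm_mult_mat_vec_le_fro[OF v] by simp
next
  case False
  then have pos: "sqnorm v > 0"
    by (simp add: order_less_le)
  define c where "c = complex_of_real (1 / sqrt (sqnorm v))"
  have c: "(cmod c)\<^sup>2 = 1 / sqnorm v"
    using pos by (simp add: c_def norm_divide power_divide real_sqrt_abs2)
  have in_ball: "c \<cdot>\<^sub>v v \<in> {v \<in> carrier_vec (dim_col A). Re (v \<bullet>c v) \<le> 1}"
    using v pos by (simp add: Re_scalar_prod_self sqnorm_smult c)
  have "sqrt (Re ((A *\<^sub>v (c \<cdot>\<^sub>v v)) \<bullet>c (A *\<^sub>v (c \<cdot>\<^sub>v v)))) \<le> mat_norm A"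
    unfolding mat_norm_def by (rule cSUP_upper[OF in_ball bdd_contr_image])
  moreover have "A *\<^sub>v (c \<cdot>\<^sub>v v) = c \<cdot>\<^sub>v (A *\<^sub>v v)"
    using v by (simp add: mult_mat_vec[of A "dim_row A" "dim_col A"])
  ultimately have "sqrt (sqnorm (A *\<^sub>v v) / sqnorm v) \<le> mat_norm A"
    unfolding Re_scalar_prod_self by (simp add: sqnorm_smult c)
  then have "sqnorm (A *\<^sub>v v) / sqnorm v \<le> (mat_norm A)\<^sup>2"
    by (simp add: real_le_rsqrt sqrt_le_D)
  then show ?thesis
    using pos by (simp add: divide_le_eq)
qed

lemma mat_norm_leI:
  assumes "0 \<le> C" "\<And>v. v \<in> carrier_vec (dim_col A) \<Longrightarrow> sqnorm v \<le> 1 \<Longrightarrow> sqnorm (A *\<^sub>v v) \<le> C\<^sup>2"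
  shows "mat_norm A \<le> C"
  unfolding mat_norm_def
proof (rule cSUP_least)
  show "{v \<in> carrier_vec (dim_col A). Re (v \<bullet>c v) \<le> 1} \<noteq> {}"
    using zero_in_ball by blast
next
  fix v assume "v \<in> {v \<in> carrier_vec (dim_col A). Re (v \<bullet>c v) \<le> 1}"
  then have "sqnorm (A *\<^sub>v v) \<le> C\<^sup>2"
    using assms(2) by (auto simp: Re_scalar_prod_self)
  then show "sqrt (Re ((A *\<^sub>v v) \<bullet>c (A *\<^sub>v v))) \<le> C"
    using assms(1) by (simp add: Re_scalar_prod_self real_le_lsqrt)
qed

lemma mat_norm_le_fro: "(mat_norm A)\<^sup>2 \<le> fro A"
proof -
  have "mat_norm A \<le> sqrt (fro A)"
  proof (rule mat_norm_leI)
    fix v assume v: "v \<in> carrier_vec (dim_col A)" "sqnorm v \<le> 1"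
    have "sqnorm (A *\<^sub>v v) \<le> fro A * sqnorm v"
      by (rule sqnorm_mult_mat_vec_le_fro) fact
    also have "\<dots> \<le> fro A"
      using v by (simp add: mult_left_le)
    finally show "sqnorm (A *\<^sub>v v) \<le> (sqrt (fro A))\<^sup>2"
      by simp
  qed simp
  then show ?thesis
    by (metis fro_nonneg mat_norm_nonneg power_mono real_sqrt_pow2)
qed

lemma fro_eq_cols: "fro A = (\<Sum>j<dim_col A. sqnorm (col A j))"
  unfolding fro_def sqnorm_def by (subst sum.swap) (auto intro!: sum.cong)

text \<open>Column j of \<open>A * B\<close> is \<open>A\<close> applied to column j of
  \<open>B\<close>, and \<open>fro\<close> adds up over columns.\<close>

lemma fro_mult_le:
  assumes "A \<in> carrier_mat n m" "B \<in> carrier_mat m k"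
  shows "fro (A * B) \<le> (mat_norm A)\<^sup>2 * fro B"
proof -
  have "fro (A * B) = (\<Sum>j<k. sqnorm (A *\<^sub>v col B j))"
    using assms by (auto simp: fro_eq_cols intro!: sum.cong arg_cong[of _ _ sqnorm])
  also have "\<dots> \<le> (\<Sum>j<k. (mat_norm A)\<^sup>2 * sqnorm (col B j))"
    using assms by (intro sum_mono mat_norm_bound) auto
  also have "\<dots> = (mat_norm A)\<^sup>2 * fro B"
    using assms by (simp add: fro_eq_cols sum_distrib_left)
  finally show ?thesis .
qed

lemma fro_one: "fro (1\<^sub>m n) = n"
proof -
  have "fro (1\<^sub>m n) = (\<Sum>i<n. \<Sum>j<n. (cmod (if i = j then 1 else 0))\<^sup>2)"
    by (simp add: fro_def)
  also have "\<dots> = (\<Sum>i<n. \<Sum>j<n. if i = j then 1 else 0)"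
    by (intro sum.cong) auto
  finally show ?thesis by simp
qed

text \<open>The case of \<open>fro_mult_le\<close> in which the second factor is the identity. The
  dimension on the right is the loss that rules out a comparison of both norms uniform in the
  level.\<close>

lemma fro_le_mat_norm:
  assumes "A \<in> carrier_mat n m"
  shows "fro A \<le> m * (mat_norm A)\<^sup>2"
  using fro_mult_le[OF assms one_carrier_mat] assms by (simp add: fro_one mult.commute)

lemma cmod_entry_le_fro:
  assumes "i < dim_row A" "j < dim_col A"
  shows "(cmod (A $$ (i, j)))\<^sup>2 \<le> fro A"
proof -
  have "(cmod (A $$ (i, j)))\<^sup>2 \<le> (\<Sum>j<dim_col A. (cmod (A $$ (i, j)))\<^sup>2)"
    using assms by (intro member_le_sum) auto
  also have "\<dots> \<le> fro A"
    unfolding fro_def using assms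
    by (intro member_le_sum[of i _ "\<lambda>i. \<Sum>j<dim_col A. (cmod (A $$ (i, j)))\<^sup>2"]) (auto intro!: sum_nonneg)
  finally show ?thesis .
qed

text \<open>Since \<open>\<parallel>C\<^sup>2v\<parallel> \<le> \<parallel>Cv\<parallel>\<close>, one has \<open>\<parallel>(1 - C\<^sup>2)v\<parallel>\<^sup>2 = \<parallel>v\<parallel>\<^sup>2 - 2\<parallel>Cv\<parallel>\<^sup>2 + \<parallel>C\<^sup>2v\<parallel>\<^sup>2 \<le> \<parallel>v\<parallel>\<^sup>2\<close>.\<close>

lemma mat_norm_one_minus_square_le:
  assumes C: "C \<in> carrier_mat n n" and adj: "mat_adjoint C = C" and le: "mat_norm C \<le> 1"
  shows "mat_norm (1\<^sub>m n - C * C) \<le> 1"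
proof (rule mat_norm_leI)
  have contr: "sqnorm (C *\<^sub>v v) \<le> sqnorm v" if "v \<in> carrier_vec n" for v
  proof -
    have "sqnorm (C *\<^sub>v v) \<le> (mat_norm C)\<^sup>2 * sqnorm v"
      using mat_norm_bound[of v C] that C by auto
    also have "\<dots> \<le> 1 * sqnorm v"
      using le by (intro mult_right_mono) (auto simp: power_le_one)
    finally show ?thesis by simp
  qed
  fix v assume v': "v \<in> carrier_vec (dim_col (1\<^sub>m n - C * C))" and v1: "sqnorm v \<le> 1"
  then have v: "v \<in> carrier_vec n"
    using C by simp
  define u where "u = C *\<^sub>v v"
  define w where "w = C *\<^sub>v u"
  have u: "u \<in> carrier_vec n" and w: "w \<in> carrier_vec n"
    unfolding u_def w_def using C v by (intro mult_mat_vec_carrier; simp)+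
  have eq: "(1\<^sub>m n - C * C) *\<^sub>v v = v - w"
    using C v by (simp add: u_def w_def minus_mult_distrib_mat_vec[of _ n n])
  have entry: "u $ i = (\<Sum>j<n. C $$ (i, j) * v $ j)" "w $ i = (\<Sum>j<n. C $$ (i, j) * u $ j)"
    if "i < n" for i
    using C v u that by (auto simp: u_def w_def scalar_prod_def atLeast0LessThan intro!: sum.cong)
  have cnjC: "cnj (C $$ (i, j)) = C $$ (j, i)" if "i < n" "j < n" for i j
    using C adj that index_mat_adjoint[of j C i] by simp
  \<comment> \<open>Self-adjointness of \<open>C\<close> turns the pairing of \<open>v\<close> with
    \<open>C (C v)\<close> into the square norm of \<open>C v\<close>.\<close>
  have cross: "(\<Sum>i<n. cnj (v $ i) * w $ i) = (\<Sum>j<n. cnj (u $ j) * u $ j)"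
  proof -
    have "(\<Sum>i<n. cnj (v $ i) * w $ i) = (\<Sum>i<n. \<Sum>j<n. cnj (v $ i) * (C $$ (i, j) * u $ j))"
      by (simp add: entry sum_distrib_left)
    also have "\<dots> = (\<Sum>j<n. \<Sum>i<n. cnj (v $ i) * (C $$ (i, j) * u $ j))"
      by (rule sum.swap)
    also have "\<dots> = (\<Sum>j<n. cnj (u $ j) * u $ j)"
    proof (rule sum.cong[OF refl])
      fix j assume "j \<in> {..<n}"
      then have "cnj (u $ j) = (\<Sum>i<n. C $$ (i, j) * cnj (v $ i))"
        by (simp add: entry cnjC)
      then show "(\<Sum>i<n. cnj (v $ i) * (C $$ (i, j) * u $ j)) = cnj (u $ j) * u $ j"
        by (simp add: sum_distrib_left ac_simps)
    qed
    finally show ?thesis .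
  qed
  have "sqnorm (v - w) = (\<Sum>i<n. (cmod (v $ i))\<^sup>2 - 2 * Re (cnj (v $ i) * w $ i) + (cmod (w $ i))\<^sup>2)"
    unfolding sqnorm_def using v w by (auto simp: cmod_diff_square simp del: complex_cnj_mult intro!: sum.cong)
  also have "\<dots> = sqnorm v - 2 * Re (\<Sum>i<n. cnj (v $ i) * w $ i) + sqnorm w"
    using v w by (simp add: sqnorm_def sum.distrib sum_subtractf sum_distrib_left Re_sum del: complex_cnj_mult)
  also have "Re (\<Sum>i<n. cnj (v $ i) * w $ i) = sqnorm u"
    unfolding cross cnj_mult_self using u by (simp add: sqnorm_def)
  also have "sqnorm v - 2 * sqnorm u + sqnorm w \<le> sqnorm v"
    using contr[OF u] by (simp add: w_def[symmetric]) (smt (verit) sqnorm_nonneg)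
  finally show "sqnorm ((1\<^sub>m n - C * C) *\<^sub>v v) \<le> 1\<^sup>2"
    using v1 by (simp add: eq)
qed simp

text \<open>Selects one last base-3 digit; this is how sums over full indices reduce to sums within
  one component.\<close>

lemma sum_times3_select:
  fixes f :: "nat \<Rightarrow> 'a::comm_monoid_add"
  assumes r: "r < 3" and z: "\<And>u p. u < m \<Longrightarrow> p < 3 \<Longrightarrow> p \<noteq> r \<Longrightarrow> f (3 * u + p) = 0"
  shows "(\<Sum>l<3 * m. f l) = (\<Sum>u<m. f (3 * u + r))"
  unfolding sum_lessThan_times3
proof (rule sum.cong[OF refl])
  fix u assume "u \<in> {..<m}"
  then have "p < 3 \<Longrightarrow> p \<noteq> r \<Longrightarrow> f (3 * u + p) = 0" for p
    using z by simp
  from this[of 0] this[of 1] this[of 2]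
  show "f (3 * u) + f (3 * u + 1) + f (3 * u + 2) = f (3 * u + r)"
    using less3_disj[OF r] by auto
qed

section \<open>Components with respect to the last tensor factor\<close>

text \<open>Membership in the full matrices tensored with the diagonal subalgebra: the row and
  column of a nonzero entry agree in the last base-3 digit.\<close>

definition bdiag :: "complex mat \<Rightarrow> bool" where
  "bdiag b \<longleftrightarrow> (\<forall>i<dim_row b. \<forall>j<dim_col b. i mod 3 \<noteq> j mod 3 \<longrightarrow> b $$ (i, j) = 0)"

lemma comp_at_carrier [simp]: "b \<in> carrier_mat (3 * n) (3 * m) \<Longrightarrow> comp_at b i \<in> carrier_mat n m"
  by (auto simp: comp_at_def)

lemma dim_comp_at [simp]: "dim_row (comp_at b i) = dim_row b div 3" "dim_col (comp_at b i) = dim_col b div 3"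
  by (simp_all add: comp_at_def)

lemma index_comp_at:
  "b \<in> carrier_mat (3 * n) (3 * m) \<Longrightarrow> s < n \<Longrightarrow> t < m \<Longrightarrow>
    comp_at b i $$ (s, t) = b $$ (3 * s + row_of i, 3 * t + row_of i)"
  by (auto simp: comp_at_def)

lemma times3_add_less: "s < n \<Longrightarrow> p < 3 \<Longrightarrow> 3 * s + p < 3 * (n :: nat)"
  by simp

lemma comp_at_cong: "row_of i = row_of j \<Longrightarrow> comp_at b i = comp_at b j"
  by (simp add: comp_at_def)

lemma comp_at_4 [simp]: "comp_at b 4 = comp_at b 1"
  by (rule comp_at_cong) simp

lemma comp_at_add:
  assumes "a \<in> carrier_mat (3 * n) (3 * m)" "b \<in> carrier_mat (3 * n) (3 * m)"
  shows "comp_at (a + b) i = comp_at a i + comp_at b i"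
  using assms by (intro eq_matI) (auto simp: comp_at_def times3_add_less)

lemma comp_at_minus:
  assumes "a \<in> carrier_mat (3 * n) (3 * m)" "b \<in> carrier_mat (3 * n) (3 * m)"
  shows "comp_at (a - b) i = comp_at a i - comp_at b i"
  using assms by (intro eq_matI) (auto simp: comp_at_def times3_add_less)

lemma comp_at_smult:
  assumes "a \<in> carrier_mat (3 * n) (3 * m)"
  shows "comp_at (c \<cdot>\<^sub>m a) i = c \<cdot>\<^sub>m comp_at a i"
  using assms by (intro eq_matI) (auto simp: comp_at_def times3_add_less)

lemma comp_at_adjoint:
  assumes "a \<in> carrier_mat (3 * n) (3 * m)"
  shows "comp_at (mat_adjoint a) i = mat_adjoint (comp_at a i)"
  using assms by (intro eq_matI) (auto simp: comp_at_def times3_add_less)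

lemma comp_at_zero: "comp_at (0\<^sub>m (3 * n) (3 * m)) i = 0\<^sub>m n m"
  by (intro eq_matI) (auto simp: comp_at_def times3_add_less)

lemma comp_at_one: "comp_at (1\<^sub>m (3 * n)) i = 1\<^sub>m n"
  by (intro eq_matI) (auto simp: comp_at_def times3_add_less)

lemma bdiag_add: "a \<in> carrier_mat n m \<Longrightarrow> b \<in> carrier_mat n m \<Longrightarrow> bdiag a \<Longrightarrow> bdiag b \<Longrightarrow> bdiag (a + b)"
  by (auto simp: bdiag_def)

lemma bdiag_minus: "a \<in> carrier_mat n m \<Longrightarrow> b \<in> carrier_mat n m \<Longrightarrow> bdiag a \<Longrightarrow> bdiag b \<Longrightarrow> bdiag (a - b)"
  by (auto simp: bdiag_def)

lemma bdiag_smult: "bdiag a \<Longrightarrow> bdiag (c \<cdot>\<^sub>m a)"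
  by (auto simp: bdiag_def)

lemma bdiag_adjoint: "bdiag a \<Longrightarrow> bdiag (mat_adjoint a)"
  by (auto simp: bdiag_def)

lemma bdiag_zero: "bdiag (0\<^sub>m n m)"
  by (auto simp: bdiag_def)

lemma bdiag_one: "bdiag (1\<^sub>m n)"
  by (auto simp: bdiag_def)

lemma bdiag_mult:
  assumes "a \<in> carrier_mat n m" "b \<in> carrier_mat m k" "bdiag a" "bdiag b"
  shows "bdiag (a * b)"
  unfolding bdiag_def
proof (intro allI impI)
  fix i j assume "i < dim_row (a * b)" "j < dim_col (a * b)" and ne: "i mod 3 \<noteq> j mod 3"
  then have ij: "i < n" "j < k" using assms by auto
  have "a $$ (i, l) * b $$ (l, j) = 0" if "l < m" for l
    using assms that ij ne unfolding bdiag_def by (cases "l mod 3 = i mod 3") auto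
  then show "(a * b) $$ (i, j) = 0"
    using index_mult_mat_sum[OF assms(1,2) ij] by (auto intro: sum.neutral)
qed

text \<open>In row \<open>3 * s + r\<close> of \<open>a\<close> only columns with last digit
  \<open>r\<close> contribute, so the sum over intermediate indices stays within one
  component.\<close>

lemma comp_at_mult:
  assumes a: "a \<in> carrier_mat (3 * n) (3 * m)" and b: "b \<in> carrier_mat (3 * m) (3 * k)" and "bdiag a"
  shows "comp_at (a * b) i = comp_at a i * comp_at b i"
proof (rule eq_matI)
  have ab: "a * b \<in> carrier_mat (3 * n) (3 * k)" using a b by simp
  fix s t assume "s < dim_row (comp_at a i * comp_at b i)" "t < dim_col (comp_at a i * comp_at b i)"
  then have st: "s < n" "t < k" using a b by auto
  define r where "r = row_of i"
  have r: "r < 3" by (simp add: r_def)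
  have z: "a $$ (3 * s + r, 3 * u + p) = 0" if "u < m" "p < 3" "p \<noteq> r" for u p
    using \<open>bdiag a\<close> a st r that unfolding bdiag_def
    by (metis (no_types) carrier_matD mod_less mod_mult_self4 times3_add_less)
  have "comp_at (a * b) i $$ (s, t) = (a * b) $$ (3 * s + r, 3 * t + r)"
    using index_comp_at[OF ab st] by (simp add: r_def)
  also have "\<dots> = (\<Sum>l<3 * m. a $$ (3 * s + r, l) * b $$ (l, 3 * t + r))"
    by (rule index_mult_mat_sum[OF a b]) (use st r in auto)
  also have "\<dots> = (\<Sum>u<m. a $$ (3 * s + r, 3 * u + r) * b $$ (3 * u + r, 3 * t + r))"
    by (rule sum_times3_select[OF r]) (simp add: z)
  also have "\<dots> = (\<Sum>u<m. comp_at a i $$ (s, u) * comp_at b i $$ (u, t))"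
    using a b st by (intro sum.cong) (auto simp: index_comp_at r_def)
  also have "\<dots> = (comp_at a i * comp_at b i) $$ (s, t)"
    by (rule index_mult_mat_sum[symmetric]) (use a b st in auto)
  finally show "comp_at (a * b) i $$ (s, t) = (comp_at a i * comp_at b i) $$ (s, t)" .
qed (use a b in auto)

lemma bdiag_eqI:
  assumes a: "a \<in> carrier_mat (3 * n) (3 * m)" and b: "b \<in> carrier_mat (3 * n) (3 * m)" and "bdiag a" "bdiag b"
    and eq: "comp_at a 1 = comp_at b 1" "comp_at a 2 = comp_at b 2" "comp_at a 3 = comp_at b 3"
  shows "a = b"
proof (rule eq_matI)
  fix i j assume "i < dim_row b" "j < dim_col b"
  then have ij: "i < 3 * n" "j < 3 * m" using b by auto
  obtain s p where s: "s < n" "p < 3" "i = 3 * s + p" by (rule less_times3_cases[OF ij(1)])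
  obtain t q where t: "t < m" "q < 3" "j = 3 * t + q" by (rule less_times3_cases[OF ij(2)])
  show "a $$ (i, j) = b $$ (i, j)"
  proof (cases "p = q")
    case False
    then have "i mod 3 \<noteq> j mod 3" using s t by simp
    then show ?thesis using \<open>bdiag a\<close> \<open>bdiag b\<close> ij a b unfolding bdiag_def by auto
  next
    case True
    \<comment> \<open>Row number p is that of vertex p + 1.\<close>
    have "comp_at a (p + 1) = comp_at b (p + 1)"
      using eq less3_disj[OF s(2)] by (auto simp: numeral_3_eq_3 numeral_2_eq_2)
    moreover have "row_of (p + 1) = p" using less3_disj[OF s(2)] by (auto simp: row_of_def)
    ultimately show ?thesis
      using index_comp_at[OF a s(1) t(1), of "p + 1"] index_comp_at[OF b s(1) t(1), of "p + 1"] True s t by simp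
  qed
qed (use a b in auto)

lemma fro_bdiag:
  assumes b: "b \<in> carrier_mat (3 * n) (3 * m)" and "bdiag b"
  shows "fro b = fro (comp_at b 1) + fro (comp_at b 2) + fro (comp_at b 3)"
proof -
  define f where "f i j = (cmod (b $$ (i, j)))\<^sup>2" for i j
  have z: "f (3 * s + p) (3 * t + q) = 0" if "s < n" "t < m" "p < 3" "q < 3" "p \<noteq> q" for s t p q
    using \<open>bdiag b\<close> b that unfolding bdiag_def f_def by auto
  have row: "(\<Sum>j<3 * m. f (3 * s + p) j) = (\<Sum>t<m. f (3 * s + p) (3 * t + p))" if "s < n" "p < 3" for s p
    by (rule sum_times3_select) (use that z in auto)
  have "fro b = (\<Sum>s<n. (\<Sum>j<3 * m. f (3 * s + 0) j) + (\<Sum>j<3 * m. f (3 * s + 1) j) + (\<Sum>j<3 * m. f (3 * s + 2) j))"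
    unfolding fro_def f_def[symmetric] using b by (simp only: carrier_matD sum_lessThan_times3[of _ n] add_0_right)
  also have "\<dots> = (\<Sum>s<n. (\<Sum>t<m. f (3 * s + 0) (3 * t + 0)) + (\<Sum>t<m. f (3 * s + 1) (3 * t + 1))
      + (\<Sum>t<m. f (3 * s + 2) (3 * t + 2)))"
  proof (rule sum.cong[OF refl])
    fix s assume "s \<in> {..<n}"
    then have s: "s < n" by simp
    show "(\<Sum>j<3 * m. f (3 * s + 0) j) + (\<Sum>j<3 * m. f (3 * s + 1) j) + (\<Sum>j<3 * m. f (3 * s + 2) j) =
        (\<Sum>t<m. f (3 * s + 0) (3 * t + 0)) + (\<Sum>t<m. f (3 * s + 1) (3 * t + 1)) + (\<Sum>t<m. f (3 * s + 2) (3 * t + 2))"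
      by (subst row[OF s], simp)+ simp
  qed
  finally have "fro b = (\<Sum>s<n. (\<Sum>t<m. f (3 * s) (3 * t)) + (\<Sum>t<m. f (3 * s + 1) (3 * t + 1))
      + (\<Sum>t<m. f (3 * s + 2) (3 * t + 2)))" by simp
  then show ?thesis
    using b by (simp add: fro_def index_comp_at[OF b] f_def sum.distrib)
qed

text \<open>A component is the compression of \<open>b\<close> to the rows and columns with one
  fixed last digit, and compressions do not increase the operator norm.\<close>

lemma mat_norm_comp_at_le:
  assumes b: "b \<in> carrier_mat (3 * n) (3 * m)"
  shows "mat_norm (comp_at b i) \<le> mat_norm b"
proof (rule mat_norm_leI)
  define r where "r = row_of i"
  have r: "r < 3" by (simp add: r_def)
  fix v assume "v \<in> carrier_vec (dim_col (comp_at b i))" and v1: "sqnorm v \<le> 1"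
  then have v: "v \<in> carrier_vec m" using b by simp
  \<comment> \<open>\<open>v\<close> tensored with a unit vector: its entries sit at the indices
    with last digit \<open>r\<close>.\<close>
  define w where "w = vec (3 * m) (\<lambda>k. if k mod 3 = r then v $ (k div 3) else 0)"
  have w: "w \<in> carrier_vec (3 * m)" by (simp add: w_def)
  have w_idx: "w $ (3 * t + p) = (if p = r then v $ t else 0)" if "t < m" "p < 3" for t p
    using that by (simp add: w_def)
  have "sqnorm w = (\<Sum>l<3 * m. (cmod (w $ l))\<^sup>2)"
    using w by (simp add: sqnorm_def)
  also have "\<dots> = (\<Sum>t<m. (cmod (w $ (3 * t + r)))\<^sup>2)"
    by (rule sum_times3_select[OF r]) (simp add: w_idx)
  also have "\<dots> = (\<Sum>t<m. (cmod (v $ t))\<^sup>2)"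
    by (simp add: w_idx r)
  finally have "sqnorm w = (\<Sum>t<m. (cmod (v $ t))\<^sup>2)" .
  then have wv: "sqnorm w = sqnorm v" using v by (simp add: sqnorm_def)
  have entry: "(comp_at b i *\<^sub>v v) $ s = (b *\<^sub>v w) $ (3 * s + r)" if s: "s < n" for s
  proof -
    have "(b *\<^sub>v w) $ (3 * s + r) = (\<Sum>l<3 * m. b $$ (3 * s + r, l) * w $ l)"
      using b w s r by (auto simp: scalar_prod_def atLeast0LessThan intro!: sum.cong)
    also have "\<dots> = (\<Sum>t<m. b $$ (3 * s + r, 3 * t + r) * w $ (3 * t + r))"
      by (rule sum_times3_select[OF r]) (simp add: w_idx)
    also have "\<dots> = (\<Sum>t<m. b $$ (3 * s + r, 3 * t + r) * v $ t)"
      by (simp add: w_idx r)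
    also have "\<dots> = (\<Sum>t<m. comp_at b i $$ (s, t) * v $ t)"
      using b s by (intro sum.cong) (auto simp: index_comp_at r_def)
    also have "\<dots> = (comp_at b i *\<^sub>v v) $ s"
      using b v s comp_at_carrier[OF b, of i] by (auto simp: scalar_prod_def atLeast0LessThan intro!: sum.cong)
    finally show ?thesis by simp
  qed
  have "sqnorm (comp_at b i *\<^sub>v v) = (\<Sum>s<n. (cmod ((b *\<^sub>v w) $ (3 * s + r)))\<^sup>2)"
    using b by (simp add: sqnorm_def entry del: index_mult_mat_vec)
  also have "\<dots> \<le> (\<Sum>s<n. (cmod ((b *\<^sub>v w) $ (3 * s)))\<^sup>2 + (cmod ((b *\<^sub>v w) $ (3 * s + 1)))\<^sup>2
      + (cmod ((b *\<^sub>v w) $ (3 * s + 2)))\<^sup>2)"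
    using less3_disj[OF r] by (intro sum_mono) auto
  also have "\<dots> = sqnorm (b *\<^sub>v w)"
    using b by (simp add: sqnorm_def sum_lessThan_times3 del: index_mult_mat_vec)
  also have "\<dots> \<le> (mat_norm b)\<^sup>2 * sqnorm w"
    by (rule mat_norm_bound) (use b w in auto)
  also have "\<dots> \<le> (mat_norm b)\<^sup>2"
    using v1 by (simp add: wv mult_left_le)
  finally show "sqnorm (comp_at b i *\<^sub>v v) \<le> (mat_norm b)\<^sup>2" .
qed simp

section \<open>Kronecker products\<close>

lemma tensor_carrier [simp]:
  "A \<in> carrier_mat n m \<Longrightarrow> B \<in> carrier_mat p q \<Longrightarrow> A \<otimes>\<^sub>m B \<in> carrier_mat (n * p) (m * q)"
  by (auto simp: tensor_def)

lemma dim_tensor [simp]: "dim_row (A \<otimes>\<^sub>m B) = dim_row A * dim_row B" "dim_col (A \<otimes>\<^sub>m B) = dim_col A * dim_col B"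
  by (simp_all add: tensor_def)

lemma index_tensor:
  "i < dim_row A * dim_row B \<Longrightarrow> j < dim_col A * dim_col B \<Longrightarrow>
    (A \<otimes>\<^sub>m B) $$ (i, j) = A $$ (i div dim_row B, j div dim_col B) * B $$ (i mod dim_row B, j mod dim_col B)"
  by (simp add: tensor_def)

lemma div_less_times: "(i::nat) < a * b \<Longrightarrow> i div b < a"
  by (simp add: less_mult_imp_div_less)

lemma mod_less_times: "(i::nat) < a * b \<Longrightarrow> i mod b < b"
  by (metis less_nat_zero_code mod_less_divisor mult_0_right neq0_conv)

lemma tensor_assoc: "(A \<otimes>\<^sub>m B) \<otimes>\<^sub>m C = A \<otimes>\<^sub>m (B \<otimes>\<^sub>m C)"
proof (rule eq_matI)
  fix i j assume "i < dim_row (A \<otimes>\<^sub>m (B \<otimes>\<^sub>m C))" "j < dim_col (A \<otimes>\<^sub>m (B \<otimes>\<^sub>m C))"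
  then have i: "i < dim_row A * dim_row B * dim_row C" and j: "j < dim_col A * dim_col B * dim_col C"
    by (simp_all add: mult.assoc)
  have i2: "i mod (dim_row B * dim_row C) < dim_row B * dim_row C"
    and j2: "j mod (dim_col B * dim_col C) < dim_col B * dim_col C"
    using mod_less_times[of i "dim_row A" "dim_row B * dim_row C"] i
      mod_less_times[of j "dim_col A" "dim_col B * dim_col C"] j by (simp_all add: mult.assoc)
  \<comment> \<open>Nested extraction of digits in mixed radix; \<open>c = 0\<close> is separate
    because of the convention for division by zero.\<close>
  have arith: "i mod (b * c) div c = i div c mod b" "i mod (b * c) mod c = i mod c"
      "i div c div b = i div (b * c)" for i b c :: nat
    by (cases "c = 0", simp_all add: div_mult2_eq mod_mult2_eq mult.commute[of b c])+
  show "((A \<otimes>\<^sub>m B) \<otimes>\<^sub>m C) $$ (i, j) = (A \<otimes>\<^sub>m (B \<otimes>\<^sub>m C)) $$ (i, j)"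
    using i j i2 j2 by (simp add: index_tensor div_less_times mult.assoc[symmetric] arith)
qed (simp_all add: mult.assoc)

lemma tensor_add_right:
  assumes "B \<in> carrier_mat p q" "C \<in> carrier_mat p q"
  shows "A \<otimes>\<^sub>m (B + C) = A \<otimes>\<^sub>m B + A \<otimes>\<^sub>m C"
  using assms by (intro eq_matI) (auto simp: index_tensor mod_less_times algebra_simps)

lemma tensor_add_left:
  assumes "B \<in> carrier_mat p q" "C \<in> carrier_mat p q"
  shows "(B + C) \<otimes>\<^sub>m A = B \<otimes>\<^sub>m A + C \<otimes>\<^sub>m A"
  using assms by (intro eq_matI) (auto simp: index_tensor div_less_times algebra_simps)

lemma tensor_smult_left: "(c \<cdot>\<^sub>m B) \<otimes>\<^sub>m A = c \<cdot>\<^sub>m (B \<otimes>\<^sub>m A)"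
  by (intro eq_matI) (auto simp: index_tensor div_less_times)

lemma tensor_one_right: "A \<otimes>\<^sub>m 1\<^sub>m 1 = A"
  by (intro eq_matI) (auto simp: index_tensor)

lemma tensor_carrier3:
  "A \<in> carrier_mat n m \<Longrightarrow> B \<in> carrier_mat 3 3 \<Longrightarrow> A \<otimes>\<^sub>m B \<in> carrier_mat (3 * n) (3 * m)"
  using tensor_carrier[of A n m B 3 3] by (simp add: mult.commute)

lemma munit_carrier [simp]: "munit i j \<in> carrier_mat 3 3"
  by (simp add: munit_def)

lemma comp_at_tensor:
  assumes "A \<in> carrier_mat n m" "B \<in> carrier_mat 3 3"
  shows "comp_at (A \<otimes>\<^sub>m B) i = B $$ (row_of i, row_of i) \<cdot>\<^sub>m A"
  using assms by (intro eq_matI) (auto simp: comp_at_def index_tensor times3_add_less mult.commute[of _ 3])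

lemma bdiag_tensor:
  assumes "B \<in> carrier_mat 3 3" "\<And>p q. p < 3 \<Longrightarrow> q < 3 \<Longrightarrow> p \<noteq> q \<Longrightarrow> B $$ (p, q) = 0"
  shows "bdiag (A \<otimes>\<^sub>m B)"
  using assms unfolding bdiag_def by (auto simp: index_tensor)

lemma bdiag_tensor_munit: "bdiag (A \<otimes>\<^sub>m munit j j)"
  by (rule bdiag_tensor) (auto simp: munit_def)

lemma bdiag_tensor_one: "bdiag (A \<otimes>\<^sub>m 1\<^sub>m 3)"
  by (rule bdiag_tensor) auto

lemma comp_at_tensor_munit:
  assumes "A \<in> carrier_mat n m"
  shows "comp_at (A \<otimes>\<^sub>m munit j j) i = (if row_of i = row_of j then A else 0\<^sub>m n m)"
  using assms by (subst comp_at_tensor) (auto simp: munit_def)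

lemma comp_at_tensor_one:
  assumes "A \<in> carrier_mat n m"
  shows "comp_at (A \<otimes>\<^sub>m 1\<^sub>m 3) i = A"
  using assms by (subst comp_at_tensor) auto

lemma fro_minus_tensor_one:
  assumes b: "b \<in> carrier_mat (3 * n) (3 * m)" and "bdiag b" and a: "a \<in> carrier_mat n m"
  shows "fro (b - a \<otimes>\<^sub>m 1\<^sub>m 3) = fro (comp_at b 1 - a) + fro (comp_at b 2 - a) + fro (comp_at b 3 - a)"
proof -
  have c: "a \<otimes>\<^sub>m 1\<^sub>m 3 \<in> carrier_mat (3 * n) (3 * m)"
    by (rule tensor_carrier3) (use a in auto)
  show ?thesis
    using fro_bdiag[of "b - a \<otimes>\<^sub>m 1\<^sub>m 3" n m] bdiag_minus[OF b c] bdiag_tensor_one \<open>bdiag b\<close> b c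
    by (simp add: comp_at_minus[OF b c] comp_at_tensor_one[OF a] minus_carrier_mat)
qed

section \<open>The algebras \<open>A_n\<close>\<close>

text \<open>Vertex 1 then stays the numeral 1 in goals, so that facts about
  \<open>comp_at b 1\<close> keep matching.\<close>

declare One_nat_def [simp del]

text \<open>Named to keep matrix dimensions opaque to the simplifier; \<open>d3_Suc\<close> splits
  off a tensor factor where it is invoked.\<close>

definition d3 :: "nat \<Rightarrow> nat" where
  "d3 n = 3 ^ n"

lemma d3_Suc: "d3 (Suc n) = 3 * d3 n"
  by (simp add: d3_def)

lemma d3_0 [simp]: "d3 0 = 1" "d3 1 = 3" "d3 (Suc 0) = 3"
  by (simp_all add: d3_def)

abbreviation M :: "nat \<Rightarrow> complex mat set" where
  "M n \<equiv> carrier_mat (d3 n) (d3 n)"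

text \<open>The component at \<open>v_2\<close> of an element of \<open>A_(n+1)\<close> lies in \<open>A_n\<close>; the components at \<open>v_1\<close> and
  \<open>v_3\<close> carry the values at the three new vertices, each new vertex being shared by two cells.\<close>

fun good :: "nat \<Rightarrow> complex mat \<Rightarrow> bool" where
  "good 0 b \<longleftrightarrow> b \<in> M (Suc 0) \<and> bdiag b"
| "good (Suc n) b \<longleftrightarrow> b \<in> M (Suc (Suc n)) \<and> bdiag b \<and> bdiag (comp_at b 1) \<and> bdiag (comp_at b 3) \<and>
     (\<forall>j\<in>{1, 2, 3}. comp_at (comp_at b 3) j = comp_at (comp_at b 1) (j + 1)) \<and> good n (comp_at b 2)"

lemma comp_at_M [simp]: "b \<in> M (Suc n) \<Longrightarrow> comp_at b i \<in> M n"
  by (simp add: d3_Suc)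

lemma good_carrier: "good n b \<Longrightarrow> b \<in> M (Suc n)"
  by (cases n) (auto simp: One_nat_def)

lemma good_bdiag: "good n b \<Longrightarrow> bdiag b"
  by (cases n) auto

lemma comp_at_M_simps:
  "a \<in> M (Suc n) \<Longrightarrow> b \<in> M (Suc n) \<Longrightarrow> comp_at (a + b) i = comp_at a i + comp_at b i"
  "a \<in> M (Suc n) \<Longrightarrow> b \<in> M (Suc n) \<Longrightarrow> comp_at (a - b) i = comp_at a i - comp_at b i"
  "a \<in> M (Suc n) \<Longrightarrow> comp_at (c \<cdot>\<^sub>m a) i = c \<cdot>\<^sub>m comp_at a i"
  "a \<in> M (Suc n) \<Longrightarrow> comp_at (mat_adjoint a) i = mat_adjoint (comp_at a i)"
  "comp_at (1\<^sub>m (d3 (Suc n))) i = 1\<^sub>m (d3 n)"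
  "comp_at (0\<^sub>m (d3 (Suc n)) (d3 (Suc n))) i = 0\<^sub>m (d3 n) (d3 n)"
  using comp_at_add[of a "d3 n" "d3 n" b i] comp_at_minus[of a "d3 n" "d3 n" b i]
    comp_at_smult[of a "d3 n" "d3 n" c i] comp_at_adjoint[of a "d3 n" "d3 n" i]
    comp_at_one[of "d3 n" i] comp_at_zero[of "d3 n" "d3 n" i]
  by (simp_all add: d3_Suc)

lemma comp_at_M_mult:
  "a \<in> M (Suc n) \<Longrightarrow> b \<in> M (Suc n) \<Longrightarrow> bdiag a \<Longrightarrow> comp_at (a * b) i = comp_at a i * comp_at b i"
  using comp_at_mult[of a "d3 n" "d3 n" b "d3 n" i] by (simp add: d3_Suc)

lemma good_add: "good n a \<Longrightarrow> good n b \<Longrightarrow> good n (a + b)"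
proof (induction n arbitrary: a b)
  case 0
  then show ?case using bdiag_add[of a 3 3 b] by auto
next
  case (Suc n)
  have c: "a \<in> M (Suc (Suc n))" "b \<in> M (Suc (Suc n))" using Suc.prems by auto
  then have c': "comp_at a i \<in> M (Suc n)" "comp_at b i \<in> M (Suc n)" for i by (auto)
  show ?case
    using Suc.prems Suc.IH[of "comp_at a 2" "comp_at b 2"] c c' bdiag_add[OF c] bdiag_add[OF c'(1) c'(2)]
    by (simp add: comp_at_M_simps(1)[OF c] comp_at_M_simps(1)[OF c'])
qed

lemma good_smult: "good n a \<Longrightarrow> good n (c \<cdot>\<^sub>m a)"
proof (induction n arbitrary: a)
  case 0
  then show ?case using bdiag_smult[of a] by auto
next
  case (Suc n)
  have c: "a \<in> M (Suc (Suc n))" using Suc.prems by auto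
  then have c': "comp_at a i \<in> M (Suc n)" for i by (auto)
  show ?case
    using Suc.prems Suc.IH[of "comp_at a 2"] c
    by (simp add: comp_at_M_simps(3)[OF c] comp_at_M_simps(3)[OF c'] bdiag_smult)
qed

lemma good_adjoint: "good n a \<Longrightarrow> good n (mat_adjoint a)"
proof (induction n arbitrary: a)
  case 0
  then show ?case using bdiag_adjoint[of a] by auto
next
  case (Suc n)
  have c: "a \<in> M (Suc (Suc n))" using Suc.prems by auto
  then have c': "comp_at a i \<in> M (Suc n)" for i by (auto)
  show ?case
    using Suc.prems Suc.IH[of "comp_at a 2"] c
    by (simp add: comp_at_M_simps(4)[OF c] comp_at_M_simps(4)[OF c'] bdiag_adjoint)
qed

text \<open>Taking components is multiplicative on block diagonal matrices, so every equation
  between components survives multiplication. This is why \<open>A_n\<close> is an algebra.\<close>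

lemma good_mult: "good n a \<Longrightarrow> good n b \<Longrightarrow> good n (a * b)"
proof (induction n arbitrary: a b)
  case 0
  then show ?case using bdiag_mult[of a 3 3 b 3] by auto
next
  case (Suc n)
  have c: "a \<in> M (Suc (Suc n))" "b \<in> M (Suc (Suc n))" using Suc.prems by auto
  then have c': "comp_at a i \<in> M (Suc n)" "comp_at b i \<in> M (Suc n)" for i by (auto)
  have d: "bdiag a" "bdiag b" "bdiag (comp_at a 1)" "bdiag (comp_at a 3)" "bdiag (comp_at b 1)" "bdiag (comp_at b 3)"
    using Suc.prems by auto
  show ?case
    using Suc.prems Suc.IH[of "comp_at a 2" "comp_at b 2"] c c' d bdiag_mult[OF c] bdiag_mult[OF c'(1) c'(2)]
    by (simp add: comp_at_M_mult[OF c d(1)] comp_at_M_mult[OF c'])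
qed

lemma good_zero: "good n (0\<^sub>m (d3 (Suc n)) (d3 (Suc n)))"
  by (induction n) (simp_all add: bdiag_zero comp_at_M_simps(6))

lemma good_one: "good n (1\<^sub>m (d3 (Suc n)))"
  by (induction n) (simp_all add: bdiag_one comp_at_M_simps(5))

lemma bdiag_limit:
  assumes "\<And>k. bdiag (B k)" "\<And>k. B k \<in> carrier_mat n m" "b \<in> carrier_mat n m"
    and lim: "\<And>i j. i < n \<Longrightarrow> j < m \<Longrightarrow> (\<lambda>k. B k $$ (i, j)) \<longlonglongrightarrow> b $$ (i, j)"
  shows "bdiag b"
  unfolding bdiag_def
proof (intro allI impI)
  fix i j assume ij: "i < dim_row b" "j < dim_col b" "i mod 3 \<noteq> j mod 3"
  then have "B k $$ (i, j) = 0" for k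
    using assms(1)[of k] assms(2)[of k] assms(3) unfolding bdiag_def by auto
  then show "b $$ (i, j) = 0"
    using lim[of i j] ij assms(3) by (simp add: LIMSEQ_const_iff)
qed

text \<open>Each clause of \<open>good\<close> is a system of linear equations between entries,
  hence closed under entrywise convergence. Closedness of \<open>A_inf\<close> comes from
  here.\<close>

lemma good_limit:
  assumes "\<And>k. good n (B k)" "b \<in> M (Suc n)"
    and lim: "\<And>i j. i < d3 (Suc n) \<Longrightarrow> j < d3 (Suc n) \<Longrightarrow> (\<lambda>k. B k $$ (i, j)) \<longlonglongrightarrow> b $$ (i, j)"
  shows "good n b"
  using assms
proof (induction n arbitrary: B b)
  case 0
  then show ?case using bdiag_limit[of B "d3 1" "d3 1" b] by (auto simp: One_nat_def)
next
  case (Suc n)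
  have c: "B k \<in> M (Suc (Suc n))" for k using Suc.prems(1) good_carrier by blast
  have cl: "(\<lambda>k. comp_at (A k) r $$ (i, j)) \<longlonglongrightarrow> comp_at a r $$ (i, j)"
    if "\<And>k. A k \<in> M (Suc n)" "a \<in> M (Suc n)" "i < d3 n" "j < d3 n"
      "\<And>i j. i < d3 (Suc n) \<Longrightarrow> j < d3 (Suc n) \<Longrightarrow> (\<lambda>k. A k $$ (i, j)) \<longlonglongrightarrow> a $$ (i, j)" for A a r i j n
    using that by (simp add: d3_Suc index_comp_at[OF _ that(3,4)] times3_add_less)
  have c1: "comp_at b r \<in> M (Suc n)" "comp_at (B k) r \<in> M (Suc n)" for r k
    using c Suc.prems(2) by (auto)
  have l1: "(\<lambda>k. comp_at (B k) r $$ (i, j)) \<longlonglongrightarrow> comp_at b r $$ (i, j)" if "i < d3 (Suc n)" "j < d3 (Suc n)" for r i j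
    by (rule cl[OF c Suc.prems(2) that Suc.prems(3)])
  have l2: "(\<lambda>k. comp_at (comp_at (B k) q) r $$ (i, j)) \<longlonglongrightarrow> comp_at (comp_at b q) r $$ (i, j)"
    if "i < d3 n" "j < d3 n" for q r i j
    by (rule cl[OF c1(2) c1(1) that l1])
  have "comp_at (comp_at b 3) j = comp_at (comp_at b 1) (j + 1)" if j: "j \<in> {1, 2, 3}" for j
  proof (rule eq_matI)
    fix s t assume "s < dim_row (comp_at (comp_at b 1) (j + 1))" "t < dim_col (comp_at (comp_at b 1) (j + 1))"
    then have st: "s < d3 n" "t < d3 n" using Suc.prems(2) by (auto simp: d3_Suc)
    have "comp_at (comp_at (B k) 3) j = comp_at (comp_at (B k) 1) (j + 1)" for k
      using Suc.prems(1)[of k] j by auto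
    then show "comp_at (comp_at b 3) j $$ (s, t) = comp_at (comp_at b 1) (j + 1) $$ (s, t)"
      using LIMSEQ_unique[OF l2[OF st, of 3 j]] l2[OF st, of 1 "j + 1"] by simp
  qed (use Suc.prems(2) in auto)
  moreover have "bdiag b"
    by (rule bdiag_limit[OF _ c Suc.prems(2,3)]) (use Suc.prems(1) in auto)
  moreover have "bdiag (comp_at b 1)" "bdiag (comp_at b 3)"
    using Suc.prems(1) by (auto intro!: bdiag_limit[OF _ c1(2) c1(1) l1])
  moreover have "good n (comp_at b 2)"
    using Suc.prems(1) by (intro Suc.IH[OF _ c1(1) l1]) auto
  ultimately show ?case
    using Suc.prems(2) by auto
qed

section \<open>The algebra \<open>A_n\<close> consists of the matrices satisfying
  \<open>good\<close>\<close>

lemma tensor_M: "a \<in> M n \<Longrightarrow> b \<in> carrier_mat 3 3 \<Longrightarrow> a \<otimes>\<^sub>m b \<in> M (Suc n)"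
  using tensor_carrier3[of a "d3 n" "d3 n" b] by (simp add: d3_Suc)

text \<open>Tensoring with \<open>munit 2 2\<close> puts \<open>a\<close> at v_2 and the value zero
  at the three new vertices.\<close>

lemma good_tensor_munit2:
  assumes "good n a" shows "good (Suc n) (a \<otimes>\<^sub>m munit 2 2)"
proof -
  have a: "a \<in> M (Suc n)" using assms by (rule good_carrier)
  show ?thesis
    using assms a tensor_M[OF a munit_carrier, of 2 2]
    by (simp add: comp_at_tensor_munit[OF a] bdiag_tensor_munit bdiag_zero comp_at_M_simps(6))
qed

lemma alpha_0: "alpha 0 j = munit j j"
  by (simp add: alpha_def tensor_one_right)

lemma alpha_Suc: "alpha (Suc n) j = alpha n j \<otimes>\<^sub>m munit 2 2"
  by (simp add: alpha_def tensor_assoc)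

lemma beta_Suc: "k \<ge> 1 \<Longrightarrow> beta (Suc k) j = beta k j \<otimes>\<^sub>m munit 2 2"
  by (cases k) (simp_all add: beta_def tensor_assoc)

lemma tensor_beta_1:
  assumes "x \<in> M n"
  shows "x \<otimes>\<^sub>m beta 1 j = (x \<otimes>\<^sub>m munit j j) \<otimes>\<^sub>m munit 1 1 + (x \<otimes>\<^sub>m munit (j + 2) (j + 2)) \<otimes>\<^sub>m munit 3 3"
proof -
  have c: "munit i i \<otimes>\<^sub>m munit k k \<in> carrier_mat 9 9" for i k
    using tensor_carrier[OF munit_carrier munit_carrier, of i i k k] by simp
  show ?thesis
    by (simp add: beta_def tensor_one_right tensor_add_right[OF c c] tensor_assoc)
qed

text \<open>The summand ending in \<open>munit 1 1\<close> places x at position j of b(v_1), the one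
  ending in \<open>munit 3 3\<close> places it at position j + 2 of b(v_3). Both positions belong to
  the same new vertex.\<close>

lemma good_tensor_beta_1:
  assumes x: "x \<in> M n" and j: "j \<in> {1, 2, 3}"
  shows "good (Suc n) (x \<otimes>\<^sub>m beta 1 j)"
proof -
  define u where "u = x \<otimes>\<^sub>m munit j j"
  define v where "v = x \<otimes>\<^sub>m munit (j + 2) (j + 2)"
  have uv: "u \<in> M (Suc n)" "v \<in> M (Suc n)"
    using x by (auto simp: u_def v_def intro: tensor_M)
  have uv': "u \<otimes>\<^sub>m munit 1 1 \<in> M (Suc (Suc n))" "v \<otimes>\<^sub>m munit 3 3 \<in> M (Suc (Suc n))"
    using uv by (auto intro: tensor_M)
  define b where "b = u \<otimes>\<^sub>m munit 1 1 + v \<otimes>\<^sub>m munit 3 3"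
  have b: "b \<in> M (Suc (Suc n))" "bdiag b"
    using uv' bdiag_add[OF uv'] by (auto simp: b_def bdiag_tensor_munit)
  have comp: "comp_at b i = (if row_of i = 0 then u else 0\<^sub>m (d3 (Suc n)) (d3 (Suc n)))
      + (if row_of i = 2 then v else 0\<^sub>m (d3 (Suc n)) (d3 (Suc n)))" for i
    using comp_at_M_simps(1)[OF uv', of i]
    by (simp add: b_def comp_at_tensor_munit[OF uv(1)] comp_at_tensor_munit[OF uv(2)])
  have comp123: "comp_at b 1 = u" "comp_at b 2 = 0\<^sub>m (d3 (Suc n)) (d3 (Suc n))" "comp_at b 3 = v"
    using uv unfolding comp by (simp_all)
  \<comment> \<open>Modulo 3, i equals j + 2 exactly when i + 1 equals j.\<close>
  have "comp_at v i = comp_at u (i + 1)" if "i \<in> {1, 2, 3}" for i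
    unfolding u_def v_def comp_at_tensor_munit[OF x] using that j by (auto simp: row_of_def)
  then have "good (Suc n) b"
    using b by (simp add: comp123 good_zero u_def v_def bdiag_tensor_munit)
  then show ?thesis
    using tensor_beta_1[OF x, of j] by (simp add: b_def u_def v_def)
qed

lemma good_tensor_beta:
  "j \<in> {1, 2, 3} \<Longrightarrow> k \<in> {1..n} \<Longrightarrow> x \<in> M (n - k) \<Longrightarrow> good n (x \<otimes>\<^sub>m beta k j)"
proof (induction n arbitrary: k)
  case (Suc n)
  show ?case
  proof (cases "k = 1")
    case True
    then show ?thesis
      using good_tensor_beta_1[of x n j] Suc.prems by simp
  next
    case False
    then obtain l where l: "k = Suc l" "l \<ge> 1" "l \<le> n"
      using Suc.prems(2) by (cases k) auto
    then have "good n (x \<otimes>\<^sub>m beta l j)"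
      using Suc by auto
    then show ?thesis
      using good_tensor_munit2 l by (simp add: beta_Suc tensor_assoc[symmetric])
  qed
qed simp

lemma A_fin_imp_good: "a \<in> A_fin n \<Longrightarrow> good n a"
proof (induction rule: A_fin.induct)
  case (alpha j)
  have "bdiag (munit j j)" by (auto simp: bdiag_def munit_def)
  then show ?case
    by (induction n) (auto simp: alpha_0 alpha_Suc intro: good_tensor_munit2 simp del: good.simps(2))
next
  case zero
  then show ?case using good_zero[of n] by (simp only: d3_def)
next
  case (beta j k x)
  then show ?case using good_tensor_beta[of j k n x] by (simp only: d3_def)
qed (auto intro: good_add good_smult)

lemma A_fin_tensor_munit2:
  "a \<in> A_fin n \<Longrightarrow> a \<otimes>\<^sub>m munit 2 2 \<in> A_fin (Suc n)"
proof (induction rule: A_fin.induct)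
  case zero
  have "0\<^sub>m (d3 (Suc n)) (d3 (Suc n)) \<otimes>\<^sub>m munit 2 2 = 0\<^sub>m (d3 (Suc (Suc n))) (d3 (Suc (Suc n)))"
    by (rule eq_matI) (auto simp: index_tensor div_less_times munit_def mult.commute d3_Suc)
  then show ?case using A_fin.zero[of "Suc n"] by (simp only: d3_def)
next
  case (alpha j)
  then show ?case using A_fin.alpha[of j "Suc n"] by (simp add: alpha_Suc)
next
  case (beta j k x)
  then show ?case
    using A_fin.beta[of j "Suc k" "Suc n" x] unfolding d3_def by (simp add: beta_Suc tensor_assoc)
next
  case (add a b)
  then show ?case
    using A_fin.add tensor_add_left[of a "d3 (Suc n)" "d3 (Suc n)" b] good_carrier[OF A_fin_imp_good] by simp
next
  case (smult a c)
  then show ?case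
    using A_fin.smult by (simp add: tensor_smult_left)
qed

lemma bdiag_decompose:
  assumes b: "b \<in> M (Suc n)" and "bdiag b"
  shows "b = comp_at b 1 \<otimes>\<^sub>m munit 1 1 + comp_at b 2 \<otimes>\<^sub>m munit 2 2 + comp_at b 3 \<otimes>\<^sub>m munit 3 3"
proof -
  let ?t = "\<lambda>i. comp_at b i \<otimes>\<^sub>m munit i i"
  have c: "comp_at b i \<in> M n" for i using b by (auto)
  have t: "?t i \<in> M (Suc n)" for i using c by (auto intro: tensor_M)
  have t2: "?t 1 + ?t 2 \<in> M (Suc n)" "?t 1 + ?t 2 + ?t 3 \<in> M (Suc n)" using t by (auto)
  have comp: "comp_at (?t 1 + ?t 2 + ?t 3) i = comp_at (?t 1) i + comp_at (?t 2) i + comp_at (?t 3) i" for i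
    by (simp only: comp_at_M_simps(1)[OF t2(1) t] comp_at_M_simps(1)[OF t t])
  show ?thesis
  proof (rule bdiag_eqI[of _ "d3 n" "d3 n"])
    show "bdiag (?t 1 + ?t 2 + ?t 3)"
      by (intro bdiag_add[OF t2(1) t] bdiag_add[OF t t] bdiag_tensor_munit)
  qed (use b t2 t c \<open>bdiag b\<close> in \<open>simp_all add: comp comp_at_tensor_munit[OF c] d3_Suc\<close>)
qed

text \<open>The components \<open>x j\<close> of b(v_1) are the coefficients of the
  \<open>beta 1 j\<close>; the consistency clause of \<open>good\<close> makes the same coefficients
  reproduce b(v_3). What remains is b(v_2) tensored with \<open>munit 2 2\<close>, covered by
  induction.\<close>

lemma good_imp_A_fin: "good n b \<Longrightarrow> b \<in> A_fin n"
proof (induction n arbitrary: b)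
  case 0
  then have b: "b \<in> M (Suc 0)" "bdiag b" by auto
  have eq: "comp_at b i \<otimes>\<^sub>m munit i i = comp_at b i $$ (0, 0) \<cdot>\<^sub>m alpha 0 i" for i
    using b(1) by (intro eq_matI) (auto simp: index_tensor alpha_0 munit_def)
  show ?case
    apply (subst bdiag_decompose[OF b])
    unfolding eq by (intro A_fin.add A_fin.smult A_fin.alpha) auto
next
  case (Suc n)
  have b: "b \<in> M (Suc (Suc n))" "bdiag b" "bdiag (comp_at b 1)" "bdiag (comp_at b 3)" using Suc.prems by auto
  have c: "comp_at b i \<in> M (Suc n)" for i using b by (auto)
  define x where "x j = comp_at (comp_at b 1) j" for j
  have x: "x j \<in> M n" for j using c unfolding x_def by (auto)
  have c3: "comp_at (comp_at b 3) 1 = x 2" "comp_at (comp_at b 3) 2 = x 3" "comp_at (comp_at b 3) 3 = x 1"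
    using Suc.prems comp_at_4[of "comp_at b 1"] by (auto simp: x_def)
  define t where "t j i k = (x j \<otimes>\<^sub>m munit i i) \<otimes>\<^sub>m munit k k" for j i k
  have t: "t j i k \<in> M (Suc (Suc n))" for i j k unfolding t_def using x by (intro tensor_M) auto
  then have td: "dim_row (t j i k) = d3 (Suc (Suc n))" "dim_col (t j i k) = d3 (Suc (Suc n))" for i j k
    by blast+
  define w where "w = comp_at b 2 \<otimes>\<^sub>m munit 2 2"
  have w: "dim_row w = d3 (Suc (Suc n))" "dim_col w = d3 (Suc (Suc n))"
    using tensor_M[OF c munit_carrier, of 2 2 2] unfolding w_def by blast+
  have tt: "x j \<otimes>\<^sub>m munit i i \<in> M (Suc n)" for i j using x by (intro tensor_M) auto
  \<comment> \<open>The index j + 2 in \<open>beta\<close> reaches 4 and 5, which are read modulo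
    3.\<close>
  have m: "munit 4 4 = munit 1 1" "munit 5 5 = munit 2 2" by (simp_all add: munit_def)
  have e1: "comp_at b 1 \<otimes>\<^sub>m munit 1 1 = t 1 1 1 + t 2 2 1 + t 3 3 1"
    apply (subst bdiag_decompose[OF c b(3)])
    using tt by (simp add: x_def[symmetric] t_def tensor_add_left[of _ "d3 (Suc n)" "d3 (Suc n)"])
  have e3: "comp_at b 3 \<otimes>\<^sub>m munit 3 3 = t 2 1 3 + t 3 2 3 + t 1 3 3"
    apply (subst bdiag_decompose[OF c b(4)])
    using tt by (simp add: c3 t_def tensor_add_left[of _ "d3 (Suc n)" "d3 (Suc n)"])
  have be: "x j \<otimes>\<^sub>m beta 1 j = t j j 1 + t j (j + 2) 3" for j
    using tensor_beta_1[OF x] by (simp add: t_def)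
  have be123: "x 1 \<otimes>\<^sub>m beta 1 1 = t 1 1 1 + t 1 3 3" "x 2 \<otimes>\<^sub>m beta 1 2 = t 2 2 1 + t 2 1 3"
      "x 3 \<otimes>\<^sub>m beta 1 3 = t 3 3 1 + t 3 2 3"
    using be[of 1] be[of 2] be[of 3] m by (simp_all add: t_def)
  have "b = comp_at b 2 \<otimes>\<^sub>m munit 2 2 + x 1 \<otimes>\<^sub>m beta 1 1 + x 2 \<otimes>\<^sub>m beta 1 2 + x 3 \<otimes>\<^sub>m beta 1 3"
    apply (subst bdiag_decompose[OF b(1,2)])
    unfolding e1 e3 be123 w_def[symmetric] by (intro eq_matI) (auto simp: td w simp del: dim_tensor)
  moreover have "comp_at b 2 \<otimes>\<^sub>m munit 2 2 \<in> A_fin (Suc n)"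
    using Suc by (intro A_fin_tensor_munit2) auto
  moreover have "x j \<otimes>\<^sub>m beta 1 j \<in> A_fin (Suc n)" if "j \<in> {1, 2, 3}" for j
    by (rule A_fin.beta) (use x that in \<open>auto simp: d3_def\<close>)
  ultimately show ?case
    by (metis A_fin.add insertI1 insertI2)
qed

lemma A_fin_iff_good: "a \<in> A_fin n \<longleftrightarrow> good n a"
  using A_fin_imp_good good_imp_A_fin by blast

section \<open>The energy of a matrix\<close>

lemma hs_diff_right:
  assumes "A \<in> carrier_mat n m" "B \<in> carrier_mat n m" "C \<in> carrier_mat n m"
  shows "hs A (B - C) = hs A B - hs A C"
  using assms by (simp add: hs_def right_diff_distrib sum_subtractf)

lemma hs_add_right:
  assumes "A \<in> carrier_mat n m" "B \<in> carrier_mat n m" "C \<in> carrier_mat n m"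
  shows "hs A (B + C) = hs A B + hs A C"
  using assms by (simp add: hs_def distrib_left sum.distrib)

lemma hs_smult_right:
  assumes "A \<in> carrier_mat n m" "B \<in> carrier_mat n m"
  shows "hs A (c \<cdot>\<^sub>m B) = c * hs A B"
  using assms by (simp add: hs_def sum_distrib_left ac_simps)

lemma hs_cnj:
  assumes "A \<in> carrier_mat n m" "B \<in> carrier_mat n m"
  shows "hs B A = cnj (hs A B)"
  using assms by (simp add: hs_def mult.commute)

lemma hs_diff_left:
  assumes "A \<in> carrier_mat n m" "B \<in> carrier_mat n m" "C \<in> carrier_mat n m"
  shows "hs (B - C) A = hs B A - hs C A"
  using assms by (simp add: hs_def left_diff_distrib sum_subtractf)

lemma fro_diff:
  assumes "A \<in> carrier_mat n m" "B \<in> carrier_mat n m"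
  shows "fro (A - B) = fro A + fro B - 2 * Re (hs A B)"
proof -
  have c: "A - B \<in> carrier_mat n m" using assms by auto
  have "complex_of_real (fro (A - B)) = hs A A - hs A B - hs B A + hs B B"
    by (simp add: hs_self[symmetric] hs_diff_left[OF assms(1) assms] hs_diff_left[OF assms(2) assms] hs_diff_right[OF c assms])
  then have "fro (A - B) = Re (hs A A - hs A B - hs B A + hs B B)"
    by (metis Re_complex_of_real)
  then show ?thesis
    using hs_cnj[OF assms] by (simp add: hs_self)
qed

lemma fro_diff_entries:
  assumes "A \<in> carrier_mat n m" "B \<in> carrier_mat n m"
  shows "fro (A - B) = (\<Sum>i<n. \<Sum>j<m. (cmod (A $$ (i, j) - B $$ (i, j)))\<^sup>2)"
  using assms by (simp add: fro_def)

lemma fro_diff_commute: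
  assumes "A \<in> carrier_mat n m" "B \<in> carrier_mat n m"
  shows "fro (A - B) = fro (B - A)"
  using assms by (simp add: fro_diff_entries norm_minus_commute)

lemma norm_add_square_le: "(norm (a + b))\<^sup>2 \<le> 2 * (norm a)\<^sup>2 + 2 * (norm (b::'a::real_normed_vector))\<^sup>2"
proof -
  have "(norm (a + b))\<^sup>2 \<le> (norm a + norm b)\<^sup>2"
    by (intro power_mono norm_triangle_ineq) simp
  then show ?thesis
    by (smt (verit) sum_squares_bound power2_sum)
qed

lemma fro_add_le:
  assumes "A \<in> carrier_mat n m" "B \<in> carrier_mat n m"
  shows "fro (A + B) \<le> 2 * fro A + 2 * fro B"
proof -
  have "fro (A + B) = (\<Sum>i<n. \<Sum>j<m. (cmod (A $$ (i, j) + B $$ (i, j)))\<^sup>2)"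
    using assms by (simp add: fro_def)
  also have "\<dots> \<le> (\<Sum>i<n. \<Sum>j<m. 2 * (cmod (A $$ (i, j)))\<^sup>2 + 2 * (cmod (B $$ (i, j)))\<^sup>2)"
    by (intro sum_mono norm_add_square_le)
  finally show ?thesis
    using assms by (simp add: fro_def sum.distrib sum_distrib_left)
qed

lemma fro_triangle:
  assumes "A \<in> carrier_mat n m" "B \<in> carrier_mat n m" "C \<in> carrier_mat n m"
  shows "fro (A - B) \<le> 2 * fro (A - C) + 2 * fro (B - C)"
proof -
  have "A - B = (A - C) + (C - B)" using assms by (intro eq_matI) auto
  then show ?thesis
    using fro_add_le[of "A - C" n m "C - B"] minus_carrier_mat[OF assms(3), of A] minus_carrier_mat[OF assms(2), of C]
      fro_diff_commute[OF assms(2,3)] by simp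
qed

text \<open>Expand the right side around p - p' and q - q'. The pairings of p with q and of p' with
  q' vanish by orthogonality, while those of p with q' and of p' with q are the nonnegative numbers
  \<open>fro (s * t')\<close> and \<open>fro (s' * t)\<close>, which enter the inner product with a
  minus sign.\<close>

lemma fro_pos_part_diff_le:
  assumes c: "p \<in> carrier_mat n n" "q \<in> carrier_mat n n" "p' \<in> carrier_mat n n" "q' \<in> carrier_mat n n"
    and s: "s \<in> carrier_mat n n" "mat_adjoint s = s" "p = s * s"
    and t: "t \<in> carrier_mat n n" "mat_adjoint t = t" "q = t * t"
    and s': "s' \<in> carrier_mat n n" "mat_adjoint s' = s'" "p' = s' * s'"
    and t': "t' \<in> carrier_mat n n" "mat_adjoint t' = t'" "q' = t' * t'"
    and orth: "p * q = 0\<^sub>m n n" "p' * q' = 0\<^sub>m n n"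
  shows "fro (p - p') \<le> fro ((p - q) - (p' - q'))"
proof -
  \<comment> \<open>By cyclicity the trace of a a b b is that of b a a b, and b a is the adjoint of
    a b.\<close>
  have hsq: "hs (a * a) (b * b) = of_real (fro (a * b))"
    if a: "a \<in> carrier_mat n n" "mat_adjoint a = a" and b: "b \<in> carrier_mat n n" "mat_adjoint b = b" for a b
  proof -
    have ab: "a * b \<in> carrier_mat n n" using a b by auto
    have "hs (a * a) (b * b) = mtrace (a * a * (b * b))"
      using mtrace_adjoint_mult[of "a * a" n n "b * b"] mat_adjoint_mult[OF a(1) a(1)] a b by auto
    also have "a * a * (b * b) = a * b' * b" if "b' = a * b" for b'
      using a b that by (simp add: assoc_mult_mat[of _ n n _ n _ n])
    then have "mtrace (a * a * (b * b)) = mtrace ((a * (a * b)) * b)" by simp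
    also have "\<dots> = mtrace (b * (a * (a * b)))"
      using a b by (intro mtrace_commute[of _ n n]) auto
    also have "b * (a * (a * b)) = mat_adjoint (a * b) * (a * b)"
      using mat_adjoint_mult[OF a(1) b(1)] a b by (simp add: assoc_mult_mat[of b n n a n _ n])
    also have "mtrace \<dots> = of_real (fro (a * b))"
      using mtrace_adjoint_mult[OF ab ab] by (simp add: hs_self)
    finally show ?thesis .
  qed
  have zero: "hs p q = 0" "hs p' q' = 0"
  proof -
    have "mtrace (0\<^sub>m n n) = 0" by (simp add: mtrace_def)
    then show "hs p q = 0"
      using mtrace_adjoint_mult[OF c(1,2)] mat_adjoint_mult[OF s(1,1)] s orth by simp
    show "hs p' q' = 0"
      using mtrace_adjoint_mult[OF c(3,4)] mat_adjoint_mult[OF s'(1,1)] s' orth \<open>mtrace (0\<^sub>m n n) = 0\<close> by simp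
  qed
  have d: "p - p' \<in> carrier_mat n n" "q - q' \<in> carrier_mat n n" using c by auto
  have "(p - q) - (p' - q') = (p - p') - (q - q')" using c by (intro eq_matI) auto
  then have "fro ((p - q) - (p' - q')) = fro (p - p') + fro (q - q') - 2 * Re (hs (p - p') (q - q'))"
    using fro_diff[OF d] by simp
  moreover have "Re (hs (p - p') (q - q')) = - fro (s * t') - fro (s' * t)"
    using hsq[OF s(1,2) t'(1,2)] hsq[OF s'(1,2) t(1,2)] zero unfolding s(3)[symmetric] t(3)[symmetric] s'(3)[symmetric] t'(3)[symmetric]
    by (simp add: hs_diff_right[OF d(1) c(2,4)] hs_diff_left[OF c(2) c(1,3)] hs_diff_left[OF c(4) c(1,3)])
  ultimately show ?thesis
    using fro_nonneg[of "q - q'"] fro_nonneg[of "s * t'"] fro_nonneg[of "s' * t"] by linarith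
qed

definition epairs :: "(nat \<times> nat) set" where
  "epairs = {(i, j). i \<in> {1, 2, 3} \<and> j \<in> {1, 2, 3} \<and> i \<noteq> j}"

lemma epairs_eq: "epairs = {(1, 2), (1, 3), (2, 1), (2, 3), (3, 1), (3, 2)}"
  unfolding epairs_def by auto

text \<open>The polarised energy. \<open>is_quadratic_form\<close> asks for a sesquilinear form, and
  this one also makes the root of the energy a seminorm.\<close>

definition energy_form :: "complex mat \<Rightarrow> complex mat \<Rightarrow> complex" where
  "energy_form a b = (\<Sum>(i, j)\<in>epairs. hs (comp_at a i - comp_at a j) (comp_at b i - comp_at b j))"

lemma energy_sum_fro:
  assumes "b \<in> M (Suc n)"
  shows "energy b = (\<Sum>(i, j)\<in>epairs. fro (comp_at b i - comp_at b j))"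
proof -
  have c: "comp_at b i - comp_at b j \<in> M n" for i j using assms by (auto intro!: minus_carrier_mat)
  show ?thesis
    unfolding energy_def epairs_def[symmetric] mtrace_adjoint_mult[OF c c] hs_self by simp
qed

lemma energy_form_self:
  assumes "b \<in> M (Suc n)"
  shows "energy_form b b = of_real (energy b)"
  unfolding energy_form_def energy_sum_fro[OF assms] hs_self by (simp add: case_prod_beta)

lemma energy_nonneg: "b \<in> M (Suc n) \<Longrightarrow> 0 \<le> energy b"
  by (auto simp: energy_sum_fro intro!: sum_nonneg)

text \<open>The factor 2 comes from ordered pairs: each edge of the triangle is counted
  twice.\<close>

lemma energy_eq:
  assumes "b \<in> M (Suc n)"
  shows "energy b = 2 * (fro (comp_at b 1 - comp_at b 2) + fro (comp_at b 2 - comp_at b 3) + fro (comp_at b 1 - comp_at b 3))"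
proof -
  have c: "comp_at b i \<in> M n" for i using assms by auto
  show ?thesis
    unfolding energy_sum_fro[OF assms] epairs_eq
    using fro_diff_commute[OF c[of 2] c[of 1]] fro_diff_commute[OF c[of 3] c[of 2]] fro_diff_commute[OF c[of 3] c[of 1]]
    by simp
qed

lemma energy_form_add_right:
  assumes "a \<in> M (Suc n)" "b \<in> M (Suc n)" "c \<in> M (Suc n)"
  shows "energy_form a (b + c) = energy_form a b + energy_form a c"
proof -
  have "comp_at (b + c) i - comp_at (b + c) j = (comp_at b i - comp_at b j) + (comp_at c i - comp_at c j)" for i j
    unfolding comp_at_M_simps(1)[OF assms(2,3)] using assms by (intro eq_matI) (auto simp: d3_Suc)
  moreover have "comp_at x i - comp_at x j \<in> M n" if "x \<in> M (Suc n)" for x i j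
    using that by (auto intro!: minus_carrier_mat)
  ultimately show ?thesis
    using assms by (simp add: energy_form_def case_prod_beta sum.distrib hs_add_right[of _ "d3 n" "d3 n"])
qed

lemma energy_form_smult_right:
  assumes "a \<in> M (Suc n)" "b \<in> M (Suc n)"
  shows "energy_form a (c \<cdot>\<^sub>m b) = c * energy_form a b"
proof -
  have "comp_at (c \<cdot>\<^sub>m b) i - comp_at (c \<cdot>\<^sub>m b) j = c \<cdot>\<^sub>m (comp_at b i - comp_at b j)" for i j
    unfolding comp_at_M_simps(3)[OF assms(2)] using assms by (intro eq_matI) (auto simp: d3_Suc algebra_simps)
  moreover have "comp_at x i - comp_at x j \<in> M n" if "x \<in> M (Suc n)" for x i j
    using that by (auto intro!: minus_carrier_mat)
  ultimately show ?thesis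
    using assms by (simp add: energy_form_def case_prod_beta sum_distrib_left hs_smult_right[of _ "d3 n" "d3 n"])
qed

lemma energy_form_cnj:
  assumes "a \<in> M (Suc n)" "b \<in> M (Suc n)"
  shows "energy_form b a = cnj (energy_form a b)"
proof -
  have "comp_at x i - comp_at x j \<in> M n" if "x \<in> M (Suc n)" for x i j
    using that by (auto intro!: minus_carrier_mat)
  then show ?thesis
    using assms by (auto simp: energy_form_def case_prod_beta intro!: sum.cong hs_cnj[of _ "d3 n" "d3 n"])
qed

lemma energy_adjoint:
  assumes "b \<in> M (Suc n)"
  shows "energy (mat_adjoint b) = energy b"
proof -
  have "mat_adjoint (comp_at b i) - mat_adjoint (comp_at b j) = mat_adjoint (comp_at b i - comp_at b j)" for i j
    using assms by (intro eq_matI) (auto simp: d3_Suc)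
  then show ?thesis
    using energy_sum_fro[OF assms] energy_sum_fro[OF mat_adjoint_carrier[OF assms]]
    by (simp add: comp_at_M_simps(4)[OF assms] fro_adjoint)
qed

lemma energy_one_minus:
  assumes "b \<in> M (Suc n)"
  shows "energy (1\<^sub>m (d3 (Suc n)) - b) = energy b"
proof -
  have c: "1\<^sub>m (d3 (Suc n)) - b \<in> M (Suc n)" using assms by (auto intro!: minus_carrier_mat)
  have "fro (comp_at (1\<^sub>m (d3 (Suc n)) - b) i - comp_at (1\<^sub>m (d3 (Suc n)) - b) j) = fro (comp_at b i - comp_at b j)" for i j
  proof -
    have "comp_at (1\<^sub>m (d3 (Suc n)) - b) i - comp_at (1\<^sub>m (d3 (Suc n)) - b) j = comp_at b j - comp_at b i"
      unfolding comp_at_M_simps(2)[OF one_carrier_mat assms] comp_at_M_simps(5)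
      using assms by (intro eq_matI) (auto simp: d3_Suc)
    then show ?thesis
      using fro_diff_commute[of "comp_at b j" "d3 n" "d3 n" "comp_at b i"] assms by simp
  qed
  then show ?thesis
    by (simp add: energy_sum_fro[OF assms] energy_sum_fro[OF c])
qed

text \<open>Evaluation at a vertex preserves self-adjointness, squares and the orthogonality
  relation, so the inequality for matrices applies to every pair of vertices.\<close>

lemma energy_pos_part_le:
  assumes s: "s \<in> M (Suc n)" "mat_adjoint s = s" "bdiag s"
    and t: "t \<in> M (Suc n)" "mat_adjoint t = t" "bdiag t"
    and orth: "(s * s) * (t * t) = 0\<^sub>m (d3 (Suc n)) (d3 (Suc n))"
  shows "energy (s * s) \<le> energy (s * s - t * t)"
proof -
  have c: "s * s \<in> M (Suc n)" "t * t \<in> M (Suc n)" "s * s - t * t \<in> M (Suc n)"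
    using s t by auto
  have cs: "comp_at (s * s) i = comp_at s i * comp_at s i" "comp_at (t * t) i = comp_at t i * comp_at t i"
    "mat_adjoint (comp_at s i) = comp_at s i" "mat_adjoint (comp_at t i) = comp_at t i" for i
    using comp_at_M_mult[OF s(1,1,3)] comp_at_M_mult[OF t(1,1,3)] comp_at_M_simps(4)[OF s(1)] comp_at_M_simps(4)[OF t(1)] s t
    by auto
  have o: "comp_at (s * s) i * comp_at (t * t) i = 0\<^sub>m (d3 n) (d3 n)" for i
    using comp_at_M_mult[OF c(1,2) bdiag_mult[OF s(1,1,3,3)], of i] comp_at_M_simps(6)[of n i] orth by simp
  have "fro (comp_at (s * s) i - comp_at (s * s) j)
      \<le> fro ((comp_at (s * s) i - comp_at (t * t) i) - (comp_at (s * s) j - comp_at (t * t) j))" for i j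
    by (rule fro_pos_part_diff_le[where n = "d3 n" and s = "comp_at s i" and t = "comp_at t i" and s' = "comp_at s j" and t' = "comp_at t j"])
      (use s t c o in \<open>auto simp: cs intro!: mult_carrier_mat comp_at_M\<close>)
  then show ?thesis
    unfolding energy_sum_fro[OF c(1)] energy_sum_fro[OF c(3)] comp_at_M_simps(2)[OF c(1,2)]
    by (auto intro!: sum_mono)
qed

text \<open>The difference has components b(v_1) - b(v_2), 0 and b(v_3) - b(v_2), two of the three
  edges that make up the energy. The third edge is recovered from them by the triangle
  inequality.\<close>

lemma fro_minus_tensor_le_energy:
  assumes "b \<in> M (Suc n)" "bdiag b"
  shows "fro (b - comp_at b 2 \<otimes>\<^sub>m 1\<^sub>m 3) \<le> energy b"
    and "energy b \<le> 8 * fro (b - comp_at b 2 \<otimes>\<^sub>m 1\<^sub>m 3)"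
proof -
  have c: "comp_at b i \<in> M n" for i using assms by auto
  have b': "b \<in> carrier_mat (3 * d3 n) (3 * d3 n)" using assms by (simp add: d3_Suc)
  have "fro (comp_at b 2 - comp_at b 2) = 0" by (simp add: fro_diff_entries[OF c c])
  then have eq: "fro (b - comp_at b 2 \<otimes>\<^sub>m 1\<^sub>m 3) = fro (comp_at b 1 - comp_at b 2) + fro (comp_at b 3 - comp_at b 2)"
    using fro_minus_tensor_one[OF b' assms(2) c[of 2]] by simp
  have le1: "x + y \<le> 2 * (x + y + z)" if "0 \<le> x" "0 \<le> y" "0 \<le> z" for x y z :: real
    using that by simp
  \<comment> \<open>With z \<le> 2x + 2y the left side is at most 6 (x + y).\<close>
  have le2: "2 * (x + y + z) \<le> 8 * (x + y)" if "z \<le> 2 * x + 2 * y" "0 \<le> x" "0 \<le> y" for x y z :: real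
    using that by simp
  show "fro (b - comp_at b 2 \<otimes>\<^sub>m 1\<^sub>m 3) \<le> energy b"
    unfolding eq energy_eq[OF assms(1)] fro_diff_commute[OF c[of 3] c[of 2]]
    by (rule le1) auto
  show "energy b \<le> 8 * fro (b - comp_at b 2 \<otimes>\<^sub>m 1\<^sub>m 3)"
    unfolding eq energy_eq[OF assms(1)] fro_diff_commute[OF c[of 2] c[of 3]]
    by (rule le2[OF fro_triangle[OF c c c]]) auto
qed

text \<open>Completing the square in x: the y_i are the deviations from the harmonic values, at
  which the gradient of the left side vanishes, so no terms linear in y are left.\<close>

lemma real_gasket_identity:
  fixes x1 x2 x3 a1 a2 a3 :: real
  defines "y1 \<equiv> x1 - (2 * a1 + 2 * a3 + a2) / 5" and "y2 \<equiv> x2 - (2 * a2 + 2 * a1 + a3) / 5"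
    and "y3 \<equiv> x3 - (2 * a3 + 2 * a2 + a1) / 5"
  shows "(x1 - a1)\<^sup>2 + (x2 - a2)\<^sup>2 + (x3 - a3)\<^sup>2 + (x2 - a1)\<^sup>2 + (x3 - a2)\<^sup>2 + (x1 - a3)\<^sup>2
      + (x1 - x2)\<^sup>2 + (x2 - x3)\<^sup>2 + (x1 - x3)\<^sup>2
    = 3 / 5 * ((a1 - a2)\<^sup>2 + (a2 - a3)\<^sup>2 + (a1 - a3)\<^sup>2)
      + 2 * (y1\<^sup>2 + y2\<^sup>2 + y3\<^sup>2) + (y1 - y2)\<^sup>2 + (y2 - y3)\<^sup>2 + (y1 - y3)\<^sup>2"
  unfolding y1_def y2_def y3_def by (simp add: power2_eq_square field_simps)

text \<open>The 2/5, 2/5, 1/5 rule of the Sierpinski gasket: the value at the new vertex between the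
  corners a and b, opposite to the corner c.\<close>

definition harm :: "complex \<Rightarrow> complex \<Rightarrow> complex \<Rightarrow> complex" where
  "harm a b c = (2 * a + 2 * b + c) / 5"

text \<open>The nine squares in L are the edges of the subdivided triangle, with x1 between a1 and
  a3, x2 between a2 and a1, x3 between a3 and a2. Real and imaginary parts are two separate
  gaskets.\<close>

lemma complex_gasket_ineq:
  fixes x1 x2 x3 a1 a2 a3 :: complex
  defines "L \<equiv> (cmod (x1 - a1))\<^sup>2 + (cmod (x2 - a2))\<^sup>2 + (cmod (x3 - a3))\<^sup>2 + (cmod (x2 - a1))\<^sup>2
      + (cmod (x3 - a2))\<^sup>2 + (cmod (x1 - a3))\<^sup>2 + (cmod (x1 - x2))\<^sup>2 + (cmod (x2 - x3))\<^sup>2 + (cmod (x1 - x3))\<^sup>2"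
    and "R \<equiv> 3 / 5 * ((cmod (a1 - a2))\<^sup>2 + (cmod (a2 - a3))\<^sup>2 + (cmod (a1 - a3))\<^sup>2)"
  shows "R \<le> L"
    and "x1 = harm a1 a3 a2 \<Longrightarrow> x2 = harm a2 a1 a3 \<Longrightarrow> x3 = harm a3 a2 a1 \<Longrightarrow> L = R"
proof -
  have re: "Re (harm a b c) = (2 * Re a + 2 * Re b + Re c) / 5" "Im (harm a b c) = (2 * Im a + 2 * Im b + Im c) / 5" for a b c
    by (simp_all add: harm_def)
  have eq: "L = R + (2 * ((cmod (x1 - harm a1 a3 a2))\<^sup>2 + (cmod (x2 - harm a2 a1 a3))\<^sup>2 + (cmod (x3 - harm a3 a2 a1))\<^sup>2)
     + (cmod ((x1 - harm a1 a3 a2) - (x2 - harm a2 a1 a3)))\<^sup>2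
     + (cmod ((x2 - harm a2 a1 a3) - (x3 - harm a3 a2 a1)))\<^sup>2
     + (cmod ((x1 - harm a1 a3 a2) - (x3 - harm a3 a2 a1)))\<^sup>2)" (is "L = R + ?E")
    unfolding L_def R_def cmod_power2 minus_complex.sel re
    using real_gasket_identity[of "Re x1" "Re a1" "Re x2" "Re a2" "Re x3" "Re a3"]
      real_gasket_identity[of "Im x1" "Im a1" "Im x2" "Im a2" "Im x3" "Im a3"]
    by argo
  have "0 \<le> ?E"
    by (intro add_nonneg_nonneg mult_nonneg_nonneg) auto
  then show "R \<le> L" using eq by linarith
  show "L = R" if "x1 = harm a1 a3 a2" "x2 = harm a2 a1 a3" "x3 = harm a3 a2 a1"
    using eq that by simp
qed

text \<open>The components of b(v_1), b(v_2), b(v_3) are x_1 x_2 x_3, then a_1 a_2 a_3, then x_2 x_3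
  x_1, so each coarse edge splits into three. Writing the norms entrywise leaves one scalar gasket
  for every pair (s, t).\<close>

lemma energy_good_Suc:
  assumes "good (Suc n) b"
  defines "x j \<equiv> comp_at (comp_at b 1) j" and "a j \<equiv> comp_at (comp_at b 2) j"
  shows "energy b = 2 * (\<Sum>s<d3 n. \<Sum>t<d3 n.
    (cmod (x 1 $$ (s, t) - a 1 $$ (s, t)))\<^sup>2 + (cmod (x 2 $$ (s, t) - a 2 $$ (s, t)))\<^sup>2
    + (cmod (x 3 $$ (s, t) - a 3 $$ (s, t)))\<^sup>2 + (cmod (x 2 $$ (s, t) - a 1 $$ (s, t)))\<^sup>2
    + (cmod (x 3 $$ (s, t) - a 2 $$ (s, t)))\<^sup>2 + (cmod (x 1 $$ (s, t) - a 3 $$ (s, t)))\<^sup>2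
    + (cmod (x 1 $$ (s, t) - x 2 $$ (s, t)))\<^sup>2 + (cmod (x 2 $$ (s, t) - x 3 $$ (s, t)))\<^sup>2
    + (cmod (x 1 $$ (s, t) - x 3 $$ (s, t)))\<^sup>2)" (is "_ = 2 * ?S")
proof -
  have b: "b \<in> M (Suc (Suc n))" "bdiag (comp_at b 1)" "bdiag (comp_at b 3)" "bdiag (comp_at b 2)"
    using assms(1) good_bdiag by auto
  then have c: "comp_at b i \<in> M (Suc n)" for i by auto
  then have xa: "x j \<in> M n" "a j \<in> M n" for j by (auto simp: x_def a_def)
  have c3: "comp_at (comp_at b 3) 1 = x 2" "comp_at (comp_at b 3) 2 = x 3" "comp_at (comp_at b 3) 3 = x 1"
    using assms(1) comp_at_4[of "comp_at b 1"] by (auto simp: x_def)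
  have split: "fro (u - v) = fro (comp_at u 1 - comp_at v 1) + fro (comp_at u 2 - comp_at v 2) + fro (comp_at u 3 - comp_at v 3)"
    if "u \<in> M (Suc n)" "v \<in> M (Suc n)" "bdiag u" "bdiag v" for u v
    using fro_bdiag[of "u - v" "d3 n" "d3 n"] bdiag_minus[OF that] that
    by (simp add: comp_at_M_simps(2)[OF that(1,2)] d3_Suc[symmetric] minus_carrier_mat)
  have "energy b = 2 * (fro (x 1 - a 1) + fro (x 2 - a 2) + fro (x 3 - a 3)
      + fro (a 1 - x 2) + fro (a 2 - x 3) + fro (a 3 - x 1) + fro (x 1 - x 2) + fro (x 2 - x 3) + fro (x 3 - x 1))"
    unfolding energy_eq[OF b(1)] using split[OF c[of 1] c[of 2]] split[OF c[of 2] c[of 3]] split[OF c[of 1] c[of 3]] b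
    by (simp add: c3 x_def[symmetric] a_def[symmetric])
  also have "\<dots> = 2 * (fro (x 1 - a 1) + fro (x 2 - a 2) + fro (x 3 - a 3)
      + fro (x 2 - a 1) + fro (x 3 - a 2) + fro (x 1 - a 3) + fro (x 1 - x 2) + fro (x 2 - x 3) + fro (x 1 - x 3))"
    using fro_diff_commute[OF xa(1)[of 2] xa(2)[of 1]] fro_diff_commute[OF xa(1)[of 3] xa(2)[of 2]]
      fro_diff_commute[OF xa(1)[of 1] xa(2)[of 3]] fro_diff_commute[OF xa(1)[of 1] xa(1)[of 3]] by simp
  also have "\<dots> = 2 * ?S"
    by (simp only: fro_diff_entries[OF xa(1) xa(1)] fro_diff_entries[OF xa(1) xa(2)] sum.distrib)
  finally show ?thesis .
qed

lemma energy_good_entries: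
  assumes "good n b"
  defines "a j \<equiv> comp_at b j"
  shows "energy b = 2 * (\<Sum>s<d3 n. \<Sum>t<d3 n. (cmod (a 1 $$ (s, t) - a 2 $$ (s, t)))\<^sup>2
    + (cmod (a 2 $$ (s, t) - a 3 $$ (s, t)))\<^sup>2 + (cmod (a 1 $$ (s, t) - a 3 $$ (s, t)))\<^sup>2)"
proof -
  have b: "b \<in> M (Suc n)" using assms(1) by (rule good_carrier)
  then have c: "a i \<in> M n" for i by (auto simp: a_def)
  show ?thesis
    unfolding energy_eq[OF b] a_def[symmetric] by (simp only: fro_diff_entries[OF c c] sum.distrib)
qed

text \<open>The origin of the renormalisation factor 5/3: the scalar inequality is summed over all
  entries.\<close>

lemma energy_mono:
  assumes "good (Suc n) b"
  shows "3 / 5 * energy (comp_at b 2) \<le> energy b"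
proof -
  have g: "good n (comp_at b 2)" using assms by simp
  have le: "3 / 5 * (2 * a) \<le> 2 * b" if "3 / 5 * a \<le> b" for a b :: real
    using that by simp
  show ?thesis
    unfolding energy_good_Suc[OF assms] energy_good_entries[OF g] sum_distrib_left
    by (intro sum_mono le complex_gasket_ineq(1))
qed

lemma assemble_bdiag:
  assumes y: "y1 \<in> M n" "y2 \<in> M n" "y3 \<in> M n"
  obtains c where "c \<in> M (Suc n)" "bdiag c" "comp_at c 1 = y1" "comp_at c 2 = y2" "comp_at c 3 = y3"
proof
  let ?t = "\<lambda>y i. y \<otimes>\<^sub>m munit i i"
  let ?c = "?t y1 1 + ?t y2 2 + ?t y3 3"
  have t: "?t y i \<in> M (Suc n)" if "y \<in> M n" for y i using that by (auto intro: tensor_M)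
  have t2: "?t y1 1 + ?t y2 2 \<in> M (Suc n)" using t y by auto
  show "?c \<in> M (Suc n)" using t y by auto
  show "bdiag ?c"
    by (intro bdiag_add[OF t2 t] bdiag_add[OF t t] bdiag_tensor_munit y)
  have comp: "comp_at ?c i = comp_at (?t y1 1) i + comp_at (?t y2 2) i + comp_at (?t y3 3) i" for i
    by (simp only: comp_at_M_simps(1)[OF t2 t[OF y(3)]] comp_at_M_simps(1)[OF t[OF y(1)] t[OF y(2)]])
  show "comp_at ?c 1 = y1" "comp_at ?c 2 = y2" "comp_at ?c 3 = y3"
    unfolding comp comp_at_tensor_munit[OF y(1)] comp_at_tensor_munit[OF y(2)] comp_at_tensor_munit[OF y(3)]
    using y by auto
qed

lemma harmonic_extension:
  assumes b: "good n b"
  obtains b' where "good (Suc n) b'" "comp_at b' 2 = b" "energy b' = 3 / 5 * energy b"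
proof -
  have bM: "b \<in> M (Suc n)" using b by (rule good_carrier)
  define a where "a j = comp_at b j" for j
  define h where "h i j k = mat (d3 n) (d3 n) (\<lambda>st. harm (a i $$ st) (a j $$ st) (a k $$ st))" for i j k
  have hM: "h i j k \<in> M n" for i j k by (simp add: h_def)
  obtain u where u: "u \<in> M (Suc n)" "bdiag u" "comp_at u 1 = h 1 3 2" "comp_at u 2 = h 2 1 3" "comp_at u 3 = h 3 2 1"
    using assemble_bdiag[OF hM hM hM] by metis
  \<comment> \<open>The cyclic shift relative to u is the consistency clause of \<open>good\<close>:
    entry j of b(v_3) is entry j + 1 of b(v_1).\<close>
  obtain v where v: "v \<in> M (Suc n)" "bdiag v" "comp_at v 1 = h 2 1 3" "comp_at v 2 = h 3 2 1" "comp_at v 3 = h 1 3 2"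
    using assemble_bdiag[OF hM hM hM] by metis
  obtain b' where b': "b' \<in> M (Suc (Suc n))" "bdiag b'" "comp_at b' 1 = u" "comp_at b' 2 = b" "comp_at b' 3 = v"
    using assemble_bdiag[OF u(1) bM v(1)] by metis
  have g: "good (Suc n) b'"
    using b' u v b comp_at_4[of u] by auto
  have sc: "2 * y = 3 / 5 * (2 * x)" if "y = 3 / 5 * x" for x y :: real
    using that by simp
  have "energy b' = 3 / 5 * energy b"
    unfolding energy_good_Suc[OF g] energy_good_entries[OF b] b' sum_distrib_left
    by (intro sum.cong refl sc complex_gasket_ineq(2)) (auto simp: u h_def a_def)
  then show ?thesis using that g b' by metis
qed

section \<open>Square roots and positive parts in C*-algebras\<close>

lemma scaleC_zero [simp]: "c *\<^sub>C (0 :: 'a::complex_vec) = 0"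
  using scaleC_add_right[of c "0::'a" 0] by simp

lemma scaleC_minus_one: "(- 1) *\<^sub>C x = - (x :: 'a::complex_vec)"
  using scaleC_of_real[of "- 1" x] by simp

lemma scaleC_minus_right: "c *\<^sub>C (- x) = - (c *\<^sub>C (x :: 'a::complex_vec))"
  using scaleC_add_right[of c x "- x"] by (simp add: eq_neg_iff_add_eq_0 add.commute)

lemma adj_scaleR: "adj (r *\<^sub>R x) = r *\<^sub>R adj (x :: 'u::cstar_algebra_1)"
  using adj_scaleC[of "complex_of_real r" x] by (simp add: scaleC_of_real)

lemma adj_zero [simp]: "adj (0 :: 'u::cstar_algebra_1) = 0"
  using adj_scaleR[of 0 "0::'u"] by simp

lemma adj_minus: "adj (- x) = - adj (x :: 'u::cstar_algebra_1)"
  using adj_scaleR[of "- 1" x] by simp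

lemma adj_diff: "adj (x - y) = adj x - adj (y :: 'u::cstar_algebra_1)"
  using adj_add[of x "- y"] by (simp add: adj_minus)

lemma adj_one [simp]: "adj (1 :: 'u::cstar_algebra_1) = 1"
  by (metis adj_adj adj_mult mult_1_left mult_1_right)

lemma norm_adj [simp]: "norm (adj x) = norm (x :: 'u::cstar_algebra_1)"
proof -
  have "norm y \<le> norm (adj y)" for y :: 'u
  proof (cases "y = 0")
    case False
    have "norm y * norm y \<le> norm (adj y) * norm y"
      using cstar_identity[of y] norm_mult_ineq[of "adj y" y] by (simp add: power2_eq_square)
    then show ?thesis
      using False by simp
  qed simp
  from this[of x] this[of "adj x"] show ?thesis
    by (simp add: adj_adj)
qed

lemma bounded_linear_adj: "bounded_linear (adj :: 'u::cstar_algebra_1 \<Rightarrow> 'u)"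
  by (rule bounded_linear_intro[where K = 1]) (simp_all add: adj_add adj_scaleR)

lemma adj_power: "adj (x ^ k) = adj (x :: 'u::cstar_algebra_1) ^ k"
  by (induction k) (simp_all add: adj_mult power_commutes)

lemma norm_square_selfadjoint: "adj x = x \<Longrightarrow> norm (x * x) = (norm (x :: 'u::cstar_algebra_1))\<^sup>2"
  using cstar_identity[of x] by simp

definition cstar_sub :: "'u::cstar_algebra_1 set \<Rightarrow> bool" where
  "cstar_sub A \<longleftrightarrow> closed A \<and> 1 \<in> A \<and> (\<forall>x\<in>A. \<forall>y\<in>A. x + y \<in> A \<and> x * y \<in> A) \<and>
     (\<forall>c. \<forall>x\<in>A. c *\<^sub>C x \<in> A) \<and> (\<forall>x\<in>A. adj x \<in> A)"

lemma cstar_subD: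
  assumes "cstar_sub A"
  shows "closed A" "1 \<in> A" "0 \<in> A"
    "x \<in> A \<Longrightarrow> y \<in> A \<Longrightarrow> x + y \<in> A" "x \<in> A \<Longrightarrow> y \<in> A \<Longrightarrow> x * y \<in> A" "x \<in> A \<Longrightarrow> y \<in> A \<Longrightarrow> x - y \<in> A"
    "x \<in> A \<Longrightarrow> c *\<^sub>C x \<in> A" "x \<in> A \<Longrightarrow> r *\<^sub>R x \<in> A" "x \<in> A \<Longrightarrow> adj x \<in> A" "x \<in> A \<Longrightarrow> x ^ k \<in> A"
proof -
  show *: "closed A" "1 \<in> A" "\<And>x y. x \<in> A \<Longrightarrow> y \<in> A \<Longrightarrow> x + y \<in> A" "\<And>x y. x \<in> A \<Longrightarrow> y \<in> A \<Longrightarrow> x * y \<in> A"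
    "\<And>x c. x \<in> A \<Longrightarrow> c *\<^sub>C x \<in> A" "\<And>x. x \<in> A \<Longrightarrow> adj x \<in> A"
    using assms unfolding cstar_sub_def by auto
  show sR: "x \<in> A \<Longrightarrow> r *\<^sub>R x \<in> A" for x r
    using *(5)[of x "complex_of_real r"] by (simp add: scaleC_of_real)
  show "0 \<in> A" using sR[of 1 0] *(2) by simp
  show "x \<in> A \<Longrightarrow> y \<in> A \<Longrightarrow> x - y \<in> A"
    using *(3)[of x "- y"] sR[of y "- 1"] by simp
  show "x \<in> A \<Longrightarrow> x ^ k \<in> A"
    using *(2,4) by (induction k) auto
qed

text \<open>The Taylor coefficients of \<open>\<lambda>y. sqrt (1 - y)\<close>.\<close>

definition sqrt_coeff :: "nat \<Rightarrow> real" where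
  "sqrt_coeff n = ((1 / 2) gchoose n) * (- 1) ^ n"

text \<open>These are the Taylor coefficients of (1 - y) to the power -1/2; the quotient of
  consecutive ones is (n + 1/2) / (n + 1).\<close>

lemma neg_half_gbinomial_nonneg: "0 \<le> (- 1) ^ n * ((- (1 / 2) :: real) gchoose n)"
proof (induction n)
  case (Suc n)
  define g where "g = ((- (1 / 2) :: real) gchoose n)"
  define g' where "g' = ((- (1 / 2) :: real) gchoose Suc n)"
  have "(real n + 1) * g' = - (1 / 2 + real n) * g"
    using gbinomial_mult_1[of "- (1 / 2) :: real" n] by (simp add: g_def g'_def algebra_simps)
  then have "(real n + 1) * ((- 1) ^ Suc n * g') = (1 / 2 + real n) * ((- 1) ^ n * g)"
    by (metis (no_types, opaque_lifting) minus_mult_left mult.left_commute mult_minus_right power_Suc mult_1 minus_minus)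
  moreover have "0 \<le> (1 / 2 + real n) * ((- 1) ^ n * g)"
    using Suc by (simp add: g_def)
  ultimately have "0 \<le> (real n + 1) * ((- 1) ^ Suc n * g')"
    by simp
  then show ?case
    unfolding g'_def[symmetric] by (smt (verit) mult_pos_neg of_nat_0_le_iff)
qed simp

lemma sqrt_coeff_0 [simp]: "sqrt_coeff 0 = 1"
  by (simp add: sqrt_coeff_def)

text \<open>Absorption expresses that the derivative of sqrt (1 - y) is minus half of (1 - y) to the
  power -1/2, whose coefficients are nonnegative.\<close>

lemma sqrt_coeff_Suc_nonpos: "sqrt_coeff (Suc n) \<le> 0"
proof -
  have "real (Suc n) * ((1 / 2) gchoose Suc n) = (1 / 2) * ((1 / 2 - 1) gchoose n)"
    by (rule gbinomial_absorption)
  then have "real (Suc n) * sqrt_coeff (Suc n) = - (1 / 2) * ((- 1) ^ n * (- (1 / 2) gchoose n))"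
    unfolding sqrt_coeff_def by simp
  then have "real (Suc n) * sqrt_coeff (Suc n) \<le> 0"
    using neg_half_gbinomial_nonneg[of n] by linarith
  then show ?thesis
    by (simp add: mult_le_0_iff)
qed

text \<open>The sum of the coefficients up to m is (-1)^m times (-1/2 choose m), hence nonnegative,
  while all coefficients after the leading 1 are nonpositive. This gives absolute convergence on the
  closed unit ball, boundary included.\<close>

lemma sqrt_coeff_abs_sum_le: "(\<Sum>k<m. \<bar>sqrt_coeff (Suc k)\<bar>) \<le> 1"
proof -
  have "(\<Sum>k\<le>m. sqrt_coeff k) = (- 1) ^ m * ((1 / 2 - 1) gchoose m)"
    unfolding sqrt_coeff_def by (rule gbinomial_sum_lower_neg)
  then have "0 \<le> (\<Sum>k\<le>m. sqrt_coeff k)"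
    using neg_half_gbinomial_nonneg[of m] by simp
  also have "(\<Sum>k\<le>m. sqrt_coeff k) = 1 + (\<Sum>k<m. sqrt_coeff (Suc k))"
    by (simp add: sum.atMost_shift)
  also have "\<dots> = 1 - (\<Sum>k<m. \<bar>sqrt_coeff (Suc k)\<bar>)"
    using sqrt_coeff_Suc_nonpos by (simp add: sum_negf abs_of_nonpos)
  finally show ?thesis by simp
qed

lemma summable_abs_sqrt_coeff_Suc: "summable (\<lambda>k. \<bar>sqrt_coeff (Suc k)\<bar>)"
  by (rule summableI_nonneg_bounded[OF _ sqrt_coeff_abs_sum_le]) simp

text \<open>Vandermonde with 1/2 + 1/2 = 1: the square of the series is 1 - y.\<close>

lemma sqrt_coeff_convolution:
  "(\<Sum>i\<le>n. sqrt_coeff i * sqrt_coeff (n - i)) = (if n = 0 then 1 else if n = 1 then - 1 else 0)"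
proof -
  have "(\<Sum>i\<le>n. sqrt_coeff i * sqrt_coeff (n - i)) = (\<Sum>i\<le>n. ((1 / 2) gchoose i) * ((1 / 2) gchoose (n - i)) * (- 1) ^ n)"
    unfolding sqrt_coeff_def by (intro sum.cong) (auto simp: power_add[symmetric] mult_ac)
  also have "\<dots> = (- 1) ^ n * ((1 / 2 + 1 / 2) gchoose n)"
    unfolding sum_distrib_right[symmetric] gbinomial_Vandermonde[symmetric] by (simp add: atLeast0AtMost)
  also have "((1 / 2 + 1 / 2 :: real) gchoose n) = real (1 choose n)"
    using binomial_gbinomial[of 1 n, where ?'a = real] by simp
  finally show ?thesis
    by (auto simp: binomial_eq_0 One_nat_def)
qed

text \<open>The root is the binomial series at 1 - x. Self-adjointness, membership in the closed
  algebra and commutation are inherited from its terms. The bound on \<open>1 - s\<close> is what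
  \<open>norm_one_minus_orthogonal_le\<close> later takes as input.\<close>

lemma cstar_sqrt:
  assumes A: "cstar_sub A" and x: "x \<in> A" "adj x = x" "norm (1 - x) \<le> 1"
  obtains s where "s \<in> A" "adj s = s" "s * s = x" "norm (1 - s) \<le> 1" "\<And>z. z * x = x * z \<Longrightarrow> z * s = s * z"
proof
  define y where "y = 1 - x"
  have y: "y \<in> A" "adj y = y" "norm y \<le> 1"
    using x cstar_subD[OF A] by (auto simp: y_def adj_diff)
  define f where "f n = sqrt_coeff n *\<^sub>R y ^ n" for n
  have nf: "norm (f n) \<le> \<bar>sqrt_coeff n\<bar>" for n
  proof -
    have "norm (y ^ n) \<le> 1"
      using norm_power_ineq[of y n] power_le_one[OF norm_ge_zero y(3), of n] by linarith
    then show ?thesis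
      by (simp add: f_def mult_left_le)
  qed
  have "summable (\<lambda>n. \<bar>sqrt_coeff n\<bar>)"
    using summable_abs_sqrt_coeff_Suc summable_Suc_iff[of "\<lambda>n. \<bar>sqrt_coeff n\<bar>"] by simp
  then have sum_abs: "summable (\<lambda>n. norm (f n))"
    by (rule summable_comparison_test'[where N = 0]) (simp add: nf)
  then have sf: "summable f"
    by (rule summable_norm_cancel)
  define s where "s = suminf f"
  have fA: "f n \<in> A" for n
    unfolding f_def using y cstar_subD[OF A] by auto
  have "sum f {..<n} \<in> A" for n
    using fA cstar_subD[OF A] by (induction n) auto
  then show "s \<in> A"
    using closed_sequentially[OF cstar_subD(1)[OF A] _ summable_LIMSEQ[OF sf]] by (simp add: s_def)
  show "adj s = s"
  proof -
    have "adj (f n) = f n" for n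
      by (simp add: f_def adj_scaleR adj_power y)
    then show ?thesis
      unfolding s_def bounded_linear.suminf[OF bounded_linear_adj sf] by simp
  qed
  have "s * s = (\<Sum>n. \<Sum>i\<le>n. f i * f (n - i))"
    unfolding s_def by (rule Cauchy_product[OF sum_abs sum_abs])
  also have "(\<lambda>n. \<Sum>i\<le>n. f i * f (n - i)) = (\<lambda>n. (if n = 0 then 1 else if n = 1 then - 1 else 0) *\<^sub>R y ^ n)"
    unfolding sqrt_coeff_convolution[symmetric] f_def
    by (auto simp: fun_eq_iff scaleR_sum_left power_add[symmetric] intro!: sum.cong)
  also have "(\<Sum>n. (if n = 0 then 1 else if n = 1 then - 1 else 0) *\<^sub>R y ^ n)
      = (\<Sum>n\<in>{0, 1}. (if n = 0 then 1 else if n = 1 then - 1 else 0) *\<^sub>R y ^ n)"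
    by (rule suminf_finite) auto
  also have "\<dots> = x"
    by (simp add: y_def)
  finally show "s * s = x" .
  \<comment> \<open>Without its leading 1 the series is s - 1, and its coefficients have absolute
    sum at most 1.\<close>
  have sn: "summable (\<lambda>n. norm (f (Suc n)))"
    using sum_abs summable_Suc_iff[of "\<lambda>n. norm (f n)"] by simp
  have "norm (suminf (\<lambda>n. f (Suc n))) \<le> (\<Sum>n. norm (f (Suc n)))"
    by (rule summable_norm[OF sn])
  also have "\<dots> \<le> (\<Sum>n. \<bar>sqrt_coeff (Suc n)\<bar>)"
    by (rule suminf_le[OF _ sn summable_abs_sqrt_coeff_Suc]) (rule nf)
  also have "\<dots> \<le> 1"
    by (rule suminf_le_const[OF summable_abs_sqrt_coeff_Suc sqrt_coeff_abs_sum_le])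
  finally show "norm (1 - s) \<le> 1"
    using suminf_split_head[OF sf] by (simp add: s_def f_def norm_minus_commute)
  fix z assume z: "z * x = x * z"
  then have "z * y = y * z" by (simp add: y_def algebra_simps)
  then have "z * y ^ n = y ^ n * z" for n
    using power_commuting_commutes[of y z n] by simp
  then show "z * s = s * z"
    unfolding s_def suminf_mult[OF sf, symmetric] suminf_mult2[OF sf] by (simp add: f_def)
qed

text \<open>The powers of \<open>1 - p\<close> stay bounded, because those of \<open>1 - (p + q) = (1 - p) (1 - q)\<close> do.\<close>

lemma norm_one_minus_orthogonal_le:
  fixes p q :: "'u::cstar_algebra_1"
  assumes p: "adj p = p" and pq: "p * q = 0" "q * p = 0" and le: "norm (1 - (p + q)) \<le> 1"
  shows "norm (1 - p) \<le> 1"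
proof -
  have bound: "norm ((1 - p) ^ k) \<le> 3" for k
  proof -
    \<comment> \<open>P and N are polynomials in p and in q without constant term, so P N = 0 and P
      + N = 1 - (1 - (p + q))^k has norm at most 2. The square of norm P is the norm of P (P + N),
      which bounds norm P by 2.\<close>
    define P where "P = 1 - (1 - p) ^ k"
    define N where "N = 1 - (1 - q) ^ k"
    have comm: "(1 - p) * (1 - q) = (1 - q) * (1 - p)" "(1 - p) * (1 - q) = 1 - (p + q)"
      using pq by (simp_all add: algebra_simps)
    have "(1 - p) ^ k * (1 - q) ^ k = ((1 - p) * (1 - q)) ^ k"
    proof (induction k)
      case (Suc k)
      have "(1 - p) ^ Suc k * (1 - q) ^ Suc k = (1 - p) * ((1 - p) ^ k * (1 - q)) * (1 - q) ^ k"
        by (simp add: mult.assoc)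
      also have "\<dots> = ((1 - p) * (1 - q)) * ((1 - p) ^ k * (1 - q) ^ k)"
        unfolding power_commuting_commutes[OF comm(1)] by (simp add: mult.assoc)
      finally show ?case
        using Suc by simp
    qed simp
    then have prod: "(1 - P) * (1 - N) = (1 - (p + q)) ^ k"
      by (simp add: P_def N_def comm(2))
    have "(1 - p) ^ j * q = q" for j
      by (induction j) (simp_all add: mult.assoc left_diff_distrib pq)
    then have "P * (1 - q) = P"
      by (simp add: P_def left_diff_distrib right_diff_distrib)
    then have "P * (1 - q) ^ j = P" for j
      by (induction j) (simp_all add: mult.assoc[symmetric])
    then have PN: "P * N = 0"
      by (simp add: N_def right_diff_distrib)
    have "P + N = 1 - (1 - (p + q)) ^ k"
      using prod PN by (simp add: algebra_simps)
    moreover have "norm ((1 - (p + q)) ^ k) \<le> 1"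
      using norm_power_ineq[of "1 - (p + q)" k] power_le_one[OF norm_ge_zero le, of k] by linarith
    ultimately have w: "norm (P + N) \<le> 2"
      using norm_triangle_ineq4[of 1 "(1 - (p + q)) ^ k"] by simp
    have "adj P = P"
      by (simp add: P_def adj_diff adj_power p)
    then have "(norm P)\<^sup>2 = norm (P * (P + N))"
      using norm_square_selfadjoint[of P] PN by (simp add: algebra_simps)
    also have "\<dots> \<le> norm P * 2"
      using norm_mult_ineq[of P "P + N"] w by (meson mult_left_mono norm_ge_zero order_trans)
    finally have "norm P \<le> 2"
      by (cases "norm P = 0") (simp_all add: power2_eq_square)
    then show ?thesis
      using norm_triangle_ineq4[of 1 P] by (simp add: P_def)
  qed
  \<comment> \<open>For a self-adjoint element and exponents that are powers of two the C*-identity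
    makes the norm multiplicative, so a norm above 1 would violate the uniform bound 3.\<close>
  have pow: "norm ((1 - p) ^ (2 ^ j)) = norm (1 - p) ^ (2 ^ j)" for j
  proof (induction j)
    case (Suc j)
    have "adj ((1 - p) ^ (2 ^ j)) = (1 - p) ^ (2 ^ j)"
      by (simp add: adj_power adj_diff p)
    then show ?case
      using norm_square_selfadjoint[of "(1 - p) ^ (2 ^ j)"] Suc
      by (simp add: mult_2 power_add power2_eq_square)
  qed (simp add: One_nat_def)
  show ?thesis
  proof (rule ccontr)
    assume "\<not> ?thesis"
    then have gt: "1 < norm (1 - p)" by simp
    then obtain n where "3 < norm (1 - p) ^ n"
      using real_arch_pow by blast
    also have "\<dots> \<le> norm (1 - p) ^ (2 ^ n)"
      using gt by (intro power_increasing) (auto intro: less_imp_le)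
    also have "\<dots> \<le> 3"
      using bound[of "2 ^ n"] pow by simp
    finally show False by simp
  qed
qed

text \<open>Here h is the absolute value of the rescaled element d, the root of d d, and 4 p q = h h
  - d d = 0 because h commutes with d. The bound \<open>norm (1 - h) \<le> 1\<close> passes to p and
  q by orthogonality, which gives their roots. The hypothesis \<open>sq\<close> is what makes the
  root of d d available.\<close>

lemma cstar_pos_neg_parts:
  fixes c :: "'u::cstar_algebra_1"
  assumes A: "cstar_sub A" and c: "c \<in> A" "adj c = c"
    and sq: "\<And>d :: 'u. adj d = d \<Longrightarrow> norm d \<le> 1 \<Longrightarrow> norm (1 - d * d) \<le> 1"
  obtains s t where "s \<in> A" "t \<in> A" "adj s = s" "adj t = t" "c = s * s - t * t"
    "(s * s) * (t * t) = 0"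
proof -
  \<comment> \<open>The summand 1 keeps K positive when c = 0.\<close>
  define K where "K = norm c + 1"
  have K: "K > 0" by (simp add: K_def add_nonneg_pos)
  define d where "d = (1 / K) *\<^sub>R c"
  have d: "d \<in> A" "adj d = d" "norm d \<le> 1"
    using c K cstar_subD[OF A] by (auto simp: d_def adj_scaleR K_def)
  have "d * d \<in> A" "adj (d * d) = d * d" "norm (1 - d * d) \<le> 1"
    using d sq cstar_subD[OF A] by (auto simp: adj_mult)
  then obtain h where h: "h \<in> A" "adj h = h" "h * h = d * d" "norm (1 - h) \<le> 1" "d * h = h * d"
    using cstar_sqrt[OF A] by (metis mult.assoc)
  define p where "p = (1 / 2) *\<^sub>R (h + d)"
  define q where "q = (1 / 2) *\<^sub>R (h - d)"
  have pq: "p \<in> A" "q \<in> A" "adj p = p" "adj q = q" "p * q = 0" "q * p = 0"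
    using h d cstar_subD[OF A] by (auto simp: p_def q_def adj_scaleR adj_add adj_diff algebra_simps)
  have hd: "p + q = h" "q + p = h" "p - q = d"
    by (simp_all add: p_def q_def algebra_simps flip: scaleR_add_left)
  have "norm (1 - p) \<le> 1" "norm (1 - q) \<le> 1"
    using norm_one_minus_orthogonal_le[of p q] norm_one_minus_orthogonal_le[of q p] pq hd h by auto
  then obtain s t where st: "s \<in> A" "t \<in> A" "adj s = s" "adj t = t" "s * s = p" "t * t = q"
    using cstar_sqrt[OF A] pq by metis
  \<comment> \<open>Undoes the scaling c = K d on the level of square roots.\<close>
  define r where "r = sqrt K"
  have r: "r * r = K" using K by (simp add: r_def)
  show ?thesis
  proof
    show "r *\<^sub>R s \<in> A" "r *\<^sub>R t \<in> A" "adj (r *\<^sub>R s) = r *\<^sub>R s" "adj (r *\<^sub>R t) = r *\<^sub>R t"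
      using st cstar_subD[OF A] by (auto simp: adj_scaleR)
    have "c = K *\<^sub>R d" using K by (simp add: d_def)
    then show "c = (r *\<^sub>R s) * (r *\<^sub>R s) - (r *\<^sub>R t) * (r *\<^sub>R t)"
      by (simp add: st r hd(3)[symmetric] scaleR_diff_right)
    show "((r *\<^sub>R s) * (r *\<^sub>R s)) * ((r *\<^sub>R t) * (r *\<^sub>R t)) = 0"
      by (simp add: st r pq)
  qed
qed

section \<open>The limit algebra, its trace and its slice maps\<close>

text \<open>Conditions under which the \<open>F n\<close> define one bounded linear functional on
  the limit. The threshold \<open>n0\<close> is there because rho_m applies to tensors with at least
  m + 1 factors.\<close>

definition compat_functional :: "nat \<Rightarrow> real \<Rightarrow> (nat \<Rightarrow> complex mat \<Rightarrow> complex) \<Rightarrow> bool" where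
  "compat_functional n0 C F \<longleftrightarrow> (\<forall>n\<ge>n0. \<forall>x\<in>M n. F (Suc n) (x \<otimes>\<^sub>m 1\<^sub>m 3) = F n x \<and>
     cmod (F n x) \<le> C * mat_norm x \<and> (\<forall>c. F n (c \<cdot>\<^sub>m x) = c * F n x) \<and> (\<forall>y\<in>M n. F n (x + y) = F n x + F n y))"

definition up :: "nat \<Rightarrow> complex mat \<Rightarrow> complex mat" where
  "up k = (\<lambda>x. x \<otimes>\<^sub>m 1\<^sub>m 3) ^^ k"

text \<open>On tensors with m + 1 + k factors this is rho_m; \<open>up\<close> is the inclusion in
  the opposite direction.\<close>

definition vcut :: "nat \<Rightarrow> complex mat \<Rightarrow> complex mat" where
  "vcut k = (\<lambda>b. comp_at b 2) ^^ k"

lemma tensor_one_M: "x \<in> M n \<Longrightarrow> x \<otimes>\<^sub>m 1\<^sub>m 3 \<in> M (Suc n)"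
  by (rule tensor_M) auto

lemma up_M: "x \<in> M n \<Longrightarrow> up k x \<in> M (n + k)"
  by (induction k) (auto simp: up_def intro: tensor_one_M)

lemma cut_0 [simp]: "vcut 0 x = x"
  by (simp add: vcut_def)

lemma cut_Suc: "vcut (Suc k) x = comp_at (vcut k x) 2"
  by (simp add: vcut_def)

lemma cut_Suc_right: "vcut (Suc k) x = vcut k (comp_at x 2)"
  by (simp add: vcut_def funpow_Suc_right del: funpow.simps)

lemma cut_M: "x \<in> M (n + k) \<Longrightarrow> vcut k x \<in> M n"
  by (induction k arbitrary: n) (auto simp: cut_Suc)

lemma cut_add: "x \<in> M (n + k) \<Longrightarrow> y \<in> M (n + k) \<Longrightarrow> vcut k (x + y) = vcut k x + vcut k y"
proof (induction k arbitrary: n)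
  case (Suc k)
  then have "x \<in> M (Suc n + k)" "y \<in> M (Suc n + k)" by auto
  from Suc.IH[OF this] comp_at_M_simps(1)[OF cut_M[OF this(1)] cut_M[OF this(2)]]
  show ?case by (simp add: cut_Suc)
qed simp

lemma cut_smult: "x \<in> M (n + k) \<Longrightarrow> vcut k (c \<cdot>\<^sub>m x) = c \<cdot>\<^sub>m vcut k x"
proof (induction k arbitrary: n)
  case (Suc k)
  then have "x \<in> M (Suc n + k)" by auto
  from Suc.IH[OF this] comp_at_M_simps(3)[OF cut_M[OF this]]
  show ?case by (simp add: cut_Suc)
qed simp

lemma cut_adjoint: "x \<in> M (n + k) \<Longrightarrow> vcut k (mat_adjoint x) = mat_adjoint (vcut k x)"
proof (induction k arbitrary: n)
  case (Suc k)
  then have "x \<in> M (Suc n + k)" by auto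
  from Suc.IH[OF this] comp_at_M_simps(4)[OF cut_M[OF this]]
  show ?case by (simp add: cut_Suc)
qed simp

lemma mat_norm_cut_le: "x \<in> M (n + k) \<Longrightarrow> mat_norm (vcut k x) \<le> mat_norm x"
proof (induction k arbitrary: n)
  case (Suc k)
  then have x: "x \<in> M (Suc n + k)" by auto
  have "mat_norm (comp_at (vcut k x) 2) \<le> mat_norm (vcut k x)"
    using mat_norm_comp_at_le[of "vcut k x" "d3 n" "d3 n" 2] cut_M[OF x] by (simp add: d3_Suc)
  then show ?case
    using Suc.IH[OF x] by (simp add: cut_Suc)
qed simp

lemma cut_tensor_one: "x \<in> M n \<Longrightarrow> vcut (Suc k) (x \<otimes>\<^sub>m 1\<^sub>m 3) = vcut k x"
  by (simp add: cut_Suc_right comp_at_tensor_one)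

lemma good_cut: "good (n + k) x \<Longrightarrow> good n (vcut k x)"
proof (induction k arbitrary: n)
  case (Suc k)
  then have "good (Suc n) (vcut k x)" by (simp only: add_Suc add_Suc_right)
  then show ?case by (simp add: cut_Suc)
qed simp

text \<open>The state at v_2 is a character of the diagonal subalgebra, and every intermediate slice
  of a \<open>good\<close> matrix is again \<open>good\<close>, hence block diagonal.\<close>

lemma cut_good_mult: "good (n + k) x \<Longrightarrow> good (n + k) y \<Longrightarrow> vcut k (x * y) = vcut k x * vcut k y"
proof (induction k arbitrary: n)
  case (Suc k)
  then have g: "good (Suc n + k) x" "good (Suc n + k) y" by auto
  then have "good (Suc n) (vcut k x)" "good (Suc n) (vcut k y)" by (auto intro: good_cut simp del: good.simps)
  then show ?case
    using Suc.IH[OF g] comp_at_M_mult[OF good_carrier good_carrier good_bdiag] by (simp add: cut_Suc del: good.simps)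
qed simp

text \<open>Each diagonal entry occurs three times in x tensored with 1. Cauchy-Schwarz against the
  identity bounds the square of the trace by d \<open>fro x\<close>, hence by d^2 times the squared
  operator norm with d the dimension, so the normalised trace is contractive.\<close>

lemma compat_functional_trace: "compat_functional 0 1 (\<lambda>n x. mtrace x / 3 ^ n)"
  unfolding compat_functional_def
proof (intro allI ballI impI conjI)
  fix n x assume x: "x \<in> M n"
  have d: "d3 n > 0" by (simp add: d3_def)
  have "(x \<otimes>\<^sub>m 1\<^sub>m 3) $$ (3 * s + p, 3 * s + p) = x $$ (s, s)" if "s < d3 n" "p < 3" for s p
    using x that by (simp add: index_tensor mult.commute[of _ 3] times3_add_less)
  from this[of _ 0] this[of _ 1] this[of _ 2]
  have "mtrace (x \<otimes>\<^sub>m 1\<^sub>m 3) = (\<Sum>s<d3 n. 3 * x $$ (s, s))"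
    unfolding mtrace_def using x by (simp add: mult.commute[of _ 3] sum_lessThan_times3)
  then show "mtrace (x \<otimes>\<^sub>m 1\<^sub>m 3) / 3 ^ Suc n = mtrace x / 3 ^ n"
    using x by (simp add: mtrace_def sum_distrib_left[symmetric])
  have "(\<Sum>i<d3 n. (cmod (x $$ (i, i)))\<^sup>2) \<le> (\<Sum>i<d3 n. \<Sum>j<d3 n. (cmod (x $$ (i, j)))\<^sup>2)"
    by (intro sum_mono member_le_sum[where f = "\<lambda>j. (cmod (x $$ (_, j)))\<^sup>2"]) auto
  then have "(\<Sum>i<d3 n. (cmod (x $$ (i, i)))\<^sup>2) \<le> fro x"
    unfolding fro_def using x by simp
  then have "d3 n * (\<Sum>i<d3 n. (cmod (x $$ (i, i)))\<^sup>2) \<le> d3 n * fro x"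
    by (intro mult_left_mono) auto
  then have "(cmod (mtrace x))\<^sup>2 \<le> d3 n * fro x"
    using norm_sum_mult_le[of "\<lambda>_. 1" "\<lambda>i. x $$ (i, i)" "{..<d3 n}"] x by (simp add: mtrace_def)
  also have "\<dots> \<le> d3 n * (d3 n * (mat_norm x)\<^sup>2)"
    by (intro mult_left_mono fro_le_mat_norm[OF x]) simp
  finally have "(cmod (mtrace x))\<^sup>2 \<le> (d3 n * mat_norm x)\<^sup>2"
    by (simp add: power_mult_distrib power2_eq_square[of "real (d3 n)"])
  then have "cmod (mtrace x) \<le> d3 n * mat_norm x"
    by (rule power2_le_imp_le[of "cmod (mtrace x)"]) simp
  then show "cmod (mtrace x / 3 ^ n) \<le> 1 * mat_norm x"
    using d by (simp add: norm_divide norm_power d3_def divide_le_eq mult.commute)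
  show "mtrace (c \<cdot>\<^sub>m x) / 3 ^ n = c * (mtrace x / 3 ^ n)" for c
    using x by (simp add: mtrace_def sum_distrib_left[symmetric])
  show "mtrace (x + y) / 3 ^ n = mtrace x / 3 ^ n + mtrace y / 3 ^ n" if "y \<in> M n" for y
    using x that by (simp add: mtrace_def sum.distrib add_divide_distrib)
qed

text \<open>The dimension factor is harmless: the bound is applied to slices of fixed size, onto
  which \<open>vcut\<close> contracts from any level.\<close>

lemma cmod_entry_le_mat_norm:
  assumes "x \<in> M n" "i < d3 n" "j < d3 n"
  shows "cmod (x $$ (i, j)) \<le> sqrt (d3 n) * mat_norm x"
proof (rule power2_le_imp_le)
  have "(cmod (x $$ (i, j)))\<^sup>2 \<le> fro x"
    using assms by (intro cmod_entry_le_fro) auto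
  also have "\<dots> \<le> d3 n * (mat_norm x)\<^sup>2"
    by (rule fro_le_mat_norm[OF assms(1)])
  finally show "(cmod (x $$ (i, j)))\<^sup>2 \<le> (sqrt (d3 n) * mat_norm x)\<^sup>2"
    by (simp add: power_mult_distrib)
qed simp

lemma compat_functional_slice:
  assumes ij: "i < d3 (Suc m)" "j < d3 (Suc m)"
  shows "compat_functional (Suc m) (sqrt (d3 (Suc m))) (\<lambda>n x. ((\<lambda>b. comp_at b 2) ^^ (n - Suc m)) x $$ (i, j))"
  unfolding compat_functional_def vcut_def[symmetric]
proof (intro allI ballI impI conjI)
  fix n x assume n: "Suc m \<le> n" and x: "x \<in> M n"
  define k where "k = n - Suc m"
  have x': "y \<in> M (Suc m + k) \<longleftrightarrow> y \<in> M n" for y using n by (simp add: k_def)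
  have k: "n - Suc m = k" "Suc n - Suc m = Suc k" using n by (auto simp: k_def)
  have c: "vcut k y \<in> M (Suc m)" if "y \<in> M n" for y by (rule cut_M) (simp only: x' that)
  show "vcut (Suc n - Suc m) (x \<otimes>\<^sub>m 1\<^sub>m 3) $$ (i, j) = vcut (n - Suc m) x $$ (i, j)"
    unfolding k cut_tensor_one[OF x] ..
  have "cmod (vcut k x $$ (i, j)) \<le> sqrt (d3 (Suc m)) * mat_norm (vcut k x)"
    by (rule cmod_entry_le_mat_norm[OF c[OF x] ij])
  also have "\<dots> \<le> sqrt (d3 (Suc m)) * mat_norm x"
    by (intro mult_left_mono mat_norm_cut_le[where n = "Suc m"]) (simp_all only: x' x real_sqrt_ge_zero of_nat_0_le_iff)
  finally show "cmod (vcut (n - Suc m) x $$ (i, j)) \<le> sqrt (d3 (Suc m)) * mat_norm x"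
    by (simp add: k)
  show "vcut (n - Suc m) (a \<cdot>\<^sub>m x) $$ (i, j) = a * vcut (n - Suc m) x $$ (i, j)" for a
    unfolding k using cut_smult[of x "Suc m" k a] c[OF x] x x' ij by simp
  show "vcut (n - Suc m) (x + y) $$ (i, j) = vcut (n - Suc m) x $$ (i, j) + vcut (n - Suc m) y $$ (i, j)" if y: "y \<in> M n" for y
    unfolding k using cut_add[of x "Suc m" k y] c[OF x] c[OF y] x y x' ij by simp
qed

lemma bounded_linear_scaleC: "bounded_linear (\<lambda>x :: 'u::cstar_algebra_1. c *\<^sub>C x)"
proof (rule bounded_linear_intro)
  show "c *\<^sub>C (r *\<^sub>R x) = r *\<^sub>R (c *\<^sub>C x)" for r and x :: 'u
    unfolding scaleC_of_real[symmetric] scaleC_scaleC by (simp only: mult.commute)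
  show "norm (c *\<^sub>C x) \<le> norm x * cmod c" for x :: 'u
    by (simp add: norm_scaleC)
qed (rule scaleC_add_right)

section \<open>Extension of functionals to the inductive limit\<close>

locale uhf3 =
  fixes \<iota> :: "nat \<Rightarrow> complex mat \<Rightarrow> 'u::cstar_algebra_1"
  assumes uhf: "is_uhf3 \<iota>"
begin

lemma iota_one: "\<iota> n (1\<^sub>m (d3 n)) = 1"
  using uhf unfolding is_uhf3_def d3_def by blast

lemma iota:
  assumes "x \<in> M n"
  shows iota_adj: "\<iota> n (mat_adjoint x) = adj (\<iota> n x)"
    and norm_iota: "norm (\<iota> n x) = mat_norm x"
    and iota_tensor_one: "\<iota> (Suc n) (x \<otimes>\<^sub>m 1\<^sub>m 3) = \<iota> n x"
    and iota_smult: "\<iota> n (c \<cdot>\<^sub>m x) = c *\<^sub>C \<iota> n x"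
    and iota_add: "y \<in> M n \<Longrightarrow> \<iota> n (x + y) = \<iota> n x + \<iota> n y"
    and iota_mult: "y \<in> M n \<Longrightarrow> \<iota> n (x * y) = \<iota> n x * \<iota> n y"
  using uhf assms unfolding is_uhf3_def d3_def by blast+

lemma iota_dense: "closure (\<Union>n. \<iota> n ` M n) = UNIV"
  using uhf unfolding is_uhf3_def d3_def by blast

lemma minus_mat_eq: "x \<in> M n \<Longrightarrow> y \<in> M n \<Longrightarrow> x - y = x + (- 1) \<cdot>\<^sub>m (y :: complex mat)"
  by (intro eq_matI) auto

lemma iota_diff: "x \<in> M n \<Longrightarrow> y \<in> M n \<Longrightarrow> \<iota> n (x - y) = \<iota> n x - \<iota> n y"
  by (simp add: minus_mat_eq[of x n y] iota_add iota_smult scaleC_minus_one)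

lemma mat_norm_diff_eq: "x \<in> M n \<Longrightarrow> y \<in> M n \<Longrightarrow> mat_norm (x - y) = norm (\<iota> n x - \<iota> n y)"
  using norm_iota[of "x - y" n] iota_diff[of x n y] minus_carrier_mat[of y] by simp

lemma iota_up: "x \<in> M n \<Longrightarrow> \<iota> (n + k) (up k x) = \<iota> n x"
proof (induction k)
  case (Suc k)
  then show ?case
    using iota_tensor_one[OF up_M[of x n k]] by (simp add: up_def)
qed (simp add: up_def)

text \<open>Density provides approximants only at some levels. A near minimiser of the distance to a
  is chosen at every level; lifting by \<open>up\<close> shows that the infima become small. The
  slack 1 / (n + 1) is there because an infimum may not be attained.\<close>

lemma iota_approx:
  obtains x where "\<And>n. x n \<in> M n" "(\<lambda>n. \<iota> n (x n)) \<longlonglongrightarrow> a"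
proof -
  define S where "S n = (\<lambda>y. norm (\<iota> n y - a)) ` M n" for n
  have bdd: "bdd_below (S n)" for n
    unfolding S_def by (rule bdd_belowI2[where m = 0]) simp
  have "0\<^sub>m (d3 n) (d3 n) \<in> M n" for n by simp
  then have ne: "S n \<noteq> {}" for n unfolding S_def by blast
  have "\<exists>y\<in>M n. norm (\<iota> n y - a) < Inf (S n) + inverse (real (Suc n))" for n
    using cInf_lessD[OF ne[of n], of "Inf (S n) + inverse (real (Suc n))"] by (auto simp: S_def)
  then obtain x where x: "\<And>n. x n \<in> M n" "\<And>n. norm (\<iota> n (x n) - a) < Inf (S n) + inverse (real (Suc n))"
    by metis
  have "(\<lambda>n. \<iota> n (x n)) \<longlonglongrightarrow> a"
  proof (rule LIMSEQ_I)
    fix e :: real assume e: "e > 0"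
    have "a \<in> closure (\<Union>n. \<iota> n ` M n)" using iota_dense by simp
    then obtain N y where y: "y \<in> M N" "dist (\<iota> N y) a < e / 2"
      using e unfolding closure_approachable by (metis (no_types, lifting) UN_E half_gt_zero imageE)
    obtain K where K: "inverse (real (Suc K)) < e / 2"
      using reals_Archimedean[of "e / 2"] e by auto
    show "\<exists>n0. \<forall>n\<ge>n0. norm (\<iota> n (x n) - a) < e"
    proof (intro exI allI impI)
      fix n assume n: "max N K \<le> n"
      have "up (n - N) y \<in> M n" using up_M[OF y(1), of "n - N"] n by simp
      moreover have "\<iota> n (up (n - N) y) = \<iota> N y" using iota_up[OF y(1), of "n - N"] n by simp
      ultimately have "norm (\<iota> N y - a) \<in> S n" unfolding S_def by (metis imageI)
      then have "Inf (S n) \<le> norm (\<iota> N y - a)" by (rule cInf_lower[OF _ bdd])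
      moreover have "inverse (real (Suc n)) \<le> inverse (real (Suc K))"
        using n by (intro le_imp_inverse_le) auto
      ultimately show "norm (\<iota> n (x n) - a) < e"
        using x(2)[of n] y(2)[unfolded dist_norm] K by linarith
    qed
  qed
  then show ?thesis using that x by blast
qed

lemma compat_functional_up:
  assumes "compat_functional n0 C F" "n \<ge> n0" "x \<in> M n"
  shows "F (n + k) (up k x) = F n x"
proof (induction k)
  case (Suc k)
  have "F (Suc (n + k)) (up k x \<otimes>\<^sub>m 1\<^sub>m 3) = F (n + k) (up k x)"
    using assms up_M[OF assms(3), of k] unfolding compat_functional_def by auto
  then show ?case using Suc by (simp add: up_def)
qed (simp add: up_def)

lemma compat_functional_diff:
  assumes F: "compat_functional n0 C F" and "n \<ge> n0" and x: "x \<in> M n" and y: "y \<in> M n"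
  shows "cmod (F n x - F n y) \<le> C * norm (\<iota> n x - \<iota> n y)"
proof -
  have "F n (x + (- 1) \<cdot>\<^sub>m y) = F n x + (- 1) * F n y"
    using assms unfolding compat_functional_def by (metis smult_carrier_mat)
  then have "F n (x - y) = F n x - F n y"
    by (simp add: minus_mat_eq[OF x y])
  moreover have "cmod (F n (x - y)) \<le> C * mat_norm (x - y)"
    using assms unfolding compat_functional_def by (metis minus_carrier_mat)
  ultimately show ?thesis
    by (simp add: mat_norm_diff_eq[OF x y])
qed

text \<open>To compare levels m < n, \<open>x m\<close> is lifted to level n, which changes neither
  its image in the limit nor the value of F. Hence the values are Cauchy with a limit depending on a
  alone, which justifies the definite description in \<open>extend_functional\<close>.\<close>

lemma extend_functional_tendsto:
  assumes F: "compat_functional n0 C F" and C: "C \<ge> 0"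
    and x: "\<And>n. x n \<in> M n" "(\<lambda>n. \<iota> n (x n)) \<longlonglongrightarrow> a"
  shows "(\<lambda>n. F n (x n)) \<longlonglongrightarrow> extend_functional \<iota> F a"
proof -
  have conv: "convergent (\<lambda>n. F n (x n))" if x: "\<And>n. x n \<in> M n" "(\<lambda>n. \<iota> n (x n)) \<longlonglongrightarrow> a" for x
  proof -
    have "Cauchy (\<lambda>n. \<iota> n (x n))"
      using x(2) by (intro convergent_Cauchy convergentI)
    have "Cauchy (\<lambda>n. F n (x n))"
    proof (rule CauchyI')
      fix e :: real assume e: "e > 0"
      \<comment> \<open>C may be 0, hence the divisor C + 1.\<close>
      then have "e / (C + 1) > 0" using C by simp
      then obtain N where N: "\<And>m n. m \<ge> N \<Longrightarrow> n \<ge> N \<Longrightarrow> norm (\<iota> m (x m) - \<iota> n (x n)) < e / (C + 1)"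
        using CauchyD[OF \<open>Cauchy (\<lambda>n. \<iota> n (x n))\<close>] by blast
      show "\<exists>N. \<forall>m\<ge>N. \<forall>n>m. dist (F m (x m)) (F n (x n)) < e"
      proof (intro exI allI impI)
        fix m n assume m: "max N n0 \<le> m" and n: "m < n"
        have up: "up (n - m) (x m) \<in> M n" "\<iota> n (up (n - m) (x m)) = \<iota> m (x m)" "F n (up (n - m) (x m)) = F m (x m)"
          using up_M[OF x(1)[of m], of "n - m"] iota_up[OF x(1)[of m], of "n - m"]
            compat_functional_up[OF F _ x(1)[of m], of "n - m"] m n by auto
        have "dist (F m (x m)) (F n (x n)) \<le> C * norm (\<iota> m (x m) - \<iota> n (x n))"
          using compat_functional_diff[OF F _ up(1) x(1)[of n]] up m n by (simp add: dist_norm)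
        also have "\<dots> \<le> C * (e / (C + 1))"
          using N[of m n] m n C by (intro mult_left_mono) auto
        also have "\<dots> < e"
          using e C by (simp add: field_simps)
        finally show "dist (F m (x m)) (F n (x n)) < e" .
      qed
    qed
    then show ?thesis by (rule Cauchy_convergent)
  qed
  obtain t where t: "(\<lambda>n. F n (x n)) \<longlonglongrightarrow> t"
    using conv[OF x] by (auto simp: convergent_def)
  have all: "(\<lambda>n. F n (y n)) \<longlonglongrightarrow> t" if y: "\<And>n. y n \<in> M n" "(\<lambda>n. \<iota> n (y n)) \<longlonglongrightarrow> a" for y
  proof -
    have "(\<lambda>n. \<iota> n (y n) - \<iota> n (x n)) \<longlonglongrightarrow> 0"
      using tendsto_diff[OF y(2) x(2)] by simp
    moreover have "norm (F n (y n) - F n (x n)) \<le> norm (\<iota> n (y n) - \<iota> n (x n)) * C" if "n \<ge> n0" for n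
      using compat_functional_diff[OF F that y(1) x(1)] by (simp only: mult.commute)
    then have "\<forall>\<^sub>F n in sequentially. norm (F n (y n) - F n (x n)) \<le> norm (\<iota> n (y n) - \<iota> n (x n)) * C"
      by (rule eventually_sequentiallyI)
    ultimately have "(\<lambda>n. F n (y n) - F n (x n)) \<longlonglongrightarrow> 0"
      by (rule tendsto_0_le)
    from tendsto_add[OF this t] show ?thesis by simp
  qed
  have "extend_functional \<iota> F a = t"
    unfolding extend_functional_def d3_def[symmetric]
  proof (rule the_equality)
    show "\<forall>x. (\<forall>n. x n \<in> M n) \<longrightarrow> (\<lambda>n. \<iota> n (x n)) \<longlonglongrightarrow> a \<longrightarrow> (\<lambda>n. F n (x n)) \<longlonglongrightarrow> t"
      using all by blast
    fix t' assume "\<forall>x. (\<forall>n. x n \<in> M n) \<longrightarrow> (\<lambda>n. \<iota> n (x n)) \<longlonglongrightarrow> a \<longrightarrow> (\<lambda>n. F n (x n)) \<longlonglongrightarrow> t'"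
    then show "t' = t"
      using x t LIMSEQ_unique by blast
  qed
  then show ?thesis using t by simp
qed

lemma extend_functional_add:
  assumes F: "compat_functional n0 C F" "C \<ge> 0"
  shows "extend_functional \<iota> F (a + b) = extend_functional \<iota> F a + extend_functional \<iota> F b"
proof -
  obtain x where x: "\<And>n. x n \<in> M n" "(\<lambda>n. \<iota> n (x n)) \<longlonglongrightarrow> a" using iota_approx by metis
  obtain y where y: "\<And>n. y n \<in> M n" "(\<lambda>n. \<iota> n (y n)) \<longlonglongrightarrow> b" using iota_approx by metis
  have xy: "x n + y n \<in> M n" for n using x y by auto
  have "(\<lambda>n. \<iota> n (x n + y n)) \<longlonglongrightarrow> a + b"
    using tendsto_add[OF x(2) y(2)] by (simp add: iota_add x y)
  then have "(\<lambda>n. F n (x n + y n)) \<longlonglongrightarrow> extend_functional \<iota> F (a + b)"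
    by (intro extend_functional_tendsto[OF F xy])
  moreover have "\<forall>\<^sub>F n in sequentially. F n (x n + y n) = F n (x n) + F n (y n)"
    using F(1) x y unfolding compat_functional_def by (auto intro!: eventually_sequentiallyI[of n0])
  ultimately have "(\<lambda>n. F n (x n) + F n (y n)) \<longlonglongrightarrow> extend_functional \<iota> F (a + b)"
    by (rule Lim_transform_eventually)
  then show ?thesis
    using tendsto_add[OF extend_functional_tendsto[OF F x] extend_functional_tendsto[OF F y]] LIMSEQ_unique by blast
qed

lemma extend_functional_scaleC:
  assumes F: "compat_functional n0 C F" "C \<ge> 0"
  shows "extend_functional \<iota> F (c *\<^sub>C a) = c * extend_functional \<iota> F a"
proof -
  obtain x where x: "\<And>n. x n \<in> M n" "(\<lambda>n. \<iota> n (x n)) \<longlonglongrightarrow> a" using iota_approx by metis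
  have cx: "c \<cdot>\<^sub>m x n \<in> M n" for n using x by auto
  have "(\<lambda>n. c *\<^sub>C \<iota> n (x n)) \<longlonglongrightarrow> c *\<^sub>C a"
    by (rule bounded_linear.tendsto[OF bounded_linear_scaleC x(2)])
  then have "(\<lambda>n. F n (c \<cdot>\<^sub>m x n)) \<longlonglongrightarrow> extend_functional \<iota> F (c *\<^sub>C a)"
    by (intro extend_functional_tendsto[OF F cx]) (simp add: iota_smult x)
  moreover have "\<forall>\<^sub>F n in sequentially. F n (c \<cdot>\<^sub>m x n) = c * F n (x n)"
    using F(1) x unfolding compat_functional_def by (auto intro!: eventually_sequentiallyI[of n0])
  ultimately have "(\<lambda>n. c * F n (x n)) \<longlonglongrightarrow> extend_functional \<iota> F (c *\<^sub>C a)"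
    by (rule Lim_transform_eventually)
  then show ?thesis
    using tendsto_mult_left[OF extend_functional_tendsto[OF F x], of c] LIMSEQ_unique by blast
qed

lemma norm_extend_functional_le:
  assumes F: "compat_functional n0 C F" "C \<ge> 0"
  shows "cmod (extend_functional \<iota> F a) \<le> C * norm a"
proof -
  obtain x where x: "\<And>n. x n \<in> M n" "(\<lambda>n. \<iota> n (x n)) \<longlonglongrightarrow> a" using iota_approx by metis
  have "(\<lambda>n. cmod (F n (x n))) \<longlonglongrightarrow> cmod (extend_functional \<iota> F a)"
    by (intro tendsto_norm extend_functional_tendsto[OF F x])
  moreover have "(\<lambda>n. C * norm (\<iota> n (x n))) \<longlonglongrightarrow> C * norm a"
    by (intro tendsto_mult_left tendsto_norm x)
  moreover have "\<forall>n\<ge>n0. cmod (F n (x n)) \<le> C * norm (\<iota> n (x n))"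
    using F(1) x unfolding compat_functional_def by (simp add: norm_iota)
  ultimately show ?thesis
    by (intro LIMSEQ_le) blast+
qed

lemma extend_functional_iota:
  assumes F: "compat_functional n0 C F" "C \<ge> 0" and "n \<ge> n0" and x: "x \<in> M n"
  shows "extend_functional \<iota> F (\<iota> n x) = F n x"
proof -
  \<comment> \<open>The levels below n are filled with zero matrices; convergence depends on the
    tail only.\<close>
  define y where "y k = (if k < n then 0\<^sub>m (d3 k) (d3 k) else up (k - n) x)" for k
  have y: "y k \<in> M k" for k
    using up_M[OF x, of "k - n"] by (auto simp: y_def)
  have "\<iota> k (y k) = \<iota> n x" "F k (y k) = F n x" if "k \<ge> n" for k
    using iota_up[OF x, of "k - n"] compat_functional_up[OF F(1) assms(3) x, of "k - n"] that by (auto simp: y_def)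
  then have ev: "\<forall>\<^sub>F k in sequentially. \<iota> k (y k) = \<iota> n x" "\<forall>\<^sub>F k in sequentially. F k (y k) = F n x"
    by (auto intro!: eventually_sequentiallyI[of n])
  have "(\<lambda>k. F k (y k)) \<longlonglongrightarrow> extend_functional \<iota> F (\<iota> n x)"
    by (rule extend_functional_tendsto[OF F y tendsto_eventually[OF ev(1)]])
  then show ?thesis
    using tendsto_eventually[OF ev(2)] LIMSEQ_unique by blast
qed

end

lemma tendsto_zero_bound:
  assumes "f \<longlonglongrightarrow> 0" "\<And>n :: nat. norm (g n) \<le> norm (f n) * K"
  shows "g \<longlonglongrightarrow> 0"
  by (rule tendsto_0_le[OF assms(1) always_eventually]) (use assms(2) in blast)

section \<open>Slice maps on the limit algebra\<close>

context uhf3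
begin

abbreviation sl :: "nat \<Rightarrow> 'u \<Rightarrow> complex mat" where
  "sl m a \<equiv> slice \<iota> m a"

abbreviation tr :: "'u \<Rightarrow> complex" where
  "tr a \<equiv> uhf_trace \<iota> a"

lemma sl_M [simp]: "sl m a \<in> M (Suc m)"
  by (simp add: slice_def d3_def)

lemma dim_sl [simp]: "dim_row (sl m a) = d3 (Suc m)" "dim_col (sl m a) = d3 (Suc m)"
  using carrier_matD[OF sl_M] by auto

lemma index_sl:
  assumes "i < d3 (Suc m)" "j < d3 (Suc m)"
  shows "sl m a $$ (i, j) = extend_functional \<iota> (\<lambda>n x. ((\<lambda>b. comp_at b 2) ^^ (n - Suc m)) x $$ (i, j)) a"
  using assms unfolding slice_def d3_def[symmetric] by simp

lemma sl_tendsto_approx: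
  assumes "\<And>n. x n \<in> M n" "(\<lambda>n. \<iota> n (x n)) \<longlonglongrightarrow> a" "i < d3 (Suc m)" "j < d3 (Suc m)"
  shows "(\<lambda>n. vcut (n - Suc m) (x n) $$ (i, j)) \<longlonglongrightarrow> sl m a $$ (i, j)"
  unfolding index_sl[OF assms(3,4)] vcut_def
  by (rule extend_functional_tendsto[OF compat_functional_slice[OF assms(3,4)] _ assms(1,2)]) simp

lemma sl_iota:
  assumes "x \<in> M (Suc m + k)"
  shows "sl m (\<iota> (Suc m + k) x) = vcut k x"
proof (rule eq_matI)
  have c: "vcut k x \<in> M (Suc m)" by (rule cut_M[OF assms])
  fix i j assume "i < dim_row (vcut k x)" "j < dim_col (vcut k x)"
  then have ij: "i < d3 (Suc m)" "j < d3 (Suc m)" using c by auto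
  show "sl m (\<iota> (Suc m + k) x) $$ (i, j) = vcut k x $$ (i, j)"
    unfolding index_sl[OF ij]
    using extend_functional_iota[OF compat_functional_slice[OF ij] _ _ assms] by (simp add: vcut_def)
qed (use cut_M[OF assms] in auto)

lemma sl_iota_0: "x \<in> M (Suc m) \<Longrightarrow> sl m (\<iota> (Suc m) x) = x"
  using sl_iota[of x m 0] by simp

lemma sl_add: "sl m (a + b) = sl m a + sl m b"
  by (rule eq_matI) (auto simp: index_sl extend_functional_add[OF compat_functional_slice])

lemma sl_scaleC: "sl m (c *\<^sub>C a) = c \<cdot>\<^sub>m sl m a"
  by (rule eq_matI) (auto simp: index_sl extend_functional_scaleC[OF compat_functional_slice])

lemma sl_diff: "sl m (a - b) = sl m a - sl m b"
proof -
  have "sl m (a - b) = sl m (a + (- 1) *\<^sub>C b)" by (simp add: scaleC_minus_one)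
  also have "\<dots> = sl m a + (- 1) \<cdot>\<^sub>m sl m b" by (simp only: sl_add sl_scaleC)
  also have "\<dots> = sl m a - sl m b" by (rule minus_mat_eq[OF sl_M sl_M, symmetric])
  finally show ?thesis .
qed

lemma sl_one: "sl m 1 = 1\<^sub>m (d3 (Suc m))"
  using sl_iota_0[of "1\<^sub>m (d3 (Suc m))" m] by (simp add: iota_one)

text \<open>At a fixed level entrywise convergence gives norm convergence, through the
  Hilbert-Schmidt bound.\<close>

lemma iota_tendsto:
  assumes A: "\<And>k. A k \<in> M n" "B \<in> M n"
    and lim: "\<And>i j. i < d3 n \<Longrightarrow> j < d3 n \<Longrightarrow> (\<lambda>k. A k $$ (i, j)) \<longlonglongrightarrow> B $$ (i, j)"
  shows "(\<lambda>k. \<iota> n (A k)) \<longlonglongrightarrow> \<iota> n B"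
proof -
  have "(\<lambda>k. sqrt (\<Sum>i<d3 n. \<Sum>j<d3 n. (cmod (A k $$ (i, j) - B $$ (i, j)))\<^sup>2)) \<longlonglongrightarrow>
      sqrt (\<Sum>i<d3 n. \<Sum>j<d3 n. (cmod (B $$ (i, j) - B $$ (i, j)))\<^sup>2)"
    by (intro tendsto_real_sqrt tendsto_sum tendsto_power tendsto_norm tendsto_diff tendsto_const lim) auto
  then have "(\<lambda>k. sqrt (fro (A k - B))) \<longlonglongrightarrow> 0"
    by (simp add: fro_diff_entries[OF A])
  moreover have "norm (\<iota> n (A k) - \<iota> n B) \<le> norm (sqrt (fro (A k - B))) * 1" for k
    unfolding mat_norm_diff_eq[OF A, symmetric] using mat_norm_le_fro[of "A k - B"]
    by (simp add: real_le_rsqrt)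
  ultimately have "(\<lambda>k. \<iota> n (A k) - \<iota> n B) \<longlonglongrightarrow> 0"
    by (rule tendsto_zero_bound)
  then show ?thesis by (rule LIM_zero_cancel)
qed

lemma iota_cut_tendsto:
  assumes x: "\<And>n. x n \<in> M n" "(\<lambda>n. \<iota> n (x n)) \<longlonglongrightarrow> a"
  shows "(\<lambda>k. \<iota> (Suc m) (vcut k (x (Suc m + k)))) \<longlonglongrightarrow> \<iota> (Suc m) (sl m a)"
proof (rule iota_tendsto)
  fix i j assume ij: "i < d3 (Suc m)" "j < d3 (Suc m)"
  show "(\<lambda>k. vcut k (x (Suc m + k)) $$ (i, j)) \<longlonglongrightarrow> sl m a $$ (i, j)"
    using LIMSEQ_ignore_initial_segment[OF sl_tendsto_approx[OF x ij], of "Suc m"] by (simp add: add.commute)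
qed (simp_all add: cut_M x)

lemma norm_sl_le: "mat_norm (sl m a) \<le> norm a"
proof -
  obtain x where x: "\<And>n. x n \<in> M n" "(\<lambda>n. \<iota> n (x n)) \<longlonglongrightarrow> a" using iota_approx by metis
  have "norm (\<iota> (Suc m) (vcut k (x (Suc m + k)))) \<le> norm (\<iota> (Suc m + k) (x (Suc m + k)))" for k
    using norm_iota[OF cut_M[OF x(1)]] norm_iota[OF x(1)] mat_norm_cut_le[OF x(1)] by metis
  moreover have "(\<lambda>k. norm (\<iota> (Suc m + k) (x (Suc m + k)))) \<longlonglongrightarrow> norm a"
    using LIMSEQ_ignore_initial_segment[OF tendsto_norm[OF x(2)], of "Suc m"] by (simp add: add.commute)
  ultimately have "norm (\<iota> (Suc m) (sl m a)) \<le> norm a"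
    using LIMSEQ_le[OF tendsto_norm[OF iota_cut_tendsto[OF x]]] by blast
  then show ?thesis by (simp add: norm_iota)
qed

lemma sl_adj: "sl m (adj a) = mat_adjoint (sl m a)"
proof (rule eq_matI)
  obtain x where x: "\<And>n. x n \<in> M n" "(\<lambda>n. \<iota> n (x n)) \<longlonglongrightarrow> a" using iota_approx by metis
  have "(\<lambda>n. \<iota> n (mat_adjoint (x n))) \<longlonglongrightarrow> adj a"
    using bounded_linear.tendsto[OF bounded_linear_adj x(2)] by (simp add: iota_adj[OF x(1)])
  then have *: "(\<lambda>k. \<iota> (Suc m) (vcut k (mat_adjoint (x (Suc m + k))))) \<longlonglongrightarrow> \<iota> (Suc m) (sl m (adj a))"
    by (intro iota_cut_tendsto) (simp_all add: x)
  have **: "\<iota> (Suc m) (vcut k (mat_adjoint (x (Suc m + k)))) = adj (\<iota> (Suc m) (vcut k (x (Suc m + k))))" for k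
    using cut_adjoint[OF x(1)] iota_adj[OF cut_M[OF x(1)]] by metis
  have "\<iota> (Suc m) (sl m (adj a)) = adj (\<iota> (Suc m) (sl m a))"
    by (rule LIMSEQ_unique[OF *[unfolded **] bounded_linear.tendsto[OF bounded_linear_adj iota_cut_tendsto[OF x]]])
  then have "\<iota> (Suc m) (sl m (adj a)) = \<iota> (Suc m) (mat_adjoint (sl m a))"
    by (simp add: iota_adj)
  then have eq: "sl m (adj a) = mat_adjoint (sl m a)"
    by (metis sl_iota_0 sl_M mat_adjoint_carrier)
  fix i j
  show "sl m (adj a) $$ (i, j) = mat_adjoint (sl m a) $$ (i, j)" using eq by simp
qed simp_all

lemma sl_tendsto:
  assumes "a \<longlonglongrightarrow> b" "i < d3 (Suc m)" "j < d3 (Suc m)"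
  shows "(\<lambda>k. sl m (a k) $$ (i, j)) \<longlonglongrightarrow> sl m b $$ (i, j)"
proof -
  have "norm (sl m (a k) $$ (i, j) - sl m b $$ (i, j)) \<le> norm (a k - b) * sqrt (d3 (Suc m))" for k
  proof -
    have "sl m (a k) $$ (i, j) - sl m b $$ (i, j) = sl m (a k - b) $$ (i, j)"
      using assms by (simp add: sl_diff)
    also have "cmod \<dots> \<le> sqrt (d3 (Suc m)) * mat_norm (sl m (a k - b))"
      by (rule cmod_entry_le_mat_norm[OF sl_M assms(2,3)])
    also have "\<dots> \<le> sqrt (d3 (Suc m)) * norm (a k - b)"
      by (intro mult_left_mono norm_sl_le) simp
    finally show ?thesis by (simp add: mult.commute)
  qed
  then have "(\<lambda>k. sl m (a k) $$ (i, j) - sl m b $$ (i, j)) \<longlonglongrightarrow> 0"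
    by (rule tendsto_zero_bound[OF LIM_zero[OF assms(1)]])
  then show ?thesis by (rule LIM_zero_cancel)
qed

lemma sl_eq_limit:
  assumes "f \<longlonglongrightarrow> a" "\<And>k. sl m (f k) = B"
  shows "sl m a = B"
proof (rule eq_matI)
  have B: "B \<in> M (Suc m)" using assms(2)[of 0] sl_M by metis
  fix i j assume "i < dim_row B" "j < dim_col B"
  then have "i < d3 (Suc m)" "j < d3 (Suc m)" using B by auto
  from sl_tendsto[OF assms(1) this] show "sl m a $$ (i, j) = B $$ (i, j)"
    unfolding assms(2) by (simp add: LIMSEQ_const_iff)
qed (use assms(2)[of 0] dim_sl in metis)+

text \<open>rho_m is a contraction that fixes the elements of level m + 1, so the slice is at most
  twice as far from a as any approximant of that level.\<close>

lemma iota_sl_tendsto: "(\<lambda>m. \<iota> (Suc m) (sl m a)) \<longlonglongrightarrow> a"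
proof -
  obtain x where x: "\<And>n. x n \<in> M n" "(\<lambda>n. \<iota> n (x n)) \<longlonglongrightarrow> a" using iota_approx by metis
  have "norm (\<iota> (Suc m) (sl m a) - a) \<le> norm (\<iota> (Suc m) (x (Suc m)) - a) * 2" for m
  proof -
    have "\<iota> (Suc m) (sl m a) - \<iota> (Suc m) (x (Suc m)) = \<iota> (Suc m) (sl m (a - \<iota> (Suc m) (x (Suc m))))"
      by (simp add: sl_diff sl_iota_0 x iota_diff)
    then have "norm (\<iota> (Suc m) (sl m a) - \<iota> (Suc m) (x (Suc m))) \<le> norm (a - \<iota> (Suc m) (x (Suc m)))"
      by (simp add: norm_iota norm_sl_le)
    then show ?thesis
      using norm_triangle_ineq[of "\<iota> (Suc m) (sl m a) - \<iota> (Suc m) (x (Suc m))" "\<iota> (Suc m) (x (Suc m)) - a"]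
      by (simp add: norm_minus_commute)
  qed
  moreover have "(\<lambda>m. \<iota> (Suc m) (x (Suc m)) - a) \<longlonglongrightarrow> 0"
    using LIM_zero[OF LIMSEQ_Suc[OF x(2)]] .
  ultimately have "(\<lambda>m. \<iota> (Suc m) (sl m a) - a) \<longlonglongrightarrow> 0"
    by (rule tendsto_zero_bound[rotated])
  then show ?thesis by (rule LIM_zero_cancel)
qed

lemma comp_sl: "comp_at (sl (Suc m) a) 2 = sl m a"
proof (rule eq_matI)
  obtain x where x: "\<And>n. x n \<in> M n" "(\<lambda>n. \<iota> n (x n)) \<longlonglongrightarrow> a" using iota_approx by metis
  fix i j assume "i < dim_row (sl m a)" "j < dim_col (sl m a)"
  then have ij: "i < d3 (Suc m)" "j < d3 (Suc m)" by auto
  let ?p = "(3 * i + 1, 3 * j + 1)"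
  have c: "sl (Suc m) a \<in> carrier_mat (3 * d3 (Suc m)) (3 * d3 (Suc m))"
    unfolding d3_Suc[symmetric] by (rule sl_M)
  have v: "vcut k (x (Suc (Suc m) + k)) \<in> carrier_mat (3 * d3 (Suc m)) (3 * d3 (Suc m))" for k
    unfolding d3_Suc[symmetric] by (rule cut_M[OF x(1)])
  have e: "comp_at (sl (Suc m) a) 2 $$ (i, j) = sl (Suc m) a $$ ?p"
    "comp_at (vcut k (x (Suc (Suc m) + k))) 2 $$ (i, j) = vcut k (x (Suc (Suc m) + k)) $$ ?p" for k
    using index_comp_at[OF c ij, of 2] index_comp_at[OF v ij, of k 2] by simp_all
  have "(\<lambda>n. vcut (n - Suc (Suc m)) (x n) $$ ?p) \<longlonglongrightarrow> sl (Suc m) a $$ ?p"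
    by (rule sl_tendsto_approx[OF x]) (use ij in \<open>auto simp: d3_Suc\<close>)
  from LIMSEQ_ignore_initial_segment[OF this, of "Suc (Suc m)"]
  have "(\<lambda>k. comp_at (vcut k (x (Suc (Suc m) + k))) 2 $$ (i, j)) \<longlonglongrightarrow> comp_at (sl (Suc m) a) 2 $$ (i, j)"
    unfolding e by (simp add: add.commute)
  moreover have "(\<lambda>k. vcut (Suc k) (x (Suc (Suc m) + k)) $$ (i, j)) \<longlonglongrightarrow> sl m a $$ (i, j)"
    using LIMSEQ_ignore_initial_segment[OF sl_tendsto_approx[OF x ij], of "Suc (Suc m)"] by (simp add: add.commute Suc_diff_le)
  ultimately show "comp_at (sl (Suc m) a) 2 $$ (i, j) = sl m a $$ (i, j)"
    using LIMSEQ_unique by (simp add: cut_Suc)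
qed (auto simp: d3_Suc)

lemma cut_sl: "vcut k (sl (m + k) a) = sl m a"
  by (induction k) (simp_all add: cut_Suc_right comp_sl)

text \<open>Replaces approximating sequences by a closed condition on slices: slices of A_n with n
  \<ge> m lie in A_m by \<open>good_cut\<close>, \<open>good_limit\<close> passes to the limit, and
  conversely the slices themselves approximate a.\<close>

lemma A_inf_iff: "a \<in> A_inf \<iota> \<longleftrightarrow> (\<forall>m. good m (sl m a))"
proof
  assume "a \<in> A_inf \<iota>"
  then obtain x where x: "\<And>n. good n (x n)" "(\<lambda>n. \<iota> (Suc n) (x n)) \<longlonglongrightarrow> a"
    unfolding A_inf_def by (auto simp: A_fin_iff_good)
  show "\<forall>m. good m (sl m a)"
  proof
    fix m
    show "good m (sl m a)"
    proof (rule good_limit[where B = "\<lambda>k. sl m (\<iota> (Suc (k + m)) (x (k + m)))"])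
      fix k
      have "x (k + m) \<in> M (Suc m + k)" using good_carrier[OF x(1), of "k + m"] by (simp add: add.commute)
      then have "sl m (\<iota> (Suc (k + m)) (x (k + m))) = vcut k (x (k + m))"
        using sl_iota[of "x (k + m)" m k] by (simp add: add.commute)
      then show "good m (sl m (\<iota> (Suc (k + m)) (x (k + m))))"
        using good_cut[of m k] x(1)[of "k + m"] by (simp add: add.commute)
    next
      fix i j assume "i < d3 (Suc m)" "j < d3 (Suc m)"
      then show "(\<lambda>k. sl m (\<iota> (Suc (k + m)) (x (k + m))) $$ (i, j)) \<longlonglongrightarrow> sl m a $$ (i, j)"
        using sl_tendsto LIMSEQ_ignore_initial_segment[OF x(2), of m] by blast
    qed simp
  qed
next
  assume "\<forall>m. good m (sl m a)"
  then show "a \<in> A_inf \<iota>"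
    unfolding A_inf_def using iota_sl_tendsto[of a] by (auto simp: A_fin_iff_good)
qed

lemma A_inf_good: "a \<in> A_inf \<iota> \<Longrightarrow> good m (sl m a)"
  by (simp add: A_inf_iff)

text \<open>Products of slices at level m + k converge to a * b, and by \<open>cut_good_mult\<close>
  their rho_m equals the right side for every k. Membership in \<open>A_inf\<close> is what makes
  these slices \<open>good\<close>.\<close>

lemma sl_mult:
  assumes a: "a \<in> A_inf \<iota>" and b: "b \<in> A_inf \<iota>"
  shows "sl m (a * b) = sl m a * sl m b"
proof (rule sl_eq_limit)
  show "sl m (\<iota> (Suc (m + k)) (sl (m + k) a) * \<iota> (Suc (m + k)) (sl (m + k) b)) = sl m a * sl m b" for k
  proof -
    have "sl (m + k) a * sl (m + k) b \<in> M (Suc (m + k))"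
      by (rule mult_carrier_mat[OF sl_M sl_M])
    then have "sl m (\<iota> (Suc (m + k)) (sl (m + k) a * sl (m + k) b)) = vcut k (sl (m + k) a * sl (m + k) b)"
      using sl_iota[of _ m k] by simp
    also have "\<dots> = sl m a * sl m b"
      using cut_good_mult[OF A_inf_good[OF a] A_inf_good[OF b]] by (simp add: cut_sl)
    finally show ?thesis by (simp add: iota_mult)
  qed
  show "(\<lambda>k. \<iota> (Suc (m + k)) (sl (m + k) a) * \<iota> (Suc (m + k)) (sl (m + k) b)) \<longlonglongrightarrow> a * b"
    using LIMSEQ_ignore_initial_segment[OF tendsto_mult[OF iota_sl_tendsto[of a] iota_sl_tendsto[of b]], of m]
    by (simp add: add.commute)
qed

lemma cstar_sub_A_inf: "cstar_sub (A_inf \<iota>)"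
  unfolding cstar_sub_def
proof (intro conjI ballI allI)
  show "closed (A_inf \<iota>)"
  proof (rule closed_sequential_limits[THEN iffD2], intro allI impI)
    fix x l assume "(\<forall>n. x n \<in> A_inf \<iota>) \<and> x \<longlonglongrightarrow> l"
    then have x: "\<And>n. x n \<in> A_inf \<iota>" "x \<longlonglongrightarrow> l" by auto
    have "good m (sl m l)" for m
      by (rule good_limit[OF A_inf_good[OF x(1)] sl_M sl_tendsto[OF x(2)]])
    then show "l \<in> A_inf \<iota>"
      by (simp add: A_inf_iff)
  qed
  show "1 \<in> A_inf \<iota>"
    by (simp add: A_inf_iff sl_one good_one)
  fix x y assume xy: "x \<in> A_inf \<iota>" "y \<in> A_inf \<iota>"
  show "x + y \<in> A_inf \<iota>"
    unfolding A_inf_iff sl_add by (intro allI good_add A_inf_good xy)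
  show "x * y \<in> A_inf \<iota>"
    unfolding A_inf_iff sl_mult[OF xy] by (intro allI good_mult A_inf_good xy)
next
  fix x c assume x: "x \<in> A_inf \<iota>"
  show "c *\<^sub>C x \<in> A_inf \<iota>"
    unfolding A_inf_iff sl_scaleC by (intro allI good_smult A_inf_good x)
  show "adj x \<in> A_inf \<iota>"
    unfolding A_inf_iff sl_adj by (intro allI good_adjoint A_inf_good x)
qed

lemmas A_infD = cstar_subD[OF cstar_sub_A_inf]

text \<open>The embedded \<open>b (m + k)\<close> has slice \<open>b m\<close> for every k, so the
  limit has the same slice.\<close>

lemma compatible_limit:
  assumes b: "\<And>m. good m (b m)" "\<And>m. comp_at (b (Suc m)) 2 = b m" and lim: "(\<lambda>m. \<iota> (Suc m) (b m)) \<longlonglongrightarrow> a"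
  shows "sl m a = b m" "a \<in> A_inf \<iota>"
proof -
  have cut: "vcut k (b (m + k)) = b m" for k m
    by (induction k) (simp_all add: cut_Suc_right b)
  show eq: "sl m a = b m" for m
  proof (rule sl_eq_limit)
    have "b (m + k) \<in> M (Suc m + k)" for k using good_carrier[OF b(1), of "m + k"] by simp
    from sl_iota[OF this] show "sl m (\<iota> (Suc (m + k)) (b (m + k))) = b m" for k
      using cut by simp
    show "(\<lambda>k. \<iota> (Suc (m + k)) (b (m + k))) \<longlonglongrightarrow> a"
      using LIMSEQ_ignore_initial_segment[OF lim, of m] by (simp add: add.commute)
  qed
  then show "a \<in> A_inf \<iota>"
    by (simp add: A_inf_iff b)
qed

text \<open>Proved on matrices, where the operator norm comes from vectors, and carried over by the
  slices of d. It is the hypothesis \<open>sq\<close> of \<open>cstar_pos_neg_parts\<close>.\<close>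

lemma norm_one_minus_square_le:
  fixes d :: 'u
  assumes "adj d = d" "norm d \<le> 1"
  shows "norm (1 - d * d) \<le> 1"
proof (rule LIMSEQ_le_const2)
  show "(\<lambda>m. norm (1 - \<iota> (Suc m) (sl m d) * \<iota> (Suc m) (sl m d))) \<longlonglongrightarrow> norm (1 - d * d)"
    by (intro tendsto_norm tendsto_diff tendsto_const tendsto_mult iota_sl_tendsto)
  have "norm (1 - \<iota> (Suc m) (sl m d) * \<iota> (Suc m) (sl m d)) \<le> 1" for m
  proof -
    have c: "sl m d * sl m d \<in> M (Suc m)" by (rule mult_carrier_mat[OF sl_M sl_M])
    have "mat_adjoint (sl m d) = sl m d"
      using sl_adj[of m d] assms by simp
    then have "mat_norm (1\<^sub>m (d3 (Suc m)) - sl m d * sl m d) \<le> 1"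
      using norm_sl_le[of m d] assms(2) by (intro mat_norm_one_minus_square_le) auto
    then show ?thesis
      using mat_norm_diff_eq[OF one_carrier_mat c] by (simp add: iota_one iota_mult)
  qed
  then show "\<exists>N. \<forall>m\<ge>N. norm (1 - \<iota> (Suc m) (sl m d) * \<iota> (Suc m) (sl m d)) \<le> 1" by blast
qed

section \<open>The trace\<close>

lemma tr_add: "tr (a + b) = tr a + tr b"
  unfolding uhf_trace_def by (rule extend_functional_add[OF compat_functional_trace]) simp

lemma tr_scaleC: "tr (c *\<^sub>C a) = c * tr a"
  unfolding uhf_trace_def by (rule extend_functional_scaleC[OF compat_functional_trace]) simp

lemma cmod_tr_le: "cmod (tr a) \<le> norm a"
  using norm_extend_functional_le[OF compat_functional_trace, of a] by (simp add: uhf_trace_def)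

lemma tr_iota: "x \<in> M n \<Longrightarrow> tr (\<iota> n x) = mtrace x / d3 n"
  using extend_functional_iota[OF compat_functional_trace, of n x] by (simp add: uhf_trace_def d3_def)

lemma bounded_linear_tr: "bounded_linear tr"
  by (rule bounded_linear_intro[where K = 1])
    (simp_all add: tr_add cmod_tr_le scaleC_of_real[symmetric] tr_scaleC scaleR_conv_of_real)

lemmas tr_tendsto = bounded_linear.tendsto[OF bounded_linear_tr]

lemma tr_commute: "tr (a * b) = tr (b * a)"
proof -
  have eq: "tr (\<iota> (Suc m) (sl m a) * \<iota> (Suc m) (sl m b)) = tr (\<iota> (Suc m) (sl m b) * \<iota> (Suc m) (sl m a))" for m
    unfolding iota_mult[OF sl_M sl_M, symmetric]
    by (simp add: tr_iota mtrace_commute[OF sl_M sl_M] mult_carrier_mat[OF sl_M sl_M])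
  have "(\<lambda>m. tr (\<iota> (Suc m) (sl m a) * \<iota> (Suc m) (sl m b))) \<longlonglongrightarrow> tr (a * b)"
    "(\<lambda>m. tr (\<iota> (Suc m) (sl m b) * \<iota> (Suc m) (sl m a))) \<longlonglongrightarrow> tr (b * a)"
    by (intro tr_tendsto tendsto_mult iota_sl_tendsto)+
  then show ?thesis
    unfolding eq by (rule LIMSEQ_unique)
qed

lemma tr_adj_mult_iota: "x \<in> M n \<Longrightarrow> y \<in> M n \<Longrightarrow> tr (adj (\<iota> n x) * \<iota> n y) = hs x y / d3 n"
  by (simp add: iota_adj[symmetric] iota_mult[symmetric] tr_iota mtrace_adjoint_mult[of x "d3 n" "d3 n"]
      mult_carrier_mat[of _ "d3 n" "d3 n"])

lemma tr_adj_mult_tendsto: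
  "(\<lambda>m. hs (sl m a) (sl m b) / d3 (Suc m)) \<longlonglongrightarrow> tr (adj a * b)"
proof -
  have "(\<lambda>m. tr (adj (\<iota> (Suc m) (sl m a)) * \<iota> (Suc m) (sl m b))) \<longlonglongrightarrow> tr (adj a * b)"
    by (intro tr_tendsto tendsto_mult bounded_linear.tendsto[OF bounded_linear_adj] iota_sl_tendsto)
  then show ?thesis by (simp add: tr_adj_mult_iota)
qed

lemma tr_adj_mult_cnj: "tr (adj b * a) = cnj (tr (adj a * b))"
proof -
  have "hs (sl m b) (sl m a) = cnj (hs (sl m a) (sl m b))" for m
    by (rule hs_cnj[OF sl_M sl_M])
  then have eq: "hs (sl m b) (sl m a) / d3 (Suc m) = cnj (hs (sl m a) (sl m b) / d3 (Suc m))" for m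
    by simp
  show ?thesis
    by (rule LIMSEQ_unique[OF tr_adj_mult_tendsto[of b a, unfolded eq] tendsto_cnj[OF tr_adj_mult_tendsto[of a b]]])
qed

text \<open>The norm of L^2(\<tau>), available before a GNS space is fixed.\<close>

definition n2 :: "'u \<Rightarrow> real" where
  "n2 a = sqrt (Re (tr (adj a * a)))"

lemma n2_square_tendsto: "(\<lambda>m. fro (sl m a) / d3 (Suc m)) \<longlonglongrightarrow> Re (tr (adj a * a))"
  using tendsto_Re[OF tr_adj_mult_tendsto[of a a]] by (simp add: hs_self)

lemma Re_tr_nonneg: "0 \<le> Re (tr (adj a * a))"
  by (rule LIMSEQ_le_const[OF n2_square_tendsto]) auto

lemma n2_nonneg [simp]: "0 \<le> n2 a"
  by (simp add: n2_def Re_tr_nonneg)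

lemma n2_square: "(n2 a)\<^sup>2 = Re (tr (adj a * a))"
  by (simp add: n2_def Re_tr_nonneg)

lemma n2_iota: "x \<in> M n \<Longrightarrow> (n2 (\<iota> n x))\<^sup>2 = fro x / d3 n"
  unfolding n2_square by (simp add: tr_adj_mult_iota hs_self)

text \<open>On slices this is \<open>fro_mult_le\<close> divided by the dimension, and both sides
  are continuous for norm convergence.\<close>

lemma n2_mult_le: "n2 (a * b) \<le> norm a * n2 b"
proof -
  let ?a = "\<lambda>m. \<iota> (Suc m) (sl m a)" and ?b = "\<lambda>m. \<iota> (Suc m) (sl m b)"
  have "(n2 (?a m * ?b m))\<^sup>2 \<le> (norm (?a m))\<^sup>2 * (n2 (?b m))\<^sup>2" for m
    unfolding iota_mult[OF sl_M sl_M, symmetric] n2_iota[OF sl_M] n2_iota[OF mult_carrier_mat[OF sl_M sl_M]]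
    using fro_mult_le[OF sl_M sl_M, of m a b] by (simp add: norm_iota divide_right_mono)
  moreover have "(\<lambda>m. (n2 (?a m * ?b m))\<^sup>2) \<longlonglongrightarrow> (n2 (a * b))\<^sup>2"
    unfolding n2_square
    by (intro tendsto_Re tr_tendsto tendsto_mult bounded_linear.tendsto[OF bounded_linear_adj] iota_sl_tendsto)
  moreover have "(\<lambda>m. (norm (?a m))\<^sup>2 * (n2 (?b m))\<^sup>2) \<longlonglongrightarrow> (norm a)\<^sup>2 * (n2 b)\<^sup>2"
    unfolding n2_square
    by (intro tendsto_Re tr_tendsto tendsto_mult tendsto_power tendsto_norm bounded_linear.tendsto[OF bounded_linear_adj] iota_sl_tendsto)
  ultimately have "(n2 (a * b))\<^sup>2 \<le> (norm a)\<^sup>2 * (n2 b)\<^sup>2"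
    by (intro LIMSEQ_le) blast+
  then show ?thesis
    by (intro power2_le_imp_le[of "n2 (a * b)"]) (simp_all add: power_mult_distrib)
qed

lemma n2_adj: "n2 (adj a) = n2 a"
  using tr_commute[of a "adj a"] by (simp add: n2_def adj_adj)

lemma n2_mult_le': "n2 (a * b) \<le> norm b * n2 a"
  using n2_mult_le[of "adj b" "adj a"] n2_adj[of "a * b"] n2_adj[of a] by (simp add: adj_mult)

lemma n2_one: "n2 1 = 1"
proof -
  have "(n2 (\<iota> 0 (1\<^sub>m (d3 0))))\<^sup>2 = 1"
    by (subst n2_iota) (auto simp: fro_one)
  then have "(n2 1)\<^sup>2 = 1" by (simp only: iota_one)
  then show ?thesis
    using n2_nonneg[of 1] unfolding power2_eq_1_iff by linarith
qed

lemma n2_le_norm: "n2 a \<le> norm a"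
  using n2_mult_le[of a 1] by (simp add: n2_one)

end

section \<open>Positive Hermitian forms\<close>

text \<open>Positive semidefinite Hermitian forms, linear in the second argument. The carrier is
  explicit because the limit energy is finite only on \<open>B_space\<close>.\<close>

definition hform :: "'v::complex_vec set \<Rightarrow> ('v \<Rightarrow> 'v \<Rightarrow> complex) \<Rightarrow> bool" where
  "hform V S \<longleftrightarrow> 0 \<in> V \<and> (\<forall>x\<in>V. \<forall>y\<in>V. x + y \<in> V) \<and> (\<forall>c. \<forall>x\<in>V. c *\<^sub>C x \<in> V) \<and>
     (\<forall>x\<in>V. \<forall>y\<in>V. \<forall>z\<in>V. S x (y + z) = S x y + S x z) \<and>
     (\<forall>c. \<forall>x\<in>V. \<forall>y\<in>V. S x (c *\<^sub>C y) = c * S x y) \<and>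
     (\<forall>x\<in>V. \<forall>y\<in>V. S y x = cnj (S x y)) \<and> (\<forall>x\<in>V. 0 \<le> Re (S x x))"

lemma hformD:
  assumes "hform V S"
  shows "0 \<in> V" "x \<in> V \<Longrightarrow> y \<in> V \<Longrightarrow> x + y \<in> V" "x \<in> V \<Longrightarrow> c *\<^sub>C x \<in> V"
    "x \<in> V \<Longrightarrow> y \<in> V \<Longrightarrow> z \<in> V \<Longrightarrow> S x (y + z) = S x y + S x z"
    "x \<in> V \<Longrightarrow> y \<in> V \<Longrightarrow> S x (c *\<^sub>C y) = c * S x y"
    "x \<in> V \<Longrightarrow> y \<in> V \<Longrightarrow> S y x = cnj (S x y)" "x \<in> V \<Longrightarrow> 0 \<le> Re (S x x)"
  using assms unfolding hform_def by blast+

lemma hform_scale: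
  assumes S: "hform V S" and x: "x \<in> V"
  shows "Re (S (c *\<^sub>C x) (c *\<^sub>C x)) = (cmod c)\<^sup>2 * Re (S x x)"
proof -
  note d = hformD[OF S]
  have "S (c *\<^sub>C x) (c *\<^sub>C x) = c * S (c *\<^sub>C x) x"
    using d(5) d(3) x by blast
  also have "S (c *\<^sub>C x) x = cnj (c * S x x)"
    using d(6)[OF x d(3)[OF x, of c]] d(5)[OF x x, of c] by simp
  also have "c * cnj (c * S x x) = complex_of_real ((cmod c)\<^sup>2) * cnj (S x x)"
    unfolding complex_norm_square by simp
  finally show ?thesis by simp
qed

lemma hform_expand:
  assumes S: "hform V S" and x: "x \<in> V" and y: "y \<in> V"
  shows "Re (S (x + y) (x + y)) = Re (S x x) + 2 * Re (S x y) + Re (S y y)"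
proof -
  note d = hformD[OF S]
  have xy: "x + y \<in> V" by (rule d(2)[OF x y])
  have "S (x + y) (x + y) = S (x + y) x + S (x + y) y"
    by (rule d(4)[OF xy x y])
  also have "S (x + y) x = cnj (S x x + S x y)"
    using d(6)[OF x xy] d(4)[OF x x y] by simp
  also have "S (x + y) y = cnj (S y x + S y y)"
    using d(6)[OF y xy] d(4)[OF y x y] by simp
  finally show ?thesis
    using d(6)[OF x y] by simp
qed

lemma hform_Cauchy_Schwarz:
  assumes S: "hform V S" and x: "x \<in> V" and y: "y \<in> V"
  shows "(Re (S x y))\<^sup>2 \<le> Re (S x x) * Re (S y y)"
proof -
  note d = hformD[OF S]
  define a where "a = Re (S x x)"
  define b where "b = Re (S x y)"
  define c where "c = Re (S y y)"
  have q: "0 \<le> a + 2 * t * b + t\<^sup>2 * c" for t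
  proof -
    have ty: "complex_of_real t *\<^sub>C y \<in> V" by (rule d(3)[OF y])
    have "0 \<le> Re (S (x + complex_of_real t *\<^sub>C y) (x + complex_of_real t *\<^sub>C y))"
      by (rule d(7)[OF d(2)[OF x ty]])
    then show ?thesis
      unfolding hform_expand[OF S x ty] hform_scale[OF S y] d(5)[OF x y] a_def b_def c_def by simp
  qed
  have c0: "0 \<le> c" unfolding c_def by (rule d(7)[OF y])
  have "b\<^sup>2 \<le> a * c"
  proof (cases "c = 0")
    case True
    have "b = 0"
    proof (rule ccontr)
      assume "b \<noteq> 0"
      \<comment> \<open>For c = 0 the quadratic in t is affine, and this t brings it down to
        -1.\<close>
      then have "a + 2 * (- (a + 1) / (2 * b)) * b = - 1" by (simp add: field_simps)
      then show False using q[of "- (a + 1) / (2 * b)"] True by simp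
    qed
    then show ?thesis using True by simp
  next
    case False
    then have "c > 0" using c0 by simp
    \<comment> \<open>t = - b / c is the minimiser of the quadratic.\<close>
    moreover have "a + 2 * (- b / c) * b + (- b / c)\<^sup>2 * c = a - b\<^sup>2 / c"
      using False by (simp add: power2_eq_square field_simps)
    ultimately have "b\<^sup>2 / c \<le> a" using q[of "- b / c"] by linarith
    then show ?thesis using \<open>c > 0\<close> by (simp add: pos_divide_le_eq)
  qed
  then show ?thesis by (simp add: a_def b_def c_def)
qed

lemma hform_triangle:
  assumes S: "hform V S" and x: "x \<in> V" and y: "y \<in> V"
  shows "sqrt (Re (S (x + y) (x + y))) \<le> sqrt (Re (S x x)) + sqrt (Re (S y y))"
proof (rule real_le_lsqrt)
  note d = hformD[OF S]
  have "Re (S x y) \<le> sqrt (Re (S x x) * Re (S y y))"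
    using hform_Cauchy_Schwarz[OF S x y] by (rule real_le_rsqrt)
  then show "Re (S (x + y) (x + y)) \<le> (sqrt (Re (S x x)) + sqrt (Re (S y y)))\<^sup>2"
    unfolding hform_expand[OF S x y] using d(7)[OF x] d(7)[OF y]
    by (simp add: power2_sum real_sqrt_mult)
qed (use hformD(7)[OF S x] hformD(7)[OF S y] in auto)

lemma hform_subset:
  assumes S: "hform UNIV S" and "0 \<in> W" "\<And>x y. x \<in> W \<Longrightarrow> y \<in> W \<Longrightarrow> x + y \<in> W" "\<And>c x. x \<in> W \<Longrightarrow> c *\<^sub>C x \<in> W"
  shows "hform W S"
  unfolding hform_def by (intro conjI ballI allI hformD(4-7)[OF S] assms(2-) UNIV_I)

lemma minus_eq_scaleC: "x - y = x + (- 1) *\<^sub>C (y :: 'v::complex_vec)"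
  by (simp add: scaleC_minus_one)

lemma hform_diff:
  assumes S: "hform V S" and x: "x \<in> V" and y: "y \<in> V"
  shows "x - y \<in> V" "Re (S (x - y) (x - y)) \<le> 2 * Re (S x x) + 2 * Re (S y y)"
proof -
  note d = hformD[OF S]
  have my: "(- 1) *\<^sub>C y \<in> V" by (rule d(3)[OF y])
  show "x - y \<in> V" unfolding minus_eq_scaleC by (rule d(2)[OF x my])
  have "Re (S (x - y) (x - y)) = Re (S x x) - 2 * Re (S x y) + Re (S y y)"
    unfolding minus_eq_scaleC[of x y] hform_expand[OF S x my] hform_scale[OF S y] d(5)[OF x y] by simp
  moreover have "0 \<le> Re (S x x) + 2 * Re (S x y) + Re (S y y)"
    using d(7)[OF d(2)[OF x y]] hform_expand[OF S x y] by simp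
  ultimately show "Re (S (x - y) (x - y)) \<le> 2 * Re (S x x) + 2 * Re (S y y)" by simp
qed

lemma hform_add:
  assumes S: "hform V S" and T: "hform V T"
  shows "hform V (\<lambda>x y. S x y + T x y)"
  unfolding hform_def
proof (intro conjI ballI allI)
  note d = hformD[OF S] and e = hformD[OF T]
  fix x y z c assume x: "x \<in> V" and y: "y \<in> V"
  show "S x (c *\<^sub>C y) + T x (c *\<^sub>C y) = c * (S x y + T x y)"
    by (simp add: d(5)[OF x y] e(5)[OF x y] distrib_left)
  show "S y x + T y x = cnj (S x y + T x y)"
    unfolding d(6)[OF x y] e(6)[OF x y] by simp
  show "S x (y + z) + T x (y + z) = S x y + T x y + (S x z + T x z)" if z: "z \<in> V"
    by (simp add: d(4)[OF x y z] e(4)[OF x y z])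
qed (simp_all add: hformD(1,2,3)[OF S] hformD(7)[OF S] hformD(7)[OF T])

text \<open>Since S is linear in its second argument, the real part of S x (\<i> y) is minus the
  imaginary part of S x y, whence the order of the last two terms.\<close>

lemma hform_polarization:
  assumes S: "hform V S" and x: "x \<in> V" and y: "y \<in> V"
  defines "q z \<equiv> Re (S z z)"
  shows "S x y = Complex ((q (x + y) - q (x - y)) / 4) ((q (x - \<i> *\<^sub>C y) - q (x + \<i> *\<^sub>C y)) / 4)"
proof -
  note d = hformD[OF S]
  have *: "q (x + z) - q (x - z) = 4 * Re (S x z)" if z: "z \<in> V" for z
    unfolding q_def minus_eq_scaleC[of x z] hform_expand[OF S x z] hform_expand[OF S x d(3)[OF z]]
      hform_scale[OF S z] d(5)[OF x z] by simp
  show ?thesis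
    using *[OF y] *[OF d(3)[OF y, of \<i>]] d(5)[OF x y, of \<i>] by (auto intro!: complex_eqI)
qed

text \<open>By polarisation, convergence on the diagonal forces convergence of S x y, and then the
  algebraic identities pass to the limit.\<close>

lemma hform_limit:
  fixes T :: "nat \<Rightarrow> 'v::complex_vec \<Rightarrow> 'v \<Rightarrow> complex"
  assumes T: "\<And>n. hform V (T n)" and q: "\<And>x. x \<in> V \<Longrightarrow> convergent (\<lambda>n. Re (T n x x))"
  shows "hform V (\<lambda>x y. lim (\<lambda>n. T n x y))"
proof -
  have conv: "(\<lambda>n. T n x y) \<longlonglongrightarrow> lim (\<lambda>n. T n x y)" if x: "x \<in> V" and y: "y \<in> V" for x y
  proof -
    have V: "x + y \<in> V" "x - y \<in> V" "x + \<i> *\<^sub>C y \<in> V" "x - \<i> *\<^sub>C y \<in> V"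
      using hformD(2,3)[OF T] hform_diff(1)[OF T] x y by blast+
    obtain p where p: "\<And>z. z \<in> V \<Longrightarrow> (\<lambda>n. Re (T n z z)) \<longlonglongrightarrow> p z"
      using q unfolding convergent_def by metis
    have "(\<lambda>n. T n x y) \<longlonglongrightarrow> Complex ((p (x + y) - p (x - y)) / 4) ((p (x - \<i> *\<^sub>C y) - p (x + \<i> *\<^sub>C y)) / 4)"
      unfolding hform_polarization[OF T x y]
      by (intro tendsto_Complex tendsto_divide tendsto_diff tendsto_const p V) auto
    then have "convergent (\<lambda>n. T n x y)" by (rule convergentI)
    then show ?thesis by (simp add: convergent_LIMSEQ_iff)
  qed
  show ?thesis
    unfolding hform_def
  proof (intro conjI ballI allI)
    note d = hformD[OF T]
    fix x y z c assume x: "x \<in> V" and y: "y \<in> V"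
    show "lim (\<lambda>n. T n x (c *\<^sub>C y)) = c * lim (\<lambda>n. T n x y)"
      unfolding d(5)[OF x y] by (intro limI tendsto_mult_left conv x y)
    show "lim (\<lambda>n. T n y x) = cnj (lim (\<lambda>n. T n x y))"
      unfolding d(6)[OF x y] by (intro limI tendsto_cnj conv x y)
    show "lim (\<lambda>n. T n x (y + z)) = lim (\<lambda>n. T n x y) + lim (\<lambda>n. T n x z)" if z: "z \<in> V"
      unfolding d(4)[OF x y z] by (intro limI tendsto_add conv x y z)
  next
    fix x assume x: "x \<in> V"
    show "0 \<le> Re (lim (\<lambda>n. T n x x))"
      by (rule LIMSEQ_le_const[OF tendsto_Re[OF conv[OF x x]]]) (use hformD(7)[OF T x] in blast)
  qed (use hformD(1,2,3)[OF T] in blast)+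
qed

section \<open>The energy form on the limit algebra\<close>

context uhf3
begin

definition ef :: "nat \<Rightarrow> 'u \<Rightarrow> 'u \<Rightarrow> complex" where
  "ef m a b = complex_of_real ((5 / 3) ^ m) * energy_form (sl m a) (sl m b)"

definition en :: "nat \<Rightarrow> 'u \<Rightarrow> real" where
  "en m a = (5 / 3) ^ m * energy (sl m a)"

lemma en_nonneg: "0 \<le> en m a"
  by (simp add: en_def energy_nonneg[OF sl_M])

lemma Re_ef: "Re (ef m a a) = en m a"
  by (simp add: ef_def en_def energy_form_self[OF sl_M])

lemma hform_ef: "hform UNIV (ef m)"
  unfolding hform_def
proof (intro conjI ballI allI)
  fix x y z :: 'u and c
  show "ef m x (y + z) = ef m x y + ef m x z"
    by (simp add: ef_def sl_add energy_form_add_right[OF sl_M sl_M sl_M] distrib_left)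
  show "ef m x (c *\<^sub>C y) = c * ef m x y"
    by (simp add: ef_def sl_scaleC energy_form_smult_right[OF sl_M sl_M])
  show "ef m y x = cnj (ef m x y)"
    using energy_form_cnj[OF sl_M sl_M, of m x y] by (simp add: ef_def)
  show "0 \<le> Re (ef m x x)"
    by (simp add: Re_ef en_nonneg)
qed auto

lemma hform_tr: "hform UNIV (\<lambda>a b. tr (adj a * b))"
  unfolding hform_def
proof (intro conjI ballI allI)
  fix x y z :: 'u and c
  show "tr (adj x * (y + z)) = tr (adj x * y) + tr (adj x * z)"
    by (simp add: distrib_left tr_add)
  show "tr (adj x * (c *\<^sub>C y)) = c * tr (adj x * y)"
    by (simp add: mult_scaleC_right tr_scaleC)
  show "tr (adj y * x) = cnj (tr (adj x * y))"
    by (rule tr_adj_mult_cnj)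
qed (auto simp: Re_tr_nonneg)

lemma n2_triangle: "n2 (a + b) \<le> n2 a + n2 b"
  using hform_triangle[OF hform_tr, of a b] by (simp add: n2_def)

lemma en_diff_le: "en m (a - b) \<le> 2 * en m a + 2 * en m b"
  using hform_diff(2)[OF hform_ef, of a b m] by (simp add: Re_ef)

lemma en_add_le: "en m (a + b) \<le> 2 * en m a + 2 * en m b"
  using hform_diff(2)[OF hform_ef, of a "- b" m] hform_scale[OF hform_ef, of b m "- 1"]
  by (simp add: Re_ef scaleC_minus_one)

lemma en_scaleC: "en m (c *\<^sub>C a) = (cmod c)\<^sup>2 * en m a"
  using hform_scale[OF hform_ef, of a m c] by (simp add: Re_ef)

lemma en_adj: "en m (adj a) = en m a"
  by (simp add: en_def sl_adj energy_adjoint[OF sl_M])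

lemma en_one_minus: "en m (1 - a) = en m a"
  by (simp add: en_def sl_diff sl_one energy_one_minus[OF sl_M])

lemma en_mono: "a \<in> A_inf \<iota> \<Longrightarrow> en m a \<le> en (Suc m) a"
  using energy_mono[OF A_inf_good, of a m] by (simp add: en_def comp_sl)

lemma incseq_en: "a \<in> A_inf \<iota> \<Longrightarrow> incseq (\<lambda>m. en m a)"
  by (intro incseq_SucI en_mono)

text \<open>By monotonicity the \<open>lim\<close> in the definition is a supremum, so energy bounds
  can be checked level by level.\<close>

lemma energy_inf_SUP:
  assumes "a \<in> A_inf \<iota>"
  shows "energy_inf \<iota> a = (SUP m. ereal (en m a))"
proof -
  have "incseq (\<lambda>m. ereal (en m a))"
    using incseq_en[OF assms] by (simp add: incseq_def)
  from LIMSEQ_SUP[OF this] show ?thesis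
    unfolding energy_inf_def en_def by (rule limI)
qed

lemma energy_inf_le_iff: "a \<in> A_inf \<iota> \<Longrightarrow> energy_inf \<iota> a \<le> ereal C \<longleftrightarrow> (\<forall>m. en m a \<le> C)"
  by (simp add: energy_inf_SUP SUP_le_iff)

lemma energy_inf_nonneg: "a \<in> A_inf \<iota> \<Longrightarrow> 0 \<le> energy_inf \<iota> a"
  unfolding energy_inf_SUP by (rule SUP_upper2[of 0]) (auto simp: en_nonneg)

lemma energy_inf_mono:
  assumes "a \<in> A_inf \<iota>" "b \<in> A_inf \<iota>" "\<And>m. en m a \<le> en m b"
  shows "energy_inf \<iota> a \<le> energy_inf \<iota> b"
  unfolding energy_inf_SUP[OF assms(1)] energy_inf_SUP[OF assms(2)]
  by (rule SUP_mono') (simp add: assms(3))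

definition En :: "'u \<Rightarrow> real" where
  "En b = real_of_ereal (energy_inf \<iota> b)"

lemma B_space_iff: "b \<in> B_space \<iota> \<longleftrightarrow> b \<in> A_inf \<iota> \<and> (\<exists>C. \<forall>m. en m b \<le> C)"
proof (cases "b \<in> A_inf \<iota>")
  case True
  have "energy_inf \<iota> b < \<infinity> \<longleftrightarrow> (\<exists>C. energy_inf \<iota> b \<le> ereal C)"
    using energy_inf_nonneg[OF True] by (cases "energy_inf \<iota> b") auto
  then show ?thesis
    using True by (simp add: B_space_def energy_inf_le_iff)
qed (simp add: B_space_def)

lemma B_spaceI: "b \<in> A_inf \<iota> \<Longrightarrow> (\<And>m. en m b \<le> C) \<Longrightarrow> b \<in> B_space \<iota>"
  by (auto simp: B_space_iff)

lemma B_space_A_inf: "b \<in> B_space \<iota> \<Longrightarrow> b \<in> A_inf \<iota>"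
  by (simp add: B_space_def)

lemma energy_inf_En:
  assumes "b \<in> B_space \<iota>"
  shows "energy_inf \<iota> b = ereal (En b)"
  using assms energy_inf_nonneg[OF B_space_A_inf[OF assms]]
  unfolding En_def B_space_def by (cases "energy_inf \<iota> b") auto

lemma En_le_iff: "b \<in> B_space \<iota> \<Longrightarrow> En b \<le> C \<longleftrightarrow> (\<forall>m. en m b \<le> C)"
  using energy_inf_le_iff[OF B_space_A_inf, of b C] energy_inf_En[of b] by simp

lemma en_le_En: "b \<in> B_space \<iota> \<Longrightarrow> en m b \<le> En b"
  using En_le_iff[of b "En b"] by simp

lemma En_nonneg: "b \<in> B_space \<iota> \<Longrightarrow> 0 \<le> En b"
  using en_le_En[of b 0] en_nonneg[of 0 b] by simp

lemma en_tendsto_En: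
  assumes "b \<in> B_space \<iota>"
  shows "(\<lambda>m. en m b) \<longlonglongrightarrow> En b"
proof -
  have "(\<lambda>m. ereal (en m b)) \<longlonglongrightarrow> (SUP m. ereal (en m b))"
    using incseq_en[OF B_space_A_inf[OF assms]] by (intro LIMSEQ_SUP) (simp add: incseq_def)
  then have "(\<lambda>m. ereal (en m b)) \<longlonglongrightarrow> ereal (En b)"
    unfolding energy_inf_SUP[OF B_space_A_inf[OF assms], symmetric] energy_inf_En[OF assms] .
  then show ?thesis by simp
qed

lemma mat_norm_adjoint: "x \<in> M n \<Longrightarrow> mat_norm (mat_adjoint x) = mat_norm x"
  using norm_iota[of "mat_adjoint x" n] by (simp add: iota_adj norm_iota)

lemma fro_mult_le':
  assumes "x \<in> M n" "y \<in> M n"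
  shows "fro (x * y) \<le> fro x * (mat_norm y)\<^sup>2"
  using fro_mult_le[of "mat_adjoint y" "d3 n" "d3 n" "mat_adjoint x" "d3 n"] assms mat_adjoint_mult[OF assms]
  by (simp add: fro_adjoint mat_norm_adjoint mult.commute flip: fro_adjoint[of "x * y"])

text \<open>Leibniz rule: a_i b_i - a_j b_j = a_i (b_i - b_j) + (a_i - a_j) b_j. The 2 comes from
  squaring a sum.\<close>

lemma energy_mult_le:
  assumes a: "a \<in> M (Suc n)" "bdiag a" and b: "b \<in> M (Suc n)" "bdiag b"
  shows "energy (a * b) \<le> 2 * ((mat_norm a)\<^sup>2 * energy b + (mat_norm b)\<^sup>2 * energy a)"
proof -
  have ab: "a * b \<in> M (Suc n)" by (rule mult_carrier_mat[OF a(1) b(1)])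
  have c: "comp_at a i \<in> M n" "comp_at b i \<in> M n" for i using a b by auto
  have d: "comp_at a i - comp_at a j \<in> M n" "comp_at b i - comp_at b j \<in> M n" for i j
    by (intro minus_carrier_mat c)+
  have nc: "(mat_norm (comp_at x i))\<^sup>2 \<le> (mat_norm x)\<^sup>2" if "x \<in> M (Suc n)" for x i
    using mat_norm_comp_at_le[of x "d3 n" "d3 n" i] that by (intro power_mono) (auto simp: d3_Suc)
  have "fro (comp_at (a * b) i - comp_at (a * b) j)
      \<le> 2 * ((mat_norm a)\<^sup>2 * fro (comp_at b i - comp_at b j) + (mat_norm b)\<^sup>2 * fro (comp_at a i - comp_at a j))" for i j
  proof -
    have p: "comp_at a i * (comp_at b i - comp_at b j) \<in> M n" "(comp_at a i - comp_at a j) * comp_at b j \<in> M n"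
      using c d by (auto intro!: mult_carrier_mat)
    have "comp_at (a * b) i - comp_at (a * b) j
        = comp_at a i * (comp_at b i - comp_at b j) + (comp_at a i - comp_at a j) * comp_at b j" (is "?l = ?r")
    proof -
      have "?r = (comp_at a i * comp_at b i - comp_at a i * comp_at b j) + (comp_at a i * comp_at b j - comp_at a j * comp_at b j)"
        using mult_minus_distrib_mat[OF c(1)[of i] c(2)[of i] c(2)[of j]]
          minus_mult_distrib_mat[OF c(1)[of i] c(1)[of j] c(2)[of j]] by simp
      also have "\<dots> = comp_at a i * comp_at b i - comp_at a j * comp_at b j"
        using mult_carrier_mat[OF c(1) c(2)] by (intro eq_matI) (auto simp: d3_Suc)
      finally show ?thesis
        by (simp add: comp_at_M_mult[OF a(1) b(1) a(2)])
    qed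
    then have "fro ?l \<le> 2 * fro (comp_at a i * (comp_at b i - comp_at b j)) + 2 * fro ((comp_at a i - comp_at a j) * comp_at b j)"
      using fro_add_le[OF p] by simp
    also have "fro (comp_at a i * (comp_at b i - comp_at b j)) \<le> (mat_norm (comp_at a i))\<^sup>2 * fro (comp_at b i - comp_at b j)"
      by (rule fro_mult_le[OF c(1) d(2)])
    also have "\<dots> \<le> (mat_norm a)\<^sup>2 * fro (comp_at b i - comp_at b j)"
      by (rule mult_right_mono[OF nc[OF a(1)]]) simp
    also have "fro ((comp_at a i - comp_at a j) * comp_at b j) \<le> fro (comp_at a i - comp_at a j) * (mat_norm (comp_at b j))\<^sup>2"
      by (rule fro_mult_le'[OF d(1) c(2)])
    also have "\<dots> \<le> fro (comp_at a i - comp_at a j) * (mat_norm b)\<^sup>2"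
      by (rule mult_left_mono[OF nc[OF b(1)]]) simp
    finally show ?thesis by (simp add: algebra_simps)
  qed
  then have "(\<Sum>(i, j)\<in>epairs. fro (comp_at (a * b) i - comp_at (a * b) j))
      \<le> (\<Sum>(i, j)\<in>epairs. 2 * ((mat_norm a)\<^sup>2 * fro (comp_at b i - comp_at b j) + (mat_norm b)\<^sup>2 * fro (comp_at a i - comp_at a j)))"
    by (intro sum_mono) auto
  then show ?thesis
    unfolding energy_sum_fro[OF ab] energy_sum_fro[OF a(1)] energy_sum_fro[OF b(1)]
    by (simp add: case_prod_beta sum.distrib sum_distrib_left)
qed

lemma en_mult_le:
  assumes a: "a \<in> A_inf \<iota>" and b: "b \<in> A_inf \<iota>"
  shows "en m (a * b) \<le> 2 * ((norm a)\<^sup>2 * en m b + (norm b)\<^sup>2 * en m a)"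
proof -
  have "energy (sl m a * sl m b) \<le> 2 * ((mat_norm (sl m a))\<^sup>2 * energy (sl m b) + (mat_norm (sl m b))\<^sup>2 * energy (sl m a))"
    by (rule energy_mult_le[OF sl_M good_bdiag[OF A_inf_good[OF a]] sl_M good_bdiag[OF A_inf_good[OF b]]])
  also have "\<dots> \<le> 2 * ((norm a)\<^sup>2 * energy (sl m b) + (norm b)\<^sup>2 * energy (sl m a))"
    by (intro mult_left_mono add_mono mult_right_mono power_mono norm_sl_le energy_nonneg[OF sl_M]) auto
  finally have "(5 / 3) ^ m * energy (sl m a * sl m b)
      \<le> (5 / 3) ^ m * (2 * ((norm a)\<^sup>2 * energy (sl m b) + (norm b)\<^sup>2 * energy (sl m a)))"
    by (rule mult_left_mono) simp
  then show ?thesis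
    by (simp add: en_def sl_mult[OF a b] algebra_simps)
qed

lemma en_zero: "en m 0 = 0"
  using en_scaleC[of m 0 0] by simp

lemma zero_B: "0 \<in> B_space \<iota>"
  by (rule B_spaceI[where C = 0]) (simp_all add: A_infD(3) en_zero)

lemma B_add:
  assumes a: "a \<in> B_space \<iota>" and b: "b \<in> B_space \<iota>"
  shows "a + b \<in> B_space \<iota>"
proof (rule B_spaceI)
  show "en m (a + b) \<le> 2 * En a + 2 * En b" for m
    using en_add_le[of m a b] en_le_En[OF a, of m] en_le_En[OF b, of m] by linarith
qed (intro A_infD(4) B_space_A_inf a b)

lemma B_scaleC:
  assumes a: "a \<in> B_space \<iota>"
  shows "c *\<^sub>C a \<in> B_space \<iota>"
proof (rule B_spaceI)
  show "en m (c *\<^sub>C a) \<le> (cmod c)\<^sup>2 * En a" for m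
    unfolding en_scaleC using en_le_En[OF a, of m] by (rule mult_left_mono) simp
qed (intro A_infD(7) B_space_A_inf a)

lemma B_diff: "a \<in> B_space \<iota> \<Longrightarrow> b \<in> B_space \<iota> \<Longrightarrow> a - b \<in> B_space \<iota>"
  unfolding minus_eq_scaleC by (intro B_add B_scaleC)

lemma B_adj:
  assumes a: "a \<in> B_space \<iota>"
  shows "adj a \<in> B_space \<iota>" "energy_inf \<iota> (adj a) = energy_inf \<iota> a"
proof -
  have A: "a \<in> A_inf \<iota>" "adj a \<in> A_inf \<iota>" by (intro A_infD(9) B_space_A_inf a)+
  show "adj a \<in> B_space \<iota>"
    by (rule B_spaceI[OF A(2)]) (use en_le_En[OF a] en_adj in simp)
  show "energy_inf \<iota> (adj a) = energy_inf \<iota> a"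
    by (simp add: energy_inf_SUP A en_adj)
qed

lemma B_mult:
  assumes a: "a \<in> B_space \<iota>" and b: "b \<in> B_space \<iota>"
  shows "a * b \<in> B_space \<iota>"
proof (rule B_spaceI)
  have A: "a \<in> A_inf \<iota>" "b \<in> A_inf \<iota>" using a b B_space_A_inf by auto
  show "en m (a * b) \<le> 2 * ((norm a)\<^sup>2 * En b + (norm b)\<^sup>2 * En a)" for m
    by (rule order_trans[OF en_mult_le[OF A]]) (intro mult_left_mono add_mono en_le_En a b; simp)
qed (intro A_infD(5) B_space_A_inf a b)

lemma hform_energy: "hform (B_space \<iota>) (\<lambda>a b. lim (\<lambda>m. ef m a b))"
proof (rule hform_limit)
  show "hform (B_space \<iota>) (ef m)" for m
    by (rule hform_subset[OF hform_ef zero_B B_add B_scaleC])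
  show "convergent (\<lambda>m. Re (ef m x x))" if "x \<in> B_space \<iota>" for x
    using en_tendsto_En[OF that] by (auto simp: Re_ef convergent_def)
qed

lemma Re_lim_ef:
  assumes "b \<in> B_space \<iota>"
  shows "Re (lim (\<lambda>m. ef m b b)) = En b"
proof -
  have "ef m b b = complex_of_real (en m b)" for m
    by (simp add: ef_def en_def energy_form_self[OF sl_M])
  then have "(\<lambda>m. ef m b b) \<longlonglongrightarrow> complex_of_real (En b)"
    using en_tendsto_En[OF assms] by (simp add: tendsto_of_real_iff)
  then show ?thesis
    by (simp add: limI)
qed

text \<open>Slices are multiplicative and adjoint preserving on \<open>A_inf\<close>, so
  \<open>energy_pos_part_le\<close> applies at every level.\<close>

lemma energy_pos_part:
  assumes A: "s \<in> A_inf \<iota>" "t \<in> A_inf \<iota>" and adj: "adj s = s" "adj t = t" and orth: "(s * s) * (t * t) = 0"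
  shows "en m (s * s) \<le> en m (s * s - t * t)"
proof -
  have AA: "s * s \<in> A_inf \<iota>" "t * t \<in> A_inf \<iota>" by (intro A_infD(5) A)+
  have "sl m 0 = 0 \<cdot>\<^sub>m sl m 0"
    using sl_scaleC[of m 0 0] by simp
  also have "\<dots> = 0\<^sub>m (d3 (Suc m)) (d3 (Suc m))"
    by (intro eq_matI) auto
  finally have "sl m 0 = 0\<^sub>m (d3 (Suc m)) (d3 (Suc m))" .
  then have "sl m s * sl m s * (sl m t * sl m t) = 0\<^sub>m (d3 (Suc m)) (d3 (Suc m))"
    using sl_mult[OF AA, of m] orth by (simp add: sl_mult A)
  then have "energy (sl m s * sl m s) \<le> energy (sl m s * sl m s - sl m t * sl m t)"
    using sl_adj[of m s] sl_adj[of m t] adj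
    by (intro energy_pos_part_le[OF sl_M _ good_bdiag[OF A_inf_good[OF A(1)]] sl_M _ good_bdiag[OF A_inf_good[OF A(2)]]]) auto
  then show ?thesis
    by (simp add: en_def sl_diff sl_mult A)
qed

end

section \<open>Energy estimates for the norm and completeness\<close>

lemma geometric_increments_bound:
  fixes u :: "nat \<Rightarrow> 'a::banach"
  assumes "\<And>k. norm (u (Suc k) - u k) \<le> c * r ^ k" "0 \<le> r" "r < 1" "u \<longlonglongrightarrow> l"
  shows "norm (l - u m) \<le> c * r ^ m / (1 - r)"
proof -
  have "(\<lambda>k. u (Suc k + m) - u (k + m)) sums (l - u (0 + m))"
    by (rule telescope_sums[OF LIMSEQ_ignore_initial_segment[OF assms(4)]])
  moreover have "(\<lambda>k. c * r ^ m * r ^ k) sums (c * r ^ m * (1 / (1 - r)))"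
    using assms by (intro sums_mult geometric_sums) auto
  moreover have "norm (u (Suc k + m) - u (k + m)) \<le> c * r ^ m * r ^ k" for k
    using assms(1)[of "k + m"] by (simp add: power_add mult_ac)
  ultimately show ?thesis
    using norm_sums_le by fastforce
qed

lemma geometric_increments_convergent:
  fixes u :: "nat \<Rightarrow> 'a::banach"
  assumes "\<And>k. norm (u (Suc k) - u k) \<le> c * r ^ k" "0 \<le> r" "r < 1"
  shows "convergent u"
proof -
  have "summable (\<lambda>k. u (Suc k) - u k)"
    by (rule summable_comparison_test'[where N = 0 and g = "\<lambda>k. c * r ^ k"])
      (use assms in \<open>auto intro!: summable_mult summable_geometric\<close>)
  then have "convergent (\<lambda>n. u n - u 0)"
    by (simp add: summable_iff_convergent sum_lessThan_telescope)
  then have "convergent (\<lambda>n. (u n - u 0) + u 0)"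
    by (intro convergent_add convergent_const)
  then show ?thesis by simp
qed

text \<open>A bound on the rescaled energies makes the plain energies decay like (3/5)^m; norms are
  controlled by the square root of that.\<close>

definition erate :: real where
  "erate = sqrt (3 / 5)"

lemma erate: "0 \<le> erate" "erate < 1" "erate\<^sup>2 = 3 / 5"
  by (simp_all add: erate_def)

lemma erate_power2: "(erate ^ k)\<^sup>2 = (3 / 5) ^ k"
  using erate(3) by (metis power_mult mult.commute)

context uhf3
begin

text \<open>\<open>d\<close> is the image of b minus b(v_2) tensored with 1. The first bound serves
  norm convergence; the other two, in which the normalised trace supplies the dimension, serve
  density.\<close>

lemma norm_increment:
  assumes b: "b \<in> M (Suc (Suc m))" "bdiag b"
  defines "d \<equiv> \<iota> (Suc (Suc m)) b - \<iota> (Suc m) (comp_at b 2)"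
  shows "(norm d)\<^sup>2 \<le> energy b" "(n2 d)\<^sup>2 \<le> energy b / d3 (Suc (Suc m))"
    "energy b \<le> 8 * d3 (Suc (Suc m)) * (n2 d)\<^sup>2"
proof -
  have c: "comp_at b 2 \<in> M (Suc m)" using b by auto
  have t: "comp_at b 2 \<otimes>\<^sub>m 1\<^sub>m 3 \<in> M (Suc (Suc m))" by (rule tensor_one_M[OF c])
  have bt: "b - comp_at b 2 \<otimes>\<^sub>m 1\<^sub>m 3 \<in> M (Suc (Suc m))" by (rule minus_carrier_mat[OF t])
  have d: "d = \<iota> (Suc (Suc m)) (b - comp_at b 2 \<otimes>\<^sub>m 1\<^sub>m 3)"
    unfolding d_def iota_diff[OF b(1) t] iota_tensor_one[OF c] ..
  have pos: "d3 (Suc (Suc m)) > 0" by (simp add: d3_def)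
  show "(norm d)\<^sup>2 \<le> energy b"
    unfolding d norm_iota[OF bt] using mat_norm_le_fro fro_minus_tensor_le_energy(1)[OF b] by (rule order_trans)
  show "(n2 d)\<^sup>2 \<le> energy b / d3 (Suc (Suc m))"
    unfolding d n2_iota[OF bt] using fro_minus_tensor_le_energy(1)[OF b] by (intro divide_right_mono) auto
  show "energy b \<le> 8 * d3 (Suc (Suc m)) * (n2 d)\<^sup>2"
    unfolding d n2_iota[OF bt] using fro_minus_tensor_le_energy(2)[OF b] pos by simp
qed

lemma energy_bound_increment:
  assumes b: "b \<in> M (Suc (Suc m))" "bdiag b" and le: "(5 / 3) ^ Suc m * energy b \<le> C"
  shows "norm (\<iota> (Suc (Suc m)) b - \<iota> (Suc m) (comp_at b 2)) \<le> sqrt C * erate ^ m"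
proof (rule power2_le_imp_le)
  have e0: "0 \<le> energy b" by (rule energy_nonneg[OF b(1)])
  then have "0 \<le> (5 / 3) ^ Suc m * energy b" by simp
  then have C: "0 \<le> C" using le by linarith
  \<comment> \<open>One factor 5/3 is given up so that the rate is indexed by m.\<close>
  have "(5 / 3) ^ m * energy b \<le> (5 / 3) ^ Suc m * energy b"
    using e0 by (intro mult_right_mono) auto
  then have "(5 / 3) ^ m * energy b \<le> C" using le by linarith
  then have "(3 / 5) ^ m * ((5 / 3) ^ m * energy b) \<le> (3 / 5) ^ m * C"
    by (rule mult_left_mono) simp
  then have "((3 / 5) ^ m * (5 / 3) ^ m) * energy b \<le> (3 / 5) ^ m * C"
    by (simp only: mult.assoc)
  moreover have "(3 / 5) ^ m * (5 / 3) ^ m = (1 :: real)"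
    by (simp add: power_mult_distrib[symmetric])
  ultimately have "energy b \<le> C * (3 / 5) ^ m"
    by (simp only: mult_1 mult.commute[of C])
  then show "(norm (\<iota> (Suc (Suc m)) b - \<iota> (Suc m) (comp_at b 2)))\<^sup>2 \<le> (sqrt C * erate ^ m)\<^sup>2"
    using norm_increment(1)[OF b] C by (simp add: power_mult_distrib erate_power2)
  show "0 \<le> sqrt C * erate ^ m" using C erate by simp
qed

text \<open>The source of elements of \<open>B_space\<close>: a compatible tower with bounded
  rescaled energies has summable increments, so it converges in norm.\<close>

lemma energy_bounded_compatible:
  assumes b: "\<And>m. good m (b m)" "\<And>m. comp_at (b (Suc m)) 2 = b m" and le: "\<And>m. (5 / 3) ^ m * energy (b m) \<le> C"
  obtains a where "(\<lambda>m. \<iota> (Suc m) (b m)) \<longlonglongrightarrow> a" "\<And>m. sl m a = b m" "a \<in> B_space \<iota>"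
proof -
  have "norm (\<iota> (Suc (Suc m)) (b (Suc m)) - \<iota> (Suc m) (b m)) \<le> sqrt C * erate ^ m" for m
    using energy_bound_increment[OF good_carrier good_bdiag, OF b(1) b(1) le] by (simp add: b(2))
  then have "convergent (\<lambda>m. \<iota> (Suc m) (b m))"
    by (rule geometric_increments_convergent[OF _ erate(1,2)])
  then obtain a where a: "(\<lambda>m. \<iota> (Suc m) (b m)) \<longlonglongrightarrow> a"
    by (auto simp: convergent_def)
  note * = compatible_limit[OF b a]
  have "a \<in> B_space \<iota>"
    by (rule B_spaceI[where C = C, OF *(2)]) (simp add: en_def *(1) le)
  then show ?thesis using that a * by blast
qed

text \<open>The bound depends on a only through C, so it is uniform on sets of bounded
  energy.\<close>

lemma norm_minus_sl_le:
  assumes a: "a \<in> A_inf \<iota>" and le: "\<And>m. en m a \<le> C"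
  shows "norm (a - \<iota> (Suc m) (sl m a)) \<le> sqrt C * erate ^ m / (1 - erate)"
proof (rule geometric_increments_bound[OF _ erate(1,2) iota_sl_tendsto])
  fix k
  show "norm (\<iota> (Suc (Suc k)) (sl (Suc k) a) - \<iota> (Suc k) (sl k a)) \<le> sqrt C * erate ^ k"
  proof -
    have "(5 / 3) ^ Suc k * energy (sl (Suc k) a) \<le> C"
      using le[of "Suc k"] by (simp only: en_def)
    from energy_bound_increment[OF sl_M good_bdiag[OF A_inf_good[OF a]] this] show ?thesis
      by (simp only: comp_sl)
  qed
qed

text \<open>On \<open>M n\<close> the operator norm is recovered from \<open>n2\<close> by testing with the rank one matrices
  whose first column is a vector \<open>v\<close>.\<close>

lemma norm_iota_le_n2:
  assumes x: "x \<in> M n"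
  shows "norm (\<iota> n x) \<le> norm (\<iota> n x - y) + sqrt (d3 n) * n2 y"
  unfolding norm_iota[OF x]
proof (rule mat_norm_leI)
  show "0 \<le> norm (\<iota> n x - y) + sqrt (d3 n) * n2 y" by simp
  fix v assume "v \<in> carrier_vec (dim_col x)" and v1: "sqnorm v \<le> 1"
  then have v: "v \<in> carrier_vec (d3 n)" using x by auto
  have pos: "d3 n > 0" by (simp add: d3_def)
  \<comment> \<open>The rank one test matrix: its \<open>n2\<close> is at most
    \<open>1 / sqrt (d3 n)\<close>, its operator norm at most 1.\<close>
  define P where "P = mat (d3 n) (d3 n) (\<lambda>(i, j). if j = 0 then v $ i else 0)"
  have P: "P \<in> M n" by (simp add: P_def)
  have colP: "col P j = (if j = 0 then v else 0\<^sub>v (d3 n))" if "j < d3 n" for j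
    using v that by (intro eq_vecI) (auto simp: P_def)
  have sum0: "(\<Sum>j<d3 n. f j) = f 0" if "\<And>j. j < d3 n \<Longrightarrow> j \<noteq> 0 \<Longrightarrow> f j = 0" for f :: "nat \<Rightarrow> real"
    using pos that by (subst sum.remove[of _ 0]) auto
  have sq0: "sqnorm (0\<^sub>v (d3 n)) = 0" by (simp add: sqnorm_def)
  have froP: "fro P = sqnorm v"
    unfolding fro_eq_cols using P sum0[of "\<lambda>j. sqnorm (col P j)"] pos by (simp add: colP sq0)
  have xP: "x * P \<in> M n" by (rule mult_carrier_mat[OF x P])
  have x0: "x *\<^sub>v 0\<^sub>v (d3 n) = 0\<^sub>v (d3 n)"
    using x by (intro eq_vecI) auto
  have colxP: "col (x * P) j = x *\<^sub>v (if j = 0 then v else 0\<^sub>v (d3 n))" if "j < d3 n" for j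
    using x P that col_mult2[OF x P that] by (simp add: colP)
  have "fro (x * P) = (\<Sum>j<d3 n. sqnorm (col (x * P) j))"
    unfolding fro_eq_cols using carrier_matD(2)[OF xP] by simp
  also have "\<dots> = sqnorm (col (x * P) 0)"
    by (rule sum0) (simp only: colxP if_False x0 sq0)
  finally have fro_xP: "fro (x * P) = sqnorm (x *\<^sub>v v)"
    using colxP[OF pos] by simp
  define p where "p = \<iota> n P"
  define N where "N = sqrt (d3 n)"
  have N: "N > 0" using pos by (simp add: N_def)
  have N2: "N\<^sup>2 = d3 n" by (simp add: N_def)
  have n2p: "n2 p \<le> 1 / N"
  proof (rule power2_le_imp_le)
    show "(n2 p)\<^sup>2 \<le> (1 / N)\<^sup>2"
      unfolding p_def n2_iota[OF P] froP power_divide N2 using v1 by (simp add: divide_right_mono)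
  qed (use N in simp)
  have "(norm p)\<^sup>2 \<le> 1\<^sup>2"
    unfolding p_def norm_iota[OF P] using mat_norm_le_fro[of P] v1 froP by simp
  then have np: "norm p \<le> 1" by (rule power2_le_imp_le) simp
  have "n2 (\<iota> n x * p) = sqrt (sqnorm (x *\<^sub>v v)) / N"
  proof -
    have "(n2 (\<iota> n x * p))\<^sup>2 = sqnorm (x *\<^sub>v v) / N\<^sup>2"
      unfolding p_def iota_mult[OF x P, symmetric] n2_iota[OF xP] fro_xP N2 ..
    then have "n2 (\<iota> n x * p) = sqrt (sqnorm (x *\<^sub>v v) / N\<^sup>2)"
      using n2_nonneg real_sqrt_unique by metis
    then show ?thesis using N by (simp add: real_sqrt_divide)
  qed
  \<comment> \<open>p is used with two bounds: \<open>n2 p \<le> 1 / N\<close> against the operator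
    norm of the difference, and \<open>norm p \<le> 1\<close> against \<open>n2 y\<close>. After
    multiplication by N the dimension stays only with \<open>n2 y\<close>.\<close>
  moreover have "n2 (\<iota> n x * p) \<le> n2 ((\<iota> n x - y) * p) + n2 (y * p)"
    using n2_triangle[of "(\<iota> n x - y) * p" "y * p"] by (simp add: algebra_simps)
  moreover have "n2 ((\<iota> n x - y) * p) \<le> norm (\<iota> n x - y) * (1 / N)"
    using n2_mult_le[of "\<iota> n x - y" p] mult_left_mono[OF n2p, of "norm (\<iota> n x - y)"] by simp
  moreover have "n2 (y * p) \<le> n2 y"
    using n2_mult_le'[of y p] mult_right_mono[OF np, of "n2 y"] by simp
  ultimately have "sqrt (sqnorm (x *\<^sub>v v)) / N \<le> norm (\<iota> n x - y) / N + n2 y"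
    by simp
  then have "sqrt (sqnorm (x *\<^sub>v v)) \<le> norm (\<iota> n x - y) + N * n2 y"
    using N by (simp add: field_simps)
  then show "sqnorm (x *\<^sub>v v) \<le> (norm (\<iota> n x - y) + sqrt (d3 n) * n2 y)\<^sup>2"
    using sqrt_le_D unfolding N_def by blast
qed

lemma norm_le_n2: "norm y \<le> 2 * norm (y - \<iota> (Suc m) (sl m y)) + sqrt (d3 (Suc m)) * n2 y"
  using norm_iota_le_n2[OF sl_M, of m y y] norm_triangle_ineq[of "y - \<iota> (Suc m) (sl m y)" "\<iota> (Suc m) (sl m y)"]
  by (simp add: norm_minus_commute)

text \<open>Faithfulness of the trace: if \<open>n2 y\<close> vanishes, the term with the dimension
  factor in \<open>norm_le_n2\<close> disappears and m can tend to infinity.\<close>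

lemma n2_eq_0_iff: "n2 y = 0 \<longleftrightarrow> y = 0"
proof
  assume "n2 y = 0"
  then have "norm y \<le> norm (y - \<iota> (Suc m) (sl m y)) * 2" for m
    using norm_le_n2[of y m] by simp
  moreover have "(\<lambda>m. norm (y - \<iota> (Suc m) (sl m y)) * 2) \<longlonglongrightarrow> norm (y - y) * 2"
    by (intro tendsto_mult_right tendsto_norm tendsto_diff tendsto_const iota_sl_tendsto)
  ultimately have "norm y \<le> norm (y - y) * 2"
    by (intro LIMSEQ_le_const[of "\<lambda>m. norm (y - \<iota> (Suc m) (sl m y)) * 2"]) blast+
  then show "y = 0" by simp
qed (use n2_le_norm[of 0] n2_nonneg[of 0] in simp)

text \<open>Crude continuity at a fixed level: six ordered pairs, each contributing at most the
  dimension times the square of 2 \<open>norm x\<close>, give the 24.\<close>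

lemma en_le_norm: "en m x \<le> (5 / 3) ^ m * (24 * d3 m) * (norm x)\<^sup>2"
proof -
  have c: "comp_at (sl m x) i \<in> M m" for i by (rule comp_at_M[OF sl_M])
  have "fro (comp_at (sl m x) i - comp_at (sl m x) j) \<le> d3 m * (2 * norm x)\<^sup>2" for i j
  proof -
    have "mat_norm (comp_at (sl m x) i) \<le> norm x" for i
      using mat_norm_comp_at_le[of "sl m x" "d3 m" "d3 m" i] sl_M[of m x] norm_sl_le[of m x] by (simp add: d3_Suc)
    then have "norm (\<iota> m (comp_at (sl m x) i) - \<iota> m (comp_at (sl m x) j)) \<le> 2 * norm x"
      using norm_triangle_ineq4[of "\<iota> m (comp_at (sl m x) i)" "\<iota> m (comp_at (sl m x) j)"]
      by (smt (verit) norm_iota[OF c])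
    then have "(mat_norm (comp_at (sl m x) i - comp_at (sl m x) j))\<^sup>2 \<le> (2 * norm x)\<^sup>2"
      unfolding mat_norm_diff_eq[OF c c] by (rule power_mono) simp
    then have "d3 m * (mat_norm (comp_at (sl m x) i - comp_at (sl m x) j))\<^sup>2 \<le> d3 m * (2 * norm x)\<^sup>2"
      by (rule mult_left_mono) simp
    then show ?thesis
      using fro_le_mat_norm[OF minus_carrier_mat[OF c]] order_trans by blast
  qed
  then have "energy (sl m x) \<le> (\<Sum>(i, j)\<in>epairs. d3 m * (2 * norm x)\<^sup>2)"
    unfolding energy_sum_fro[OF sl_M] by (intro sum_mono) auto
  also have "\<dots> = 24 * d3 m * (norm x)\<^sup>2"
    by (simp add: epairs_eq power_mult_distrib)
  finally have "(5 / 3) ^ m * energy (sl m x) \<le> (5 / 3) ^ m * (24 * d3 m * (norm x)\<^sup>2)"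
    by (rule mult_left_mono) simp
  then show ?thesis by (simp add: en_def mult.assoc)
qed

text \<open>For fixed m the root of \<open>en m\<close> is a norm continuous seminorm, so bounds
  pass to norm limits; letting m vary afterwards bounds the full energy.\<close>

lemma en_limit_le:
  assumes f: "f \<longlonglongrightarrow> x" and le: "\<And>l. l \<ge> N \<Longrightarrow> en m (f l) \<le> C"
  shows "en m x \<le> C"
proof -
  define K where "K = (5 / 3) ^ m * (24 * real (d3 m))"
  have C: "0 \<le> C" using le[of N] en_nonneg[of m "f N"] by simp
  have "sqrt (en m x) \<le> sqrt C + sqrt K * norm (x - f l)" if l: "l \<ge> N" for l
  proof -
    have "sqrt (en m x) \<le> sqrt (en m (f l)) + sqrt (en m (x - f l))"
      using hform_triangle[OF hform_ef, of "f l" "x - f l" m] by (simp add: Re_ef)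
    also have "sqrt (en m (f l)) \<le> sqrt C" using le[OF l] by simp
    also have "sqrt (en m (x - f l)) \<le> sqrt (K * (norm (x - f l))\<^sup>2)"
      using en_le_norm[of m "x - f l"] by (simp add: K_def)
    also have "\<dots> = sqrt K * norm (x - f l)" by (simp add: real_sqrt_mult)
    finally show ?thesis by simp
  qed
  moreover have "(\<lambda>l. sqrt C + sqrt K * norm (x - f l)) \<longlonglongrightarrow> sqrt C + sqrt K * norm (x - x)"
    by (intro tendsto_intros f)
  ultimately have "sqrt (en m x) \<le> sqrt C + sqrt K * norm (x - x)"
    by (intro LIMSEQ_le_const[of "\<lambda>l. sqrt C + sqrt K * norm (x - f l)"]) blast+
  then show ?thesis by simp
qed

text \<open>The order of choices matters: m is fixed first, which makes the tail small for all pairs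
  at once; the dimension factor is then a constant, absorbed by the L^2 Cauchy property.\<close>

lemma energy_bounded_L2_Cauchy:
  assumes b: "\<And>k. b k \<in> B_space \<iota>" "\<And>k. En (b k) \<le> C"
    and Cauchy: "\<And>e. e > 0 \<Longrightarrow> \<exists>K. \<forall>i\<ge>K. \<forall>j\<ge>K. n2 (b i - b j) < e"
  obtains a where "b \<longlonglongrightarrow> a" "a \<in> B_space \<iota>" "En a \<le> C"
proof -
  have C: "0 \<le> C" using b(2)[of 0] En_nonneg[OF b(1)[of 0]] by linarith
  \<comment> \<open>Differences have energy at most 2C + 2C; the leading 2 is that of
    \<open>norm_le_n2\<close>.\<close>
  define D where "D = 2 * (sqrt (4 * C) / (1 - erate))"
  have bound: "norm (b i - b j) \<le> D * erate ^ m + sqrt (d3 (Suc m)) * n2 (b i - b j)" for i j m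
  proof -
    have "en m (b i - b j) \<le> 4 * C" for m
      using en_diff_le[of m "b i" "b j"] en_le_En[OF b(1)[of i], of m] en_le_En[OF b(1)[of j], of m] b(2)[of i] b(2)[of j]
      by linarith
    then have "norm (b i - b j - \<iota> (Suc m) (sl m (b i - b j))) \<le> sqrt (4 * C) * erate ^ m / (1 - erate)"
      by (intro norm_minus_sl_le A_infD(6) B_space_A_inf b)
    then show ?thesis
      using norm_le_n2[of "b i - b j" m] by (simp add: D_def)
  qed
  have "Cauchy b"
  proof (rule CauchyI)
    fix e :: real assume e: "e > 0"
    have "(\<lambda>m. D * erate ^ m) \<longlonglongrightarrow> D * 0"
      using erate by (intro tendsto_mult_left LIMSEQ_power_zero) simp
    then obtain m where m: "norm (D * erate ^ m - D * 0) < e / 2"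
      using LIMSEQ_D[of "\<lambda>m. D * erate ^ m" "D * 0" "e / 2"] e by auto
    have pos: "sqrt (d3 (Suc m)) > 0" by (simp add: d3_def)
    then obtain K where K: "\<And>i j. i \<ge> K \<Longrightarrow> j \<ge> K \<Longrightarrow> n2 (b i - b j) < e / 2 / sqrt (d3 (Suc m))"
      using Cauchy[of "e / 2 / sqrt (d3 (Suc m))"] e by auto
    show "\<exists>M. \<forall>i\<ge>M. \<forall>j\<ge>M. norm (b i - b j) < e"
    proof (intro exI allI impI)
      fix i j assume ij: "i \<ge> K" "j \<ge> K"
      have "n2 (b i - b j) * sqrt (d3 (Suc m)) < e / 2"
        using K[OF ij] unfolding pos_less_divide_eq[OF pos] .
      then have "sqrt (d3 (Suc m)) * n2 (b i - b j) < e / 2"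
        by (simp only: mult.commute)
      then show "norm (b i - b j) < e"
        using bound[of i j m] m by (simp add: abs_less_iff)
    qed
  qed
  then obtain a where a: "b \<longlonglongrightarrow> a"
    using Cauchy_convergent convergent_def by blast
  have aA: "a \<in> A_inf \<iota>"
    by (rule closed_sequentially[OF A_infD(1) _ a]) (rule B_space_A_inf[OF b(1)])
  have le: "en m a \<le> C" for m
    by (rule en_limit_le[OF a]) (rule order_trans[OF en_le_En[OF b(1)] b(2)])
  have aB: "a \<in> B_space \<iota>" by (rule B_spaceI[OF aA le])
  show ?thesis
    by (rule that[OF a aB]) (use En_le_iff[OF aB] le in blast)
qed

lemma B_norm_eq: "b \<in> B_space \<iota> \<Longrightarrow> B_norm \<iota> b = sqrt ((n2 b)\<^sup>2 + En b)"
  by (simp add: B_norm_def n2_square En_def)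

lemma hform_B: "hform (B_space \<iota>) (\<lambda>a b. tr (adj a * b) + lim (\<lambda>m. ef m a b))"
  by (rule hform_add[OF hform_subset[OF hform_tr zero_B B_add B_scaleC] hform_energy])

lemma B_norm_hform:
  assumes "b \<in> B_space \<iota>"
  shows "B_norm \<iota> b = sqrt (Re (tr (adj b * b) + lim (\<lambda>m. ef m b b)))"
  by (simp add: B_norm_eq[OF assms] Re_lim_ef[OF assms] n2_square)

lemma B_norm_triangle:
  assumes "a \<in> B_space \<iota>" "b \<in> B_space \<iota>"
  shows "B_norm \<iota> (a + b) \<le> B_norm \<iota> a + B_norm \<iota> b"
  using hform_triangle[OF hform_B assms] by (simp add: B_norm_hform assms B_add)

lemma n2_le_B_norm: "b \<in> B_space \<iota> \<Longrightarrow> n2 b \<le> B_norm \<iota> b"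
  unfolding B_norm_eq by (rule real_le_rsqrt) (simp add: En_nonneg)

lemma En_le_B_norm: "b \<in> B_space \<iota> \<Longrightarrow> En b \<le> (B_norm \<iota> b)\<^sup>2"
  unfolding B_norm_eq by (subst real_sqrt_pow2) (auto simp: En_nonneg)

lemma B_norm_nonneg: "b \<in> B_space \<iota> \<Longrightarrow> 0 \<le> B_norm \<iota> b"
  by (simp add: B_norm_eq En_nonneg)

lemma is_norm_on_B: "is_norm_on (B_space \<iota>) (B_norm \<iota>)"
  unfolding is_norm_on_def
proof (intro conjI ballI allI)
  fix x c assume x: "x \<in> B_space \<iota>"
  show "0 \<le> B_norm \<iota> x" by (rule B_norm_nonneg[OF x])
  show "B_norm \<iota> (c *\<^sub>C x) = cmod c * B_norm \<iota> x"
    unfolding B_norm_hform[OF x] B_norm_hform[OF B_scaleC[OF x]] hform_scale[OF hform_B x] by (simp add: real_sqrt_mult)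
  show "B_norm \<iota> x = 0 \<longleftrightarrow> x = 0"
  proof
    assume "B_norm \<iota> x = 0"
    then have "n2 x = 0" using n2_le_B_norm[OF x] n2_nonneg[of x] by linarith
    then show "x = 0" by (simp add: n2_eq_0_iff)
  next
    assume x0: "x = 0"
    have "B_norm \<iota> (0 *\<^sub>C x) = cmod 0 * B_norm \<iota> x"
      unfolding B_norm_hform[OF x] B_norm_hform[OF B_scaleC[OF x]] hform_scale[OF hform_B x] by simp
    then show "B_norm \<iota> x = 0" using x0 by simp
  qed
next
  fix x y assume "x \<in> B_space \<iota>" "y \<in> B_space \<iota>"
  then show "B_norm \<iota> (x + y) \<le> B_norm \<iota> x + B_norm \<iota> y" by (rule B_norm_triangle)
qed

lemma complete_B: "complete_for (B_space \<iota>) (B_norm \<iota>)"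
  unfolding complete_for_def
proof (intro allI impI)
  fix X :: "nat \<Rightarrow> 'u" assume "\<forall>n. X n \<in> B_space \<iota>" and Cauchy: "\<forall>e>0. \<exists>K. \<forall>m\<ge>K. \<forall>n\<ge>K. B_norm \<iota> (X m - X n) < e"
  then have X: "X n \<in> B_space \<iota>" for n by blast
  obtain K where K: "\<And>m n. m \<ge> K \<Longrightarrow> n \<ge> K \<Longrightarrow> B_norm \<iota> (X m - X n) < 1"
    using Cauchy[rule_format, of 1] by auto
  \<comment> \<open>The Cauchy property bounds the norms, hence the energies, of all terms from K
    on.\<close>
  define C where "C = (1 + B_norm \<iota> (X K))\<^sup>2"
  have En_C: "En (X (n + K)) \<le> C" for n
  proof -
    have "B_norm \<iota> (X (n + K)) \<le> 1 + B_norm \<iota> (X K)"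
      using B_norm_triangle[OF B_diff[OF X X] X, of "n + K" K K] K[of "n + K" K] by simp
    then have "(B_norm \<iota> (X (n + K)))\<^sup>2 \<le> C"
      unfolding C_def using B_norm_nonneg[OF X] by (rule power_mono)
    then show ?thesis using En_le_B_norm[OF X] order_trans by blast
  qed
  have n2_Cauchy: "\<exists>N. \<forall>i\<ge>N. \<forall>j\<ge>N. n2 (X (i + K) - X (j + K)) < e" if e: "e > 0" for e
  proof -
    obtain N where "\<And>m n. m \<ge> N \<Longrightarrow> n \<ge> N \<Longrightarrow> B_norm \<iota> (X m - X n) < e"
      using Cauchy e by blast
    then show ?thesis
      using n2_le_B_norm[OF B_diff[OF X X]] by (meson le_add1 le_less_trans le_trans)
  qed
  obtain a where a: "(\<lambda>n. X (n + K)) \<longlonglongrightarrow> a" "a \<in> B_space \<iota>"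
    using energy_bounded_L2_Cauchy[of "\<lambda>n. X (n + K)" C, OF X En_C n2_Cauchy] by metis
  have lim: "X \<longlonglongrightarrow> a" by (rule LIMSEQ_offset[OF a(1)])
  \<comment> \<open>For fixed n and m let l tend to infinity in \<open>en m (X n - X l)\<close>,
    then use that the bound holds for all m.\<close>
  have En_lim: "(\<lambda>n. En (X n - a)) \<longlonglongrightarrow> 0"
  proof (rule LIMSEQ_I)
    fix e :: real assume e: "e > 0"
    then obtain N where N: "\<And>m n. m \<ge> N \<Longrightarrow> n \<ge> N \<Longrightarrow> B_norm \<iota> (X m - X n) < sqrt (e / 2)"
      using Cauchy[rule_format, of "sqrt (e / 2)"] by auto
    show "\<exists>N. \<forall>n\<ge>N. norm (En (X n - a) - 0) < e"
    proof (intro exI allI impI)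
      fix n assume n: "n \<ge> N"
      have XB: "X n - a \<in> B_space \<iota>" by (rule B_diff[OF X a(2)])
      have "en m (X n - a) \<le> e / 2" for m
      proof (rule en_limit_le)
        show "(\<lambda>l. X n - X l) \<longlonglongrightarrow> X n - a" by (intro tendsto_intros lim)
        fix l assume l: "l \<ge> N"
        have "(B_norm \<iota> (X n - X l))\<^sup>2 \<le> (sqrt (e / 2))\<^sup>2"
          using N[OF n l] B_norm_nonneg[OF B_diff[OF X X]] by (intro power_mono) auto
        then have "En (X n - X l) \<le> e / 2"
          using En_le_B_norm[OF B_diff[OF X X], of n l] e by simp
        then show "en m (X n - X l) \<le> e / 2"
          using en_le_En[OF B_diff[OF X X], of m n l] by linarith
      qed
      then have "En (X n - a) \<le> e / 2" using En_le_iff[OF XB] by blast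
      then show "norm (En (X n - a) - 0) < e" using En_nonneg[OF XB] e by simp
    qed
  qed
  have "(\<lambda>n. n2 (X n - a)) \<longlonglongrightarrow> 0"
    by (rule tendsto_zero_bound[OF LIM_zero[OF lim], of _ 1]) (simp add: n2_le_norm)
  then have "(\<lambda>n. sqrt ((n2 (X n - a))\<^sup>2 + En (X n - a))) \<longlonglongrightarrow> sqrt (0\<^sup>2 + 0)"
    by (intro tendsto_intros En_lim)
  then have "(\<lambda>n. B_norm \<iota> (X n - a)) \<longlonglongrightarrow> 0"
    by (simp add: B_norm_eq[OF B_diff[OF X a(2)]])
  then show "\<exists>x\<in>B_space \<iota>. (\<lambda>n. B_norm \<iota> (X n - x)) \<longlonglongrightarrow> 0"
    using a(2) by blast
qed

section \<open>Density of the finite energy elements\<close>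

lemma n2_tendsto:
  assumes "f \<longlonglongrightarrow> a"
  shows "(\<lambda>k. n2 (f k)) \<longlonglongrightarrow> n2 a"
  unfolding n2_def
  by (intro tendsto_real_sqrt tendsto_Re tr_tendsto tendsto_mult bounded_linear.tendsto[OF bounded_linear_adj] assms)

text \<open>The approximating element is the harmonic extension of \<open>sl m a\<close>.\<close>

lemma harmonic_approximation:
  assumes a: "a \<in> A_inf \<iota>"
  obtains b where "b \<in> B_space \<iota>"
    "n2 (b - \<iota> (Suc m) (sl m a)) \<le> sqrt (energy (sl m a) / d3 (Suc m)) / (1 - erate)"
proof -
  have "\<exists>b'. good n b \<longrightarrow> good (Suc n) b' \<and> comp_at b' 2 = b \<and> energy b' = 3 / 5 * energy b" for n b
    using harmonic_extension by metis
  then obtain ext where ext: "\<And>n b. good n b \<Longrightarrow>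
      good (Suc n) (ext n b) \<and> comp_at (ext n b) 2 = b \<and> energy (ext n b) = 3 / 5 * energy b"
    by metis
  define h where "h = rec_nat (sl m a) (\<lambda>k. ext (m + k))"
  have h0: "h 0 = sl m a" and hS: "h (Suc k) = ext (m + k) (h k)" for k by (simp_all add: h_def)
  have hg: "good (m + k) (h k)" for k
  proof (induction k)
    case (Suc k)
    then show ?case using ext[OF Suc] by (simp add: hS del: good.simps)
  qed (simp add: h0 A_inf_good[OF a])
  have hc: "comp_at (h (Suc k)) 2 = h k" for k
    using ext[OF hg[of k]] by (simp add: hS)
  have he: "energy (h k) = (3 / 5) ^ k * energy (sl m a)" for k
  proof (induction k)
    case (Suc k)
    then show ?case using ext[OF hg[of k]] by (simp add: hS)
  qed (simp add: h0)
  define C where "C = en m a"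
  \<comment> \<open>Slices of a below level m and harmonic extensions from m on form one tower
    compatible at all levels.\<close>
  define b where "b n = (if n < m then sl n a else h (n - m))" for n
  have bg: "good n (b n)" for n
    using hg[of "n - m"] A_inf_good[OF a] by (auto simp: b_def)
  have bc: "comp_at (b (Suc n)) 2 = b n" for n
  proof -
    consider "Suc n < m" | "Suc n = m" | "Suc n > m" by linarith
    then show ?thesis
    proof cases
      case 2
      then have "b (Suc n) = sl (Suc n) a" by (simp add: b_def h0)
      then show ?thesis using 2 comp_sl[of n a] by (simp add: b_def)
    next
      case 3
      then have "Suc n - m = Suc (n - m)" by simp
      then show ?thesis using 3 hc by (simp add: b_def)
    qed (simp add: b_def comp_sl)
  qed
  \<comment> \<open>Below m this is monotonicity; from m on the factors 5/3 and 3/5 cancel and the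
    rescaled energy stays constant.\<close>
  have be: "(5 / 3) ^ n * energy (b n) \<le> C" for n
  proof (cases "n < m")
    case True
    then show ?thesis
      using incseqD[OF incseq_en[OF a], of n m] by (simp add: b_def C_def en_def)
  next
    case False
    have "(5 / 3) ^ n * (3 / 5) ^ (n - m) = (5 / 3) ^ m * ((5 / 3) ^ (n - m) * (3 / 5) ^ (n - m) :: real)"
      using False by (simp add: power_add[symmetric] mult.assoc[symmetric])
    also have "\<dots> = (5 / 3) ^ m" by (simp add: power_mult_distrib[symmetric])
    finally show ?thesis
      using False he[of "n - m"] by (simp add: b_def C_def en_def mult.assoc[symmetric])
  qed
  obtain x where x: "(\<lambda>n. \<iota> (Suc n) (b n)) \<longlonglongrightarrow> x" "x \<in> B_space \<iota>"
    using energy_bounded_compatible[OF bg bc be] by metis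
  define u where "u k = \<iota> (Suc (m + k)) (h k)" for k
  have ulim: "u \<longlonglongrightarrow> x"
    using LIMSEQ_ignore_initial_segment[OF x(1), of m] by (simp add: u_def[abs_def] b_def add.commute)
  define Q where "Q = sqrt (energy (sl m a) / d3 (Suc m))"
  have e0: "0 \<le> energy (sl m a)" by (rule energy_nonneg[OF sl_M])
  have Q0: "0 \<le> Q" by (simp add: Q_def e0)
  have step: "n2 (u (Suc k) - u k) \<le> Q * erate ^ k" for k
  proof (rule power2_le_imp_le)
    have "(n2 (u (Suc k) - u k))\<^sup>2 \<le> energy (h (Suc k)) / d3 (Suc (Suc (m + k)))"
      using norm_increment(2)[OF good_carrier good_bdiag, of "m + k" "h (Suc k)"] hg[of "Suc k"]
      by (simp add: u_def hc del: good.simps)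
    also have "\<dots> \<le> (3 / 5) ^ k * energy (sl m a) / d3 (Suc m)"
    proof (rule frac_le)
      show "energy (h (Suc k)) \<le> (3 / 5) ^ k * energy (sl m a)"
        unfolding he using e0 by (intro mult_right_mono) auto
      show "real (d3 (Suc m)) \<le> real (d3 (Suc (Suc (m + k))))"
        unfolding d3_def of_nat_power by (intro power_increasing) auto
    qed (use e0 in \<open>auto simp: d3_def\<close>)
    also have "\<dots> = (Q * erate ^ k)\<^sup>2"
      using e0 by (simp add: Q_def power_mult_distrib erate_power2)
    finally show "(n2 (u (Suc k) - u k))\<^sup>2 \<le> (Q * erate ^ k)\<^sup>2" .
    show "0 \<le> Q * erate ^ k" using Q0 erate by simp
  qed
  have "n2 (u k - u 0) \<le> Q * (\<Sum>i<k. erate ^ i)" for k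
  proof (induction k)
    case 0
    show ?case using n2_eq_0_iff[of 0] by simp
  next
    case (Suc k)
    then show ?case
      using n2_triangle[of "u (Suc k) - u k" "u k - u 0"] step[of k] by (simp add: algebra_simps)
  qed
  moreover have "(\<Sum>i<k. erate ^ i) \<le> 1 / (1 - erate)" for k
  proof -
    have "(\<Sum>i<k. erate ^ i) = (1 - erate ^ k) / (1 - erate)"
      using erate by (simp add: sum_gp_strict)
    also have "\<dots> \<le> 1 / (1 - erate)"
      using erate by (intro divide_right_mono) auto
    finally show ?thesis .
  qed
  ultimately have "n2 (u k - u 0) \<le> Q * (1 / (1 - erate))" for k
    using Q0 mult_left_mono order_trans by metis
  moreover have "(\<lambda>k. n2 (u k - u 0)) \<longlonglongrightarrow> n2 (x - u 0)"
    by (intro n2_tendsto tendsto_intros ulim)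
  ultimately have "n2 (x - u 0) \<le> Q / (1 - erate)"
    by (intro LIMSEQ_le_const2[of "\<lambda>k. n2 (u k - u 0)"]) auto
  then show ?thesis
    using that[OF x(2)] by (simp add: u_def h0 Q_def)
qed

text \<open>The energy of a slice is at most 8 times its dimension times the squared L^2 norm of the
  last increment. Divided by that dimension it bounds the error of the harmonic extension by the
  norm of an increment, which tends to 0 because the slices converge.\<close>

lemma B_space_L2_dense:
  assumes a: "a \<in> A_inf \<iota>" and e: "e > 0"
  obtains b where "b \<in> B_space \<iota>" "n2 (b - a) < e"
proof -
  define d where "d m = \<iota> (Suc (Suc m)) (sl (Suc m) a) - \<iota> (Suc m) (sl m a)" for m
  have "d \<longlonglongrightarrow> a - a"
    unfolding d_def by (intro tendsto_diff iota_sl_tendsto LIMSEQ_Suc[OF iota_sl_tendsto])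
  then have "(\<lambda>m. sqrt 8 * norm (d m) / (1 - erate) + norm (\<iota> (Suc (Suc m)) (sl (Suc m) a) - a))
      \<longlonglongrightarrow> sqrt 8 * norm (a - a) / (1 - erate) + norm (a - a)"
    using erate by (intro tendsto_intros LIMSEQ_Suc[OF iota_sl_tendsto]) auto
  then have "(\<lambda>m. sqrt 8 * norm (d m) / (1 - erate) + norm (\<iota> (Suc (Suc m)) (sl (Suc m) a) - a)) \<longlonglongrightarrow> 0"
    by simp
  from LIMSEQ_D[OF this e] obtain m where
    m: "norm (sqrt 8 * norm (d m) / (1 - erate) + norm (\<iota> (Suc (Suc m)) (sl (Suc m) a) - a) - 0) < e"
    by blast
  obtain b where b: "b \<in> B_space \<iota>"
    "n2 (b - \<iota> (Suc (Suc m)) (sl (Suc m) a)) \<le> sqrt (energy (sl (Suc m) a) / d3 (Suc (Suc m))) / (1 - erate)"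
    using harmonic_approximation[OF a] by blast
  have pos: "d3 (Suc (Suc m)) > 0" by (simp add: d3_def)
  have "energy (sl (Suc m) a) / d3 (Suc (Suc m)) \<le> 8 * (n2 (d m))\<^sup>2"
    using norm_increment(3)[OF sl_M good_bdiag[OF A_inf_good[OF a]], of m] pos
    by (simp add: d_def comp_sl divide_le_eq mult_ac)
  also have "\<dots> \<le> 8 * (norm (d m))\<^sup>2"
    using n2_le_norm[of "d m"] by (intro mult_left_mono power_mono) auto
  finally have "sqrt (energy (sl (Suc m) a) / d3 (Suc (Suc m))) \<le> sqrt (8 * (norm (d m))\<^sup>2)"
    by simp
  then have "sqrt (energy (sl (Suc m) a) / d3 (Suc (Suc m))) / (1 - erate) \<le> sqrt 8 * norm (d m) / (1 - erate)"
    using erate by (intro divide_right_mono) (auto simp: real_sqrt_mult)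
  then have "n2 (b - a) < e"
    using b(2) m n2_triangle[of "b - \<iota> (Suc (Suc m)) (sl (Suc m) a)" "\<iota> (Suc (Suc m)) (sl (Suc m) a) - a"]
      n2_le_norm[of "\<iota> (Suc (Suc m)) (sl (Suc m) a) - a"] by simp
  then show ?thesis using that b(1) by blast
qed

end

section \<open>The Dirichlet form\<close>

locale uhf3_gns = uhf3 \<iota> for \<iota> :: "nat \<Rightarrow> complex mat \<Rightarrow> 'u::cstar_algebra_1" +
  fixes \<Lambda> :: "'u \<Rightarrow> 'h::complex_hilbert"
  assumes gns: "is_gns (A_inf \<iota>) (uhf_trace \<iota>) \<Lambda>"
begin

section \<open>The GNS embedding and the adjoint on the Hilbert space\<close>

abbreviation J :: "'h \<Rightarrow> 'h" where
  "J \<xi> \<equiv> L2_adj (A_inf \<iota>) \<Lambda> \<xi>"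

abbreviation F :: "'h \<Rightarrow> ereal" where
  "F \<xi> \<equiv> energy_L2 \<iota> \<Lambda> \<xi>"

lemma Lambda:
  assumes "a \<in> A_inf \<iota>"
  shows Lambda_add: "b \<in> A_inf \<iota> \<Longrightarrow> \<Lambda> (a + b) = \<Lambda> a + \<Lambda> b"
    and Lambda_scaleC: "\<Lambda> (c *\<^sub>C a) = c *\<^sub>C \<Lambda> a"
    and cinner_Lambda: "b \<in> A_inf \<iota> \<Longrightarrow> cinner (\<Lambda> a) (\<Lambda> b) = tr (adj a * b)"
  using gns assms unfolding is_gns_def by simp_all

lemma closure_Lambda: "closure (\<Lambda> ` A_inf \<iota>) = UNIV"
  using gns unfolding is_gns_def by simp

lemma Lambda_diff: "a \<in> A_inf \<iota> \<Longrightarrow> b \<in> A_inf \<iota> \<Longrightarrow> \<Lambda> (a - b) = \<Lambda> a - \<Lambda> b"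
  unfolding minus_eq_scaleC[of a b] minus_eq_scaleC[of "\<Lambda> a" "\<Lambda> b"]
  by (simp only: Lambda_add Lambda_scaleC A_infD(7))

lemma inner_Lambda: "a \<in> A_inf \<iota> \<Longrightarrow> b \<in> A_inf \<iota> \<Longrightarrow> inner (\<Lambda> a) (\<Lambda> b) = Re (tr (adj a * b))"
  by (simp add: inner_eq_Re_cinner cinner_Lambda)

lemma norm_Lambda: "a \<in> A_inf \<iota> \<Longrightarrow> norm (\<Lambda> a) = n2 a"
  by (simp add: norm_eq_sqrt_inner inner_Lambda n2_def)

lemma norm_Lambda_diff: "a \<in> A_inf \<iota> \<Longrightarrow> b \<in> A_inf \<iota> \<Longrightarrow> norm (\<Lambda> a - \<Lambda> b) = n2 (a - b)"
  using norm_Lambda[OF A_infD(6)] by (simp add: Lambda_diff)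

lemma Lambda_inject: "a \<in> A_inf \<iota> \<Longrightarrow> b \<in> A_inf \<iota> \<Longrightarrow> \<Lambda> a = \<Lambda> b \<longleftrightarrow> a = b"
  using norm_Lambda_diff[of a b] n2_eq_0_iff[of "a - b"] by auto

lemma Lambda_tendsto:
  assumes "\<And>n. x n \<in> A_inf \<iota>" "a \<in> A_inf \<iota>" "x \<longlonglongrightarrow> a"
  shows "(\<lambda>n. \<Lambda> (x n)) \<longlonglongrightarrow> \<Lambda> a"
proof -
  have "(\<lambda>n. \<Lambda> (x n) - \<Lambda> a) \<longlonglongrightarrow> 0"
    by (rule tendsto_zero_bound[OF LIM_zero[OF assms(3)], of _ 1]) (simp add: norm_Lambda_diff assms n2_le_norm)
  then show ?thesis by (rule LIM_zero_cancel)
qed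

lemma Lambda_approx:
  obtains x where "\<And>n. x n \<in> A_inf \<iota>" "(\<lambda>n. \<Lambda> (x n)) \<longlonglongrightarrow> \<xi>"
proof -
  have "\<xi> \<in> closure (\<Lambda> ` A_inf \<iota>)" using closure_Lambda by simp
  then obtain y where y: "\<And>n. y n \<in> \<Lambda> ` A_inf \<iota>" "y \<longlonglongrightarrow> \<xi>"
    unfolding closure_sequential by blast
  have "\<exists>a. a \<in> A_inf \<iota> \<and> \<Lambda> a = y n" for n
    using y(1)[of n] by (elim imageE) auto
  then obtain x where "\<And>n. x n \<in> A_inf \<iota>" "\<And>n. \<Lambda> (x n) = y n" by metis
  with y(2) show ?thesis using that[of x] by simp
qed

lemma norm_Lambda_adj_diff:
  assumes "a \<in> A_inf \<iota>" "b \<in> A_inf \<iota>"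
  shows "norm (\<Lambda> (adj a) - \<Lambda> (adj b)) = norm (\<Lambda> a - \<Lambda> b)"
  using norm_Lambda_diff[OF A_infD(9) A_infD(9), OF assms] norm_Lambda_diff[OF assms]
  by (simp add: adj_diff[symmetric] n2_adj)

text \<open>The trace property makes the adjoint isometric for \<open>n2\<close>, so it maps Cauchy
  sequences to Cauchy sequences and equivalent ones to the same limit. This justifies the definite
  description in \<open>L2_adj\<close>.\<close>

lemma J_tendsto:
  assumes x: "\<And>n. x n \<in> A_inf \<iota>" "(\<lambda>n. \<Lambda> (x n)) \<longlonglongrightarrow> \<xi>"
  shows "(\<lambda>n. \<Lambda> (adj (x n))) \<longlonglongrightarrow> J \<xi>"
proof -
  have "Cauchy (\<lambda>n. \<Lambda> (x n))"
    using x(2) by (intro LIMSEQ_imp_Cauchy)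
  then have "Cauchy (\<lambda>n. \<Lambda> (adj (x n)))"
    by (simp add: Cauchy_iff norm_Lambda_adj_diff x(1))
  then obtain \<eta> where \<eta>: "(\<lambda>n. \<Lambda> (adj (x n))) \<longlonglongrightarrow> \<eta>"
    using Cauchy_convergent convergent_def by blast
  have all: "(\<lambda>n. \<Lambda> (adj (y n))) \<longlonglongrightarrow> \<eta>" if y: "\<And>n. y n \<in> A_inf \<iota>" "(\<lambda>n. \<Lambda> (y n)) \<longlonglongrightarrow> \<xi>" for y
  proof -
    have "(\<lambda>n. \<Lambda> (y n) - \<Lambda> (x n)) \<longlonglongrightarrow> 0"
      using tendsto_diff[OF y(2) x(2)] by simp
    then have "(\<lambda>n. \<Lambda> (adj (y n)) - \<Lambda> (adj (x n))) \<longlonglongrightarrow> 0"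
      by (rule tendsto_zero_bound[of _ _ 1]) (simp add: norm_Lambda_adj_diff x(1) y(1))
    from tendsto_add[OF this \<eta>] show ?thesis by simp
  qed
  have "J \<xi> = \<eta>"
    unfolding L2_adj_def
  proof (rule the_equality)
    show "\<forall>x. (\<forall>n. x n \<in> A_inf \<iota>) \<longrightarrow> (\<lambda>n. \<Lambda> (x n)) \<longlonglongrightarrow> \<xi> \<longrightarrow> (\<lambda>n. \<Lambda> (adj (x n))) \<longlonglongrightarrow> \<eta>"
      using all by blast
    fix \<eta>' assume "\<forall>x. (\<forall>n. x n \<in> A_inf \<iota>) \<longrightarrow> (\<lambda>n. \<Lambda> (x n)) \<longlonglongrightarrow> \<xi> \<longrightarrow> (\<lambda>n. \<Lambda> (adj (x n))) \<longlonglongrightarrow> \<eta>'"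
    then have "(\<lambda>n. \<Lambda> (adj (x n))) \<longlonglongrightarrow> \<eta>'" using x by blast
    then show "\<eta>' = \<eta>" by (rule LIMSEQ_unique[OF _ \<eta>])
  qed
  then show ?thesis using \<eta> by simp
qed

lemma J_Lambda: "a \<in> A_inf \<iota> \<Longrightarrow> J (\<Lambda> a) = \<Lambda> (adj a)"
  using J_tendsto[of "\<lambda>_. a" "\<Lambda> a"] by (simp add: LIMSEQ_const_iff)

lemma J_J: "J (J \<xi>) = \<xi>"
proof -
  obtain x where x: "\<And>n. x n \<in> A_inf \<iota>" "(\<lambda>n. \<Lambda> (x n)) \<longlonglongrightarrow> \<xi>" using Lambda_approx by metis
  have "(\<lambda>n. \<Lambda> (adj (adj (x n)))) \<longlonglongrightarrow> J (J \<xi>)"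
    by (rule J_tendsto[OF A_infD(9)[OF x(1)] J_tendsto[OF x]])
  then show ?thesis
    using LIMSEQ_unique x(2) unfolding adj_adj by blast
qed

lemma F_Lambda:
  assumes "b \<in> B_space \<iota>"
  shows "F (\<Lambda> b) = energy_inf \<iota> b"
proof -
  have "(THE b'. b' \<in> A_inf \<iota> \<and> \<Lambda> b' = \<Lambda> b) = b"
    using B_space_A_inf[OF assms] Lambda_inject by (intro the_equality) auto
  then show ?thesis
    using assms by (simp add: energy_L2_def)
qed

lemma F_infinity: "\<xi> \<notin> \<Lambda> ` B_space \<iota> \<Longrightarrow> F \<xi> = \<infinity>"
  by (simp add: energy_L2_def)

lemma form_domain_F: "form_domain F = \<Lambda> ` B_space \<iota>"
proof -
  have "F (\<Lambda> b) < \<infinity>" if "b \<in> B_space \<iota>" for b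
    using that by (simp add: F_Lambda energy_inf_En)
  moreover have "\<xi> \<in> \<Lambda> ` B_space \<iota>" if "F \<xi> < \<infinity>" for \<xi>
    using that F_infinity[of \<xi>] by auto
  ultimately show ?thesis
    unfolding form_domain_def by blast
qed

lemma closure_form_domain: "closure (form_domain F) = UNIV"
proof -
  have "\<Lambda> a \<in> closure (\<Lambda> ` B_space \<iota>)" if a: "a \<in> A_inf \<iota>" for a
    unfolding closure_approachable
  proof (intro allI impI)
    fix e :: real assume "e > 0"
    then obtain b where b: "b \<in> B_space \<iota>" "n2 (b - a) < e" by (rule B_space_L2_dense[OF a])
    then have "dist (\<Lambda> b) (\<Lambda> a) < e"
      by (simp add: dist_norm norm_Lambda_diff[OF B_space_A_inf a])
    then show "\<exists>y\<in>\<Lambda> ` B_space \<iota>. dist y (\<Lambda> a) < e" using b(1) by blast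
  qed
  then have "closure (\<Lambda> ` A_inf \<iota>) \<subseteq> closure (\<Lambda> ` B_space \<iota>)"
    by (intro closure_minimal) auto
  then show ?thesis
    by (simp add: closure_Lambda form_domain_F top.extremum_unique)
qed

lemma F_nonneg: "0 \<le> F \<xi>"
proof (cases "\<xi> \<in> \<Lambda> ` B_space \<iota>")
  case True
  then obtain b where "b \<in> B_space \<iota>" "\<xi> = \<Lambda> b" by blast
  then show ?thesis by (simp add: F_Lambda energy_inf_nonneg B_space_A_inf)
qed (simp add: F_infinity)

lemma quadratic_F: "is_quadratic_form F"
proof -
  \<comment> \<open>The embedding is injective on \<open>B_space\<close>, so the limit form is
    transported along its inverse.\<close>
  define g where "g = inv_into (B_space \<iota>) \<Lambda>"
  have inj: "inj_on \<Lambda> (B_space \<iota>)"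
    by (rule inj_onI) (simp add: Lambda_inject B_space_A_inf)
  have g: "g (\<Lambda> b) = b" if "b \<in> B_space \<iota>" for b
    unfolding g_def by (rule inv_into_f_f[OF inj that])
  define S where "S \<xi> \<eta> = lim (\<lambda>m. ef m (g \<xi>) (g \<eta>))" for \<xi> \<eta>
  note d = hformD[OF hform_energy]
  note L = Lambda_add[OF B_space_A_inf B_space_A_inf, symmetric] Lambda_scaleC[OF B_space_A_inf, symmetric]
  have S: "S (\<Lambda> a) (\<Lambda> b) = lim (\<lambda>m. ef m a b)" if "a \<in> B_space \<iota>" "b \<in> B_space \<iota>" for a b
    by (simp add: S_def g that)
  have "\<Lambda> (0 *\<^sub>C 0) = 0 *\<^sub>C \<Lambda> 0"
    by (rule Lambda_scaleC[OF B_space_A_inf[OF zero_B]])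
  then have L0: "\<Lambda> 0 = 0"
    using scaleC_of_real[of 0 "\<Lambda> 0"] scaleC_of_real[of 0 "0::'u"] by simp
  show ?thesis
    unfolding is_quadratic_form_def Let_def form_domain_F
  proof (intro conjI exI[of _ S])
    show "0 \<in> \<Lambda> ` B_space \<iota>" using zero_B L0 by (metis imageI)
    show "\<forall>\<xi>\<in>\<Lambda> ` B_space \<iota>. \<forall>\<eta>\<in>\<Lambda> ` B_space \<iota>. \<xi> + \<eta> \<in> \<Lambda> ` B_space \<iota>"
      by (auto simp: L intro!: imageI B_add)
    show "\<forall>c. \<forall>\<xi>\<in>\<Lambda> ` B_space \<iota>. c *\<^sub>C \<xi> \<in> \<Lambda> ` B_space \<iota>"
      by (auto simp: L intro!: imageI B_scaleC)
    show "\<forall>\<xi>\<in>\<Lambda> ` B_space \<iota>. \<forall>\<eta>\<in>\<Lambda> ` B_space \<iota>. \<forall>\<zeta>\<in>\<Lambda> ` B_space \<iota>. S \<xi> (\<eta> + \<zeta>) = S \<xi> \<eta> + S \<xi> \<zeta>"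
      by (auto simp: L S d(4) B_add)
    show "\<forall>c. \<forall>\<xi>\<in>\<Lambda> ` B_space \<iota>. \<forall>\<eta>\<in>\<Lambda> ` B_space \<iota>. S \<xi> (c *\<^sub>C \<eta>) = c * S \<xi> \<eta>"
      by (auto simp: L S d(5) B_scaleC)
    have "S (\<Lambda> y) (\<Lambda> x) = cnj (S (\<Lambda> x) (\<Lambda> y))" if "x \<in> B_space \<iota>" "y \<in> B_space \<iota>" for x y
      unfolding S[OF that] S[OF that(2,1)] by (rule d(6)[OF that])
    then show "\<forall>\<xi>\<in>\<Lambda> ` B_space \<iota>. \<forall>\<eta>\<in>\<Lambda> ` B_space \<iota>. S \<eta> \<xi> = cnj (S \<xi> \<eta>)"
      by blast
    show "\<forall>\<xi>\<in>\<Lambda> ` B_space \<iota>. F \<xi> = ereal (Re (S \<xi> \<xi>))"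
      by (auto simp: S F_Lambda energy_inf_En Re_lim_ef)
  qed
qed

lemma F_J: "F (J \<xi>) = F \<xi>"
proof (cases "\<xi> \<in> \<Lambda> ` B_space \<iota>")
  case True
  then obtain b where b: "b \<in> B_space \<iota>" "\<xi> = \<Lambda> b" by blast
  then show ?thesis
    by (simp add: J_Lambda B_space_A_inf F_Lambda B_adj)
next
  case False
  have "J \<xi> \<notin> \<Lambda> ` B_space \<iota>"
  proof
    assume "J \<xi> \<in> \<Lambda> ` B_space \<iota>"
    then obtain b where b: "b \<in> B_space \<iota>" "J \<xi> = \<Lambda> b" by blast
    then have "\<xi> = \<Lambda> (adj b)"
      using J_J[of \<xi>] J_Lambda[OF B_space_A_inf[OF b(1)]] by simp
    then show False using False B_adj(1)[OF b(1)] by blast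
  qed
  then show ?thesis using False by (simp add: F_infinity)
qed

text \<open>Otherwise terms arbitrarily far out have energy below some C < F \<xi>. They are L^2
  Cauchy with bounded energy, so \<open>energy_bounded_L2_Cauchy\<close> identifies \<xi> as the
  image of an element of energy at most C.\<close>

lemma F_lsc:
  assumes X: "X \<longlonglongrightarrow> \<xi>"
  shows "F \<xi> \<le> liminf (\<lambda>n. F (X n))"
proof (rule ccontr)
  assume "\<not> ?thesis"
  then obtain C where C: "liminf (\<lambda>n. F (X n)) < ereal C" "ereal C < F \<xi>"
    using ereal_dense2 by (metis not_le)
  have "\<exists>n\<ge>N. F (X n) < ereal C" for N
  proof (rule ccontr)
    assume "\<not> ?thesis"
    then have "\<forall>\<^sub>F n in sequentially. ereal C \<le> F (X n)"
      by (intro eventually_sequentiallyI[of N]) (simp add: not_less)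
    then have "ereal C \<le> liminf (\<lambda>n. F (X n))"
      by (rule Liminf_bounded)
    then show False using C(1) by simp
  qed
  \<comment> \<open>r may fail to be increasing; \<open>r N \<ge> N\<close> suffices for convergence
    along it.\<close>
  then obtain r where r: "\<And>N. r N \<ge> N" "\<And>N. F (X (r N)) < ereal C" by metis
  have "filterlim r at_top sequentially"
    by (rule filterlim_at_top_mono[OF filterlim_ident]) (simp add: r(1))
  then have Xr: "(\<lambda>k. X (r k)) \<longlonglongrightarrow> \<xi>"
    by (rule filterlim_compose[OF X])
  have "\<exists>b. b \<in> B_space \<iota> \<and> \<Lambda> b = X (r k)" for k
  proof -
    have "X (r k) \<in> \<Lambda> ` B_space \<iota>"
    proof (rule ccontr)
      assume "X (r k) \<notin> \<Lambda> ` B_space \<iota>"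
      from F_infinity[OF this] show False using r(2)[of k] by simp
    qed
    then show ?thesis by (elim imageE) auto
  qed
  then obtain b where b: "\<And>k. b k \<in> B_space \<iota>" "\<And>k. \<Lambda> (b k) = X (r k)" by metis
  have En: "En (b k) \<le> C" for k
    using r(2)[of k] F_Lambda[OF b(1), of k] energy_inf_En[OF b(1), of k] by (simp add: b(2))
  have n2_eq: "n2 (b i - b j) = norm (X (r i) - X (r j))" for i j
    using norm_Lambda_diff[OF B_space_A_inf B_space_A_inf, OF b(1) b(1)] by (simp add: b(2))
  have "\<exists>K. \<forall>i\<ge>K. \<forall>j\<ge>K. n2 (b i - b j) < e" if "e > 0" for e
    unfolding n2_eq by (rule CauchyD[OF LIMSEQ_imp_Cauchy[OF Xr] that])
  then obtain a where a: "b \<longlonglongrightarrow> a" "a \<in> B_space \<iota>" "En a \<le> C"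
    using energy_bounded_L2_Cauchy[of b C, OF b(1) En] by metis
  have "(\<lambda>k. X (r k)) \<longlonglongrightarrow> \<Lambda> a"
    using Lambda_tendsto[OF B_space_A_inf[OF b(1)] B_space_A_inf[OF a(2)] a(1)] by (simp add: b(2))
  then have "\<xi> = \<Lambda> a" by (rule LIMSEQ_unique[OF Xr])
  then have "F \<xi> \<le> ereal C" using a by (simp add: F_Lambda energy_inf_En)
  then show False using C(2) by simp
qed

text \<open>By cyclicity the trace of (adj a) a t t is that of a t times its adjoint, hence
  nonnegative; limits cover the whole cone.\<close>

lemma inner_L2_pos_nonneg:
  assumes p: "p \<in> L2_pos (A_inf \<iota>) \<Lambda>" and t: "t \<in> A_inf \<iota>" "adj t = t"
  shows "0 \<le> inner p (\<Lambda> (t * t))"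
proof -
  obtain y where y: "\<And>n. y n \<in> (\<lambda>a. \<Lambda> (adj a * a)) ` A_inf \<iota>" "y \<longlonglongrightarrow> p"
    using p unfolding L2_pos_def closure_sequential by blast
  have tt: "t * t \<in> A_inf \<iota>" by (rule A_infD(5)[OF t(1) t(1)])
  have "0 \<le> inner (y n) (\<Lambda> (t * t))" for n
  proof -
    obtain a where a: "a \<in> A_inf \<iota>" "y n = \<Lambda> (adj a * a)" using y(1)[of n] by blast
    have "inner (y n) (\<Lambda> (t * t)) = Re (tr (adj (adj a * a) * (t * t)))"
      unfolding a(2) by (rule inner_Lambda[OF A_infD(5)[OF A_infD(9)[OF a(1)] a(1)] tt])
    also have "adj (adj a * a) * (t * t) = adj a * (a * t * t)"
      by (simp add: adj_mult adj_adj mult.assoc)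
    also have "tr \<dots> = tr (a * t * t * adj a)" by (rule tr_commute)
    also have "a * t * t * adj a = adj (adj (a * t)) * adj (a * t)"
      by (simp add: adj_adj adj_mult t(2) mult.assoc)
    finally show ?thesis by (simp only: Re_tr_nonneg)
  qed
  moreover have "(\<lambda>n. inner (y n) (\<Lambda> (t * t))) \<longlonglongrightarrow> inner p (\<Lambda> (t * t))"
    by (intro tendsto_inner y tendsto_const)
  ultimately show ?thesis
    by (intro LIMSEQ_le_const[of "\<lambda>n. inner (y n) (\<Lambda> (t * t))"]) blast+
qed

text \<open>Obtuse angle criterion for the projection: the residue of b is t t, and the vector from
  k to 1 - s s, which is (1 - k) - s s, has nonnegative inner product with t t, since 1 - k is
  positive and s s is orthogonal to t t.\<close>

lemma wedge_one_Lambda: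
  assumes b: "b \<in> A_inf \<iota>" and A: "s \<in> A_inf \<iota>" "t \<in> A_inf \<iota>" and adj: "adj s = s" "adj t = t"
    and dec: "1 - b = s * s - t * t" and orth: "(s * s) * (t * t) = 0"
  shows "wedge_one (A_inf \<iota>) \<Lambda> (\<Lambda> b) = \<Lambda> (1 - s * s)"
proof -
  define K where "K = L2_le_one (A_inf \<iota>) \<Lambda>"
  have AA: "1 \<in> A_inf \<iota>" "s * s \<in> A_inf \<iota>" "t * t \<in> A_inf \<iota>" "1 - s * s \<in> A_inf \<iota>"
    by (intro A_infD A)+
  have one_diff: "\<Lambda> 1 - \<Lambda> (1 - s * s) = \<Lambda> (s * s)"
    unfolding Lambda_diff[OF AA(1,4), symmetric] by simp
  have wK: "\<Lambda> (1 - s * s) \<in> K"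
    unfolding K_def L2_le_one_def
  proof (intro CollectI conjI)
    show "J (\<Lambda> (1 - s * s)) = \<Lambda> (1 - s * s)"
      unfolding J_Lambda[OF AA(4)] by (simp add: adj_diff adj_mult adj)
    have "\<Lambda> (adj s * s) \<in> (\<lambda>a. \<Lambda> (adj a * a)) ` A_inf \<iota>"
      using A(1) by (rule imageI)
    from subsetD[OF closure_subset this]
    show "\<Lambda> 1 - \<Lambda> (1 - s * s) \<in> L2_pos (A_inf \<iota>) \<Lambda>"
      by (simp only: one_diff L2_pos_def adj(1))
  qed
  have Lb: "\<Lambda> b = \<Lambda> 1 - (\<Lambda> (s * s) - \<Lambda> (t * t))"
  proof -
    have "b = 1 - (s * s - t * t)" unfolding dec[symmetric] by simp
    then show ?thesis
      using Lambda_diff[OF AA(1) A_infD(6)[OF AA(2,3)]] Lambda_diff[OF AA(2,3)] by simp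
  qed
  have orth': "inner (\<Lambda> (s * s)) (\<Lambda> (t * t)) = 0"
    unfolding inner_Lambda[OF AA(2,3)] adj_mult adj orth using tr_scaleC[of 0 0] by simp
  \<comment> \<open>Stronger than minimality: the extra square on the left also yields the
    uniqueness that the definite description in \<open>hilbert_proj\<close> requires.\<close>
  have key: "(dist (\<Lambda> b) (\<Lambda> (1 - s * s)))\<^sup>2 + (norm (k - \<Lambda> (1 - s * s)))\<^sup>2 \<le> (dist (\<Lambda> b) k)\<^sup>2" if "k \<in> K" for k
  proof -
    define p where "p = \<Lambda> 1 - k"
    define v where "v = p - \<Lambda> (s * s)"
    have p: "p \<in> L2_pos (A_inf \<iota>) \<Lambda>" using that by (simp add: K_def L2_le_one_def p_def)
    have e1: "\<Lambda> b - \<Lambda> (1 - s * s) = \<Lambda> (t * t)"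
      using one_diff unfolding Lb by (simp add: algebra_simps)
    have e2: "\<Lambda> b - k = v + \<Lambda> (t * t)"
      unfolding Lb v_def p_def by (simp add: algebra_simps)
    have e3: "k - \<Lambda> (1 - s * s) = - v"
      using one_diff unfolding v_def p_def by (simp add: algebra_simps)
    have "0 \<le> inner v (\<Lambda> (t * t))"
      unfolding v_def inner_diff_left orth' using inner_L2_pos_nonneg[OF p A(2) adj(2)] by simp
    then show ?thesis
      unfolding dist_norm e1 e2 e3 power2_norm_eq_inner
      by (simp add: inner_add_left inner_add_right inner_commute)
  qed
  have "hilbert_proj K (\<Lambda> b) = \<Lambda> (1 - s * s)"
    unfolding hilbert_proj_def
  proof (rule the_equality)
    have "dist (\<Lambda> b) (\<Lambda> (1 - s * s)) \<le> dist (\<Lambda> b) k" if "k \<in> K" for k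
      using key[OF that] by (intro power2_le_imp_le[OF _ zero_le_dist]) (smt (verit) zero_le_power2)
    then show "\<Lambda> (1 - s * s) \<in> K \<and> (\<forall>k\<in>K. dist (\<Lambda> b) (\<Lambda> (1 - s * s)) \<le> dist (\<Lambda> b) k)"
      using wK by blast
    fix h assume h: "h \<in> K \<and> (\<forall>k\<in>K. dist (\<Lambda> b) h \<le> dist (\<Lambda> b) k)"
    then have "(dist (\<Lambda> b) h)\<^sup>2 \<le> (dist (\<Lambda> b) (\<Lambda> (1 - s * s)))\<^sup>2"
      using wK by (intro power_mono) auto
    then have "(norm (h - \<Lambda> (1 - s * s)))\<^sup>2 \<le> 0"
      using key[of h] h by linarith
    then show "h = \<Lambda> (1 - s * s)" by simp
  qed
  then show ?thesis
    by (simp add: wedge_one_def K_def)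
qed

text \<open>Injectivity of the embedding turns J \<xi> = \<xi> into adj b = b. The constant 1 drops
  out of the energy, so passing from b to 1 - s s amounts to passing from s s - t t to s s.\<close>

lemma F_wedge_one:
  assumes J: "J \<xi> = \<xi>"
  shows "F (wedge_one (A_inf \<iota>) \<Lambda> \<xi>) \<le> F \<xi>"
proof (cases "\<xi> \<in> \<Lambda> ` B_space \<iota>")
  case True
  then obtain b where b: "b \<in> B_space \<iota>" "\<xi> = \<Lambda> b" by blast
  have bA: "b \<in> A_inf \<iota>" by (rule B_space_A_inf[OF b(1)])
  have "\<Lambda> (adj b) = \<Lambda> b"
    using J J_Lambda[OF bA] b(2) by simp
  then have "adj b = b"
    using Lambda_inject[OF A_infD(9)[OF bA] bA] by simp
  then have c: "1 - b \<in> A_inf \<iota>" "adj (1 - b) = 1 - b"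
    using A_infD(6)[OF A_infD(2) bA] by (simp_all add: adj_diff)
  obtain s t where st: "s \<in> A_inf \<iota>" "t \<in> A_inf \<iota>" "adj s = s" "adj t = t" "1 - b = s * s - t * t"
    "(s * s) * (t * t) = 0"
    using cstar_pos_neg_parts[OF cstar_sub_A_inf c norm_one_minus_square_le] by metis
  have wA: "1 - s * s \<in> A_inf \<iota>" by (intro A_infD st)
  have le: "en m (1 - s * s) \<le> en m b" for m
    using energy_pos_part[OF st(1-4,6), of m] unfolding st(5)[symmetric] en_one_minus .
  have wB: "1 - s * s \<in> B_space \<iota>"
    by (rule B_spaceI[OF wA]) (rule order_trans[OF le en_le_En[OF b(1)]])
  show ?thesis
    unfolding b(2) wedge_one_Lambda[OF bA st] F_Lambda[OF wB] F_Lambda[OF b(1)]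
    by (rule energy_inf_mono[OF wA bA le])
qed (simp add: F_infinity)

lemma dirichlet_form_F: "is_symmetric_dirichlet_form (A_inf \<iota>) \<Lambda> F"
  unfolding is_symmetric_dirichlet_form_def
  using closure_form_domain quadratic_F F_nonneg F_lsc F_J F_wedge_one by blast

lemma dirichlet_algebra_F: "dirichlet_algebra (A_inf \<iota>) \<Lambda> F = B_space \<iota>"
  unfolding dirichlet_algebra_def form_domain_F using B_space_A_inf Lambda_inject by blast

end

theorem theorem4p8:
  fixes \<iota> :: "nat \<Rightarrow> complex mat \<Rightarrow> 'u::cstar_algebra_1"
    and \<Lambda> :: "'u \<Rightarrow> 'h::complex_hilbert"
  assumes "is_uhf3 \<iota>"
    and "is_gns (A_inf \<iota>) (uhf_trace \<iota>) \<Lambda>"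
  shows "(is_subalgebra (B_space \<iota>) \<and>
          is_norm_on (B_space \<iota>) (B_norm \<iota>) \<and> complete_for (B_space \<iota>) (B_norm \<iota>)) \<and>
         is_symmetric_dirichlet_form (A_inf \<iota>) \<Lambda> (energy_L2 \<iota> \<Lambda>) \<and>
         (\<Lambda> ` dirichlet_algebra (A_inf \<iota>) \<Lambda> (energy_L2 \<iota> \<Lambda>) = dirichlet_space (energy_L2 \<iota> \<Lambda>) \<and>
          dirichlet_algebra (A_inf \<iota>) \<Lambda> (energy_L2 \<iota> \<Lambda>) = B_space \<iota> \<and>
          dirichlet_space (energy_L2 \<iota> \<Lambda>) = \<Lambda> ` B_space \<iota>)"
proof -
  interpret uhf3_gns \<iota> \<Lambda>
    by unfold_locales (fact assms)+
  have "is_subalgebra (B_space \<iota>)"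
    unfolding is_subalgebra_def using zero_B B_add B_mult B_scaleC by blast
  then show ?thesis
    using is_norm_on_B complete_B dirichlet_form_F dirichlet_algebra_F
    by (simp add: dirichlet_space_def form_domain_F)
qed

end
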